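(* Let $G = SU(2)\ltimes\mathbb{H}$, let $p$ be a prime, let $e^{i\beta}$ be a primitive $p$-th root of unity, and let $\Gamma_\beta = \langle A_\beta\rangle\ltimes\mathbb{Z}^4$ be the corresponding discrete subgroup of $G$ (defined in the context). Then the quotient $M_\beta = G/\Gamma_\beta$ is a compact manifold, and $M_\beta$ has an invariant weakly integrable generalized $G_2$-structure with respect to a closed $3$-form $H$.
   Context: The group. $\mathbb{H}\cong\mathbb{R}^4$ denotes the quaternions and $SU(2)$ is identified with the group of unit quaternions. The Lie group $G = SU(2)\ltimes\mathbb{H}$ has the product $(A,q)\cdot(A',q') = (AA', Aq'+q)$ for $A,A'\in SU(2)$, $q,q'\in\mathbb{H}$, where $Aq'$ is quaternionic multiplication (equivalently the standard action of $SU(2)$ on $\mathbb{C}^2\cong\mathbb{H}$). The quotient. $\langle A_\beta\rangle\subset SU(2)$ is the cyclic subgroup generated by $A_\beta = \begin{pmatrix} e^{i\beta} & 0\\ 0 & e^{-i\beta}\end{pmatrix}$, and $\Gamma_\beta = \langle A_\beta\rangle\ltimes\mathbb{Z}^4 = \{(A_\beta^m, r) : m\in\mathbb{Z},\ r\in\mathbb{Z}^4\}$, with $\mathbb{Z}^4\subset\mathbb{R}^4\cong\mathbb{H}$; it is taken to be a discrete subgroup of $G$ (the semidirect product notation presupposes that $A_\beta$ maps $\mathbb{Z}^4$ to itself). The quotient $M_\beta = G/\Gamma_\beta$ is the space of orbits of $\Gamma_\beta$ acting on $G$ by left translations, i.e. the class of $(A',q')$ is $\{(A_\beta^m A', A_\beta^m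 q'+r) : m\in\mathbb{Z},\ r\in\mathbb{Z}^4\}$. A structure on $M_\beta$ is called invariant if it is induced by left-invariant forms on $G$. Generalized $G_2$-structures. Throughout, generalized $G_2$-structures have constant dilaton and trivial $B$-field, and their two unit spinors form the angle $\pi/2$. Such a structure on a $7$-manifold $M$ is given by an $SU(3)$-structure ($SU(3)\cong SU(3)\times\{1\}\subset SO(7)$), i.e. a $1$-form $\alpha$, a $2$-form $\omega$ and $3$-forms $\psi_\pm$ such that locally there is a coframe $(e^1,\dots,e^7)$ (declared orthonormal) with $\alpha = e^7$, $$\omega = e^{12}+e^{34}+e^{56},\quad \psi_+ + i\psi_- = (e^1+ie^2)\wedge(e^3+ie^4)\wedge(e^5+ie^6),$$ where $e^{ij\cdots} = e^i\wedge e^j\wedge\cdots$. The associated mixed-degree forms are $$\rho^{ev} = \omega + \psi_+\wedge\alpha - \tfrac16\omega^3,\qquad \rho^{od} = \alpha - \psi_- - \tfrac12\omega^2\wedge\alpha .$$ The structure form $\rho$ is one of $\rho^{ev}$ (even type) or $\rho^{od}$ (odd type), and its companion $\hat\rho$ is the other one. Weak integrability. For a $3$-form $H$ put $d_H\gamma = d\gamma + H\wedge\gamma$. The generalized $G_2$-structure with structure form $\rho$ is weakly integrable with respect to $H$ if $d_H\rho = \lambda\hat\rho$ for some real constant $\lambda\neq 0$. *)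

theory Defs
  imports
    "HOL-Analysis.Analysis"
    "HOL-Algebra.Coset"
    "HOL-Computational_Algebra.Primes"
begin

section \<open>Smooth manifolds and differential forms\<close>

text \<open>On an open set \<^term>\<open>W\<close> of a finite-dimensional space this is the usual notion of a
  \<open>k\<close> times continuously differentiable map.\<close>

primrec Ck_on :: "nat \<Rightarrow> 'x::real_normed_vector set \<Rightarrow> ('x \<Rightarrow> 'y::real_normed_vector) \<Rightarrow> bool" where
  "Ck_on 0 W f \<longleftrightarrow> continuous_on W f"
| "Ck_on (Suc k) W f \<longleftrightarrow>
     (\<forall>x\<in>W. f differentiable (at x)) \<and> (\<forall>v. Ck_on k W (\<lambda>x. frechet_derivative f (at x) v))"

text \<open>Smoothness on an arbitrary subset of a Euclidean space means that smooth extensions to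
  open neighbourhoods exist locally; on an open set this is ordinary smoothness.\<close>

definition smooth_on :: "'x::real_normed_vector set \<Rightarrow> ('x \<Rightarrow> 'y::real_normed_vector) \<Rightarrow> bool" where
  "smooth_on S f \<longleftrightarrow>
     (\<forall>x\<in>S. \<exists>W F. open W \<and> x \<in> W \<and> (\<forall>k. Ck_on k W F) \<and> (\<forall>y\<in>S \<inter> W. F y = f y))"

text \<open>A chart is a pair of its domain and a coordinate map, of which only the values on the
  domain matter.\<close>

type_synonym ('p, 'e) chart = "'p set \<times> ('p \<Rightarrow> 'e)"

definition chart_image :: "('p, 'e) chart \<Rightarrow> 'e set" where
  "chart_image c = snd c ` fst c"

definition chart_inv :: "('p, 'e) chart \<Rightarrow> 'e \<Rightarrow> 'p" where
  "chart_inv c = inv_into (fst c) (snd c)"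

text \<open>The dimension of the manifold is that of the model space \<^typ>\<open>'e\<close>.\<close>

definition smooth_manifold :: "'p topology \<Rightarrow> ('p, 'e::euclidean_space) chart set \<Rightarrow> bool" where
  "smooth_manifold X A \<longleftrightarrow>
     Hausdorff_space X \<and> second_countable X \<and>
     (\<Union>c\<in>A. fst c) = topspace X \<and>
     (\<forall>c\<in>A. openin X (fst c) \<and> open (chart_image c) \<and>
        homeomorphic_map (subtopology X (fst c)) (top_of_set (chart_image c)) (snd c)) \<and>
     (\<forall>c\<in>A. \<forall>d\<in>A. smooth_on (snd c ` (fst c \<inter> fst d)) (snd d \<circ> chart_inv c))"

text \<open>The canonical atlas of an embedded submanifold: all diffeomorphisms from relatively open
  subsets of \<^term>\<open>S\<close> onto open subsets of the model space.\<close>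

definition embedded_atlas :: "'x::euclidean_space set \<Rightarrow> ('x, 'e::euclidean_space) chart set" where
  "embedded_atlas S =
     {c. openin (top_of_set S) (fst c) \<and> inj_on (snd c) (fst c) \<and> open (chart_image c) \<and>
         smooth_on (fst c) (snd c) \<and> smooth_on (chart_image c) (chart_inv c)}"

definition quotient_topology :: "'p topology \<Rightarrow> ('p \<Rightarrow> 'q) \<Rightarrow> 'q topology" where
  "quotient_topology X \<pi> =
     topology (\<lambda>U. U \<subseteq> \<pi> ` topspace X \<and> openin X {x \<in> topspace X. \<pi> x \<in> U})"

lemma openin_quotient_topology:
  "openin (quotient_topology X \<pi>) U \<longleftrightarrow>
     U \<subseteq> \<pi> ` topspace X \<and> openin X {x \<in> topspace X. \<pi> x \<in> U}"
proof -
  have "istopology (\<lambda>U. U \<subseteq> \<pi> ` topspace X \<and> openin X {x \<in> topspace X. \<pi> x \<in> U})"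
    unfolding istopology_def
  proof (intro conjI allI impI)
    fix S T
    assume S: "S \<subseteq> \<pi> ` topspace X \<and> openin X {x \<in> topspace X. \<pi> x \<in> S}"
      and T: "T \<subseteq> \<pi> ` topspace X \<and> openin X {x \<in> topspace X. \<pi> x \<in> T}"
    have "{x \<in> topspace X. \<pi> x \<in> S \<inter> T} =
        {x \<in> topspace X. \<pi> x \<in> S} \<inter> {x \<in> topspace X. \<pi> x \<in> T}" by auto
    then show "openin X {x \<in> topspace X. \<pi> x \<in> S \<inter> T}" using S T by auto
    show "S \<inter> T \<subseteq> \<pi> ` topspace X" using S by auto
  next
    fix \<K>
    assume K: "\<forall>K\<in>\<K>. K \<subseteq> \<pi> ` topspace X \<and> openin X {x \<in> topspace X. \<pi> x \<in> K}"
    have "{x \<in> topspace X. \<pi> x \<in> \<Union>\<K>} = (\<Union>K\<in>\<K>. {x \<in> topspace X. \<pi> x \<in> K})" by auto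
    then show "openin X {x \<in> topspace X. \<pi> x \<in> \<Union>\<K>}" using K by auto
    show "\<Union>\<K> \<subseteq> \<pi> ` topspace X" using K by auto
  qed
  then show ?thesis unfolding quotient_topology_def by (simp add: topology_inverse')
qed

text \<open>The smooth structure that makes the projection \<open>\<pi>\<close> a local diffeomorphism: its charts are
  the compositions of charts upstairs with local inverses of \<open>\<pi>\<close>.\<close>

definition quotient_atlas :: "('p, 'e) chart set \<Rightarrow> ('p \<Rightarrow> 'q) \<Rightarrow> ('q, 'e) chart set" where
  "quotient_atlas A \<pi> = {(\<pi> ` fst c, snd c \<circ> inv_into (fst c) \<pi>) | c. c \<in> A \<and> inj_on \<pi> (fst c)}"

text \<open>A mixed-degree form at a point is a function on lists of tangent vectors; its degree \<open>k\<close>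
  part is the restriction to lists of length \<open>k\<close>.\<close>

type_synonym ('v, 'b) form = "'v list \<Rightarrow> 'b"

definition alternating_form :: "nat \<Rightarrow> ('v::real_vector, real) form \<Rightarrow> bool" where
  "alternating_form k a \<longleftrightarrow>
     (\<forall>vs. length vs \<noteq> k \<longrightarrow> a vs = 0) \<and>
     (\<forall>vs. \<forall>i<length vs. linear (\<lambda>v. a (vs[i := v]))) \<and>
     (\<forall>vs. \<forall>i<length vs. \<forall>j<length vs. i \<noteq> j \<and> vs ! i = vs ! j \<longrightarrow> a vs = 0)"

text \<open>The wedge product as a signed sum over shuffles, so that
  \<open>(a \<and> b)(v, w) = a(v) b(w) - a(w) b(v)\<close> for \<open>1\<close>-forms.\<close>

definition wedge :: "('v, 'b::comm_ring_1) form \<Rightarrow> ('v, 'b) form \<Rightarrow> ('v, 'b) form"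
    (infixr \<open>\<and>\<^sub>w\<close> 75) where
  "(a \<and>\<^sub>w b) vs =
     (\<Sum>I\<in>Pow {..<length vs}.
        (-1) ^ card {(i, j). i \<in> I \<and> j < i \<and> j \<notin> I} * a (nths vs I) * b (nths vs (- I)))"

text \<open>The exterior derivative of a form on an open subset of the model space,
  \<open>d\<omega>(v\<^sub>0, \<dots>, v\<^sub>k) = \<Sum>\<^sub>i (-1)\<^sup>i D\<omega>(v\<^sub>i)(v\<^sub>0, \<dots>, omit v\<^sub>i, \<dots>, v\<^sub>k)\<close>.\<close>

definition ext_deriv ::
    "('v::real_normed_vector \<Rightarrow> ('v, real) form) \<Rightarrow> 'v \<Rightarrow> ('v, real) form" where
  "ext_deriv \<omega> x vs =
     (\<Sum>i<length vs.
        (-1) ^ i * frechet_derivative (\<lambda>y. \<omega> y (take i vs @ drop (Suc i) vs)) (at x) (vs ! i))"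

text \<open>A form on a manifold is the family of its local representatives in the charts.\<close>

type_synonym ('p, 'e) mform = "('p, 'e) chart \<Rightarrow> 'e \<Rightarrow> ('e, real) form"

text \<open>\<open>pulls_back A B f \<eta> \<omega>\<close> says \<open>f\<^sup>*\<eta> = \<omega>\<close>, where \<^term>\<open>A\<close> and \<^term>\<open>B\<close> are the atlases of
  the domain and the codomain of \<^term>\<open>f\<close>.\<close>

definition pulls_back ::
    "('p, 'e::euclidean_space) chart set \<Rightarrow> ('q, 'e) chart set \<Rightarrow> ('p \<Rightarrow> 'q) \<Rightarrow>
     ('q, 'e) mform \<Rightarrow> ('p, 'e) mform \<Rightarrow> bool" where
  "pulls_back A B f \<eta> \<omega> \<longleftrightarrow>
     (\<forall>c\<in>A. \<forall>d\<in>B. \<forall>p\<in>fst c. f p \<in> fst d \<longrightarrow>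
        (\<forall>vs. \<omega> c (snd c p) vs =
           \<eta> d (snd d (f p))
             (map (frechet_derivative (snd d \<circ> f \<circ> chart_inv c) (at (snd c p))) vs)))"

definition diff_form :: "('p, 'e::euclidean_space) chart set \<Rightarrow> nat \<Rightarrow> ('p, 'e) mform \<Rightarrow> bool" where
  "diff_form A k \<omega> \<longleftrightarrow>
     (\<forall>c\<in>A. (\<forall>x\<in>chart_image c. alternating_form k (\<omega> c x)) \<and>
             (\<forall>vs. smooth_on (chart_image c) (\<lambda>x. \<omega> c x vs))) \<and>
     pulls_back A A id \<omega> \<omega>"

definition closed_form :: "('p, 'e::euclidean_space) chart set \<Rightarrow> ('p, 'e) mform \<Rightarrow> bool" where
  "closed_form A \<omega> \<longleftrightarrow> (\<forall>c\<in>A. \<forall>x\<in>chart_image c. \<forall>vs. ext_deriv (\<omega> c) x vs = 0)"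


section \<open>Generalized \<open>G\<^sub>2\<close>-structures with constant dilaton, trivial \<open>B\<close>-field and angle \<open>\<pi>/2\<close>\<close>

definition cform :: "('v, real) form \<Rightarrow> ('v, real) form \<Rightarrow> ('v, complex) form" where
  "cform a b vs = Complex (a vs) (b vs)"

definition local_coframe :: "(real^7) set \<Rightarrow> (nat \<Rightarrow> real^7 \<Rightarrow> (real^7, real) form) \<Rightarrow> bool" where
  "local_coframe W e \<longleftrightarrow>
     (\<forall>i\<in>{1..7}. (\<forall>x\<in>W. alternating_form 1 (e i x)) \<and> (\<forall>vs. smooth_on W (\<lambda>x. e i x vs))) \<and>
     (\<forall>x\<in>W. \<forall>a::nat \<Rightarrow> real.
        (\<forall>vs. (\<Sum>i\<in>{1..7}. a i * e i x vs) = 0) \<longrightarrow> (\<forall>i\<in>{1..7}. a i = 0))"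

text \<open>\<open>\<alpha> = e\<^sup>7\<close>, \<open>\<omega> = e\<^sup>1\<^sup>2 + e\<^sup>3\<^sup>4 + e\<^sup>5\<^sup>6\<close> and
  \<open>\<psi>\<^sub>+ + i\<psi>\<^sub>- = (e\<^sup>1 + ie\<^sup>2) \<and> (e\<^sup>3 + ie\<^sup>4) \<and> (e\<^sup>5 + ie\<^sup>6)\<close> at a point.\<close>

definition SU3_adapted ::
    "(nat \<Rightarrow> ('v, real) form) \<Rightarrow>
     ('v, real) form \<Rightarrow> ('v, real) form \<Rightarrow> ('v, real) form \<Rightarrow> ('v, real) form \<Rightarrow> bool" where
  "SU3_adapted e \<alpha> \<omega> \<psi>p \<psi>m \<longleftrightarrow>
     \<alpha> = e 7 \<and>
     \<omega> = (\<lambda>vs. (e 1 \<and>\<^sub>w e 2) vs + (e 3 \<and>\<^sub>w e 4) vs + (e 5 \<and>\<^sub>w e 6) vs) \<and>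
     cform \<psi>p \<psi>m = cform (e 1) (e 2) \<and>\<^sub>w cform (e 3) (e 4) \<and>\<^sub>w cform (e 5) (e 6)"

definition generalized_G2_structure ::
    "('p, real^7) chart set \<Rightarrow>
     ('p, real^7) mform \<Rightarrow> ('p, real^7) mform \<Rightarrow> ('p, real^7) mform \<Rightarrow> ('p, real^7) mform \<Rightarrow> bool"
  where
  "generalized_G2_structure A \<alpha> \<omega> \<psi>p \<psi>m \<longleftrightarrow>
     diff_form A 1 \<alpha> \<and> diff_form A 2 \<omega> \<and> diff_form A 3 \<psi>p \<and> diff_form A 3 \<psi>m \<and>
     (\<forall>c\<in>A. \<forall>x\<in>chart_image c. \<exists>W e. open W \<and> x \<in> W \<and> W \<subseteq> chart_image c \<and> local_coframe W e \<and>
        (\<forall>y\<in>W. SU3_adapted (\<lambda>i. e i y) (\<alpha> c y) (\<omega> c y) (\<psi>p c y) (\<psi>m c y)))"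

definition rho_ev ::
    "('p, 'e) mform \<Rightarrow> ('p, 'e) mform \<Rightarrow> ('p, 'e) mform \<Rightarrow> ('p, 'e) mform \<Rightarrow> ('p, 'e) mform" where
  "rho_ev \<alpha> \<omega> \<psi>p \<psi>m c x vs =
     \<omega> c x vs + (\<psi>p c x \<and>\<^sub>w \<alpha> c x) vs - 1/6 * (\<omega> c x \<and>\<^sub>w \<omega> c x \<and>\<^sub>w \<omega> c x) vs"

definition rho_od ::
    "('p, 'e) mform \<Rightarrow> ('p, 'e) mform \<Rightarrow> ('p, 'e) mform \<Rightarrow> ('p, 'e) mform \<Rightarrow> ('p, 'e) mform" where
  "rho_od \<alpha> \<omega> \<psi>p \<psi>m c x vs =
     \<alpha> c x vs - \<psi>m c x vs - 1/2 * (\<omega> c x \<and>\<^sub>w \<omega> c x \<and>\<^sub>w \<alpha> c x) vs"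

definition twisted_deriv ::
    "('p, 'e::euclidean_space) mform \<Rightarrow> ('p, 'e) mform \<Rightarrow> ('p, 'e) mform" where
  "twisted_deriv H \<rho> c x vs = ext_deriv (\<rho> c) x vs + (H c x \<and>\<^sub>w \<rho> c x) vs"

definition weakly_integrable_form ::
    "('p, 'e::euclidean_space) chart set \<Rightarrow>
     ('p, 'e) mform \<Rightarrow> ('p, 'e) mform \<Rightarrow> ('p, 'e) mform \<Rightarrow> bool" where
  "weakly_integrable_form A H \<rho> \<rho>' \<longleftrightarrow>
     (\<exists>l::real. l \<noteq> 0 \<and>
        (\<forall>c\<in>A. \<forall>x\<in>chart_image c. \<forall>vs. twisted_deriv H \<rho> c x vs = l * \<rho>' c x vs))"

text \<open>The structure form may be of even or of odd type.\<close>

definition weakly_integrable ::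
    "('p, real^7) chart set \<Rightarrow> ('p, real^7) mform \<Rightarrow>
     ('p, real^7) mform \<Rightarrow> ('p, real^7) mform \<Rightarrow> ('p, real^7) mform \<Rightarrow> ('p, real^7) mform \<Rightarrow> bool"
  where
  "weakly_integrable A H \<alpha> \<omega> \<psi>p \<psi>m \<longleftrightarrow>
     weakly_integrable_form A H (rho_ev \<alpha> \<omega> \<psi>p \<psi>m) (rho_od \<alpha> \<omega> \<psi>p \<psi>m) \<or>
     weakly_integrable_form A H (rho_od \<alpha> \<omega> \<psi>p \<psi>m) (rho_ev \<alpha> \<omega> \<psi>p \<psi>m)"


section \<open>The group \<open>SU(2) \<ltimes> \<bbbH>\<close> and its quotients\<close>

text \<open>The quaternion \<open>a + bi + cj + dk\<close> is the vector with components \<open>a, b, c, d\<close>.\<close>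

type_synonym quat = "real^4"

definition qmult :: "quat \<Rightarrow> quat \<Rightarrow> quat" (infixl \<open>\<bullet>\<^sub>q\<close> 70) where
  "a \<bullet>\<^sub>q b = vector
     [a$1 * b$1 - a$2 * b$2 - a$3 * b$3 - a$4 * b$4,
      a$1 * b$2 + a$2 * b$1 + a$3 * b$4 - a$4 * b$3,
      a$1 * b$3 - a$2 * b$4 + a$3 * b$1 + a$4 * b$2,
      a$1 * b$4 + a$2 * b$3 - a$3 * b$2 + a$4 * b$1]"

text \<open>The complex matrix of a quaternion; it identifies the unit quaternions with \<open>SU(2)\<close>, and its
  first column identifies \<open>\<bbbH>\<close> with \<open>\<complex>\<^sup>2\<close> in such a way that \<open>SU(2)\<close> acts in the standard way.\<close>

definition quat_mat :: "quat \<Rightarrow> complex^2^2" where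
  "quat_mat a = vector
     [vector [Complex (a$1) (a$2), Complex (a$3) (a$4)],
      vector [- cnj (Complex (a$3) (a$4)), cnj (Complex (a$1) (a$2))]]"

definition SU2 :: "quat monoid" where
  "SU2 = \<lparr>carrier = {a. norm a = 1}, mult = (\<bullet>\<^sub>q), one = vector [1, 0, 0, 0]\<rparr>"

definition SU2_ltimes_H :: "(quat \<times> quat) monoid" where
  "SU2_ltimes_H =
     \<lparr>carrier = {a. norm a = 1} \<times> UNIV,
      mult = (\<lambda>(A, q) (A', q'). (A \<bullet>\<^sub>q A', A \<bullet>\<^sub>q q' + q)),
      one = (vector [1, 0, 0, 0], 0)\<rparr>"

definition A_beta :: "real \<Rightarrow> quat" where
  "A_beta \<beta> = vector [cos \<beta>, sin \<beta>, 0, 0]"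

definition integer_lattice :: "(real^4) set" where
  "integer_lattice = {r. \<forall>i. r $ i \<in> \<int>}"

text \<open>\<open>\<phi>\<close> is the identification \<open>\<real>\<^sup>4 \<cong> \<bbbH>\<close> through which \<open>\<int>\<^sup>4\<close> is regarded as a subset of \<open>\<bbbH>\<close>;
  the one by components is \<^term>\<open>id\<close>.\<close>

definition Gamma_beta :: "(real^4 \<Rightarrow> quat) \<Rightarrow> real \<Rightarrow> (quat \<times> quat) set" where
  "Gamma_beta \<phi> \<beta> = {(A_beta \<beta> [^]\<^bsub>SU2\<^esub> (m::int), \<phi> r) | m r. r \<in> integer_lattice}"

text \<open>The orbit of a group element under left translations by \<open>\<Gamma>\<^sub>\<beta>\<close>.\<close>

definition M_proj :: "(real^4 \<Rightarrow> quat) \<Rightarrow> real \<Rightarrow> quat \<times> quat \<Rightarrow> (quat \<times> quat) set" where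
  "M_proj \<phi> \<beta> g = Gamma_beta \<phi> \<beta> #>\<^bsub>SU2_ltimes_H\<^esub> g"

definition G_atlas :: "(quat \<times> quat, real^7) chart set" where
  "G_atlas = embedded_atlas (carrier SU2_ltimes_H)"

definition M_top :: "(real^4 \<Rightarrow> quat) \<Rightarrow> real \<Rightarrow> (quat \<times> quat) set topology" where
  "M_top \<phi> \<beta> = quotient_topology (top_of_set (carrier SU2_ltimes_H)) (M_proj \<phi> \<beta>)"

definition M_atlas :: "(real^4 \<Rightarrow> quat) \<Rightarrow> real \<Rightarrow> ((quat \<times> quat) set, real^7) chart set" where
  "M_atlas \<phi> \<beta> = quotient_atlas G_atlas (M_proj \<phi> \<beta>)"

definition left_invariant :: "(quat \<times> quat, real^7) mform \<Rightarrow> bool" where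
  "left_invariant \<sigma> \<longleftrightarrow>
     (\<forall>g\<in>carrier SU2_ltimes_H. pulls_back G_atlas G_atlas (\<lambda>x. g \<otimes>\<^bsub>SU2_ltimes_H\<^esub> x) \<sigma> \<sigma>)"

definition invariant_form ::
    "(real^4 \<Rightarrow> quat) \<Rightarrow> real \<Rightarrow> nat \<Rightarrow> ((quat \<times> quat) set, real^7) mform \<Rightarrow> bool" where
  "invariant_form \<phi> \<beta> k \<omega> \<longleftrightarrow>
     (\<exists>\<sigma>. diff_form G_atlas k \<sigma> \<and> left_invariant \<sigma> \<and>
          pulls_back G_atlas (M_atlas \<phi> \<beta>) (M_proj \<phi> \<beta>) \<omega> \<sigma>)"

definition primitive_root_of_unity :: "nat \<Rightarrow> complex \<Rightarrow> bool" where
  "primitive_root_of_unity n z \<longleftrightarrow> 0 < n \<and> z ^ n = 1 \<and> (\<forall>k. 0 < k \<and> k < n \<longrightarrow> z ^ k \<noteq> 1)"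


subsection \<open>Consistency of the conventions\<close>

lemma vector_4 [simp]:
  "(vector [a, b, c, d] :: 'a::zero^4) $ 1 = a"
  "(vector [a, b, c, d] :: 'a::zero^4) $ 2 = b"
  "(vector [a, b, c, d] :: 'a::zero^4) $ 3 = c"
  "(vector [a, b, c, d] :: 'a::zero^4) $ 4 = d"
  unfolding vector_def by simp_all

lemma quat_mat_mult: "quat_mat (a \<bullet>\<^sub>q b) = quat_mat a ** quat_mat b"
  by (simp add: quat_mat_def qmult_def matrix_matrix_mult_def vec_eq_iff forall_2 sum_2
      complex_eq_iff algebra_simps)

lemma quat_mat_A_beta:
  "quat_mat (A_beta \<beta>) = vector [vector [cis \<beta>, 0], vector [0, cis (- \<beta>)]]"
  by (simp add: quat_mat_def A_beta_def vec_eq_iff forall_2 complex_eq_iff)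

lemma qmult_assoc: "(a \<bullet>\<^sub>q b) \<bullet>\<^sub>q c = a \<bullet>\<^sub>q (b \<bullet>\<^sub>q c)"
  by (simp add: qmult_def vec_eq_iff forall_4 algebra_simps)

lemma qmult_add_right: "a \<bullet>\<^sub>q (b + c) = a \<bullet>\<^sub>q b + a \<bullet>\<^sub>q c"
  by (simp add: qmult_def vec_eq_iff forall_4 algebra_simps)

lemma norm_quat: "(norm (a::quat))\<^sup>2 = (a$1)\<^sup>2 + (a$2)\<^sup>2 + (a$3)\<^sup>2 + (a$4)\<^sup>2"
  unfolding power2_norm_eq_inner inner_vec_def by (simp add: sum_4 power2_eq_square)

lemma four_squares:
  fixes a b c d e f g h :: real
  shows "(a*e - b*f - c*g - d*h)\<^sup>2 + (a*f + b*e + c*h - d*g)\<^sup>2 +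
    (a*g - b*h + c*e + d*f)\<^sup>2 + (a*h + b*g - c*f + d*e)\<^sup>2 =
    (a\<^sup>2 + b\<^sup>2 + c\<^sup>2 + d\<^sup>2) * (e\<^sup>2 + f\<^sup>2 + g\<^sup>2 + h\<^sup>2)"
  by algebra

lemma norm_qmult: "norm (a \<bullet>\<^sub>q b) = norm a * norm b"
proof -
  have "(norm (a \<bullet>\<^sub>q b))\<^sup>2 = (norm a * norm b)\<^sup>2"
    unfolding power_mult_distrib norm_quat by (simp only: qmult_def vector_4 four_squares)
  then show ?thesis by simp
qed

lemma qmult_one [simp]: "vector [1, 0, 0, 0] \<bullet>\<^sub>q a = a" "a \<bullet>\<^sub>q vector [1, 0, 0, 0] = a"
  by (simp_all add: qmult_def vec_eq_iff forall_4)

lemma norm_qone [simp]: "norm (vector [1, 0, 0, 0] :: quat) = 1"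
proof -
  have "(norm (vector [1, 0, 0, 0] :: quat))\<^sup>2 = 1\<^sup>2" by (simp add: norm_quat)
  then show ?thesis by (subst (asm) power2_eq_iff_nonneg) auto
qed

lemma qconj_left:
  assumes "norm (a::quat) = 1"
  shows "\<exists>b. norm b = 1 \<and> b \<bullet>\<^sub>q a = vector [1, 0, 0, 0]"
proof -
  define b :: quat where "b = vector [a$1, - a$2, - a$3, - a$4]"
  have n: "(a$1)\<^sup>2 + (a$2)\<^sup>2 + (a$3)\<^sup>2 + (a$4)\<^sup>2 = 1"
    using norm_quat[of a] assms by simp
  have "(norm b)\<^sup>2 = 1\<^sup>2" using n unfolding norm_quat by (simp add: b_def)
  then have "norm b = 1" by (subst (asm) power2_eq_iff_nonneg) auto
  moreover have "b \<bullet>\<^sub>q a = vector [1, 0, 0, 0]"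
    using n by (simp add: b_def qmult_def vec_eq_iff forall_4 power2_eq_square algebra_simps)
  ultimately show ?thesis by blast
qed

lemma group_SU2: "group SU2"
  by (rule groupI) (auto simp: SU2_def norm_qmult qmult_assoc intro: qconj_left)

lemma group_SU2_ltimes_H: "group SU2_ltimes_H"
proof (rule groupI)
  fix x assume "x \<in> carrier SU2_ltimes_H"
  then obtain a q where x: "x = (a, q)" "norm a = 1" by (auto simp: SU2_ltimes_H_def)
  obtain b where b: "norm b = 1" "b \<bullet>\<^sub>q a = vector [1, 0, 0, 0]" using qconj_left[OF x(2)] by blast
  then show "\<exists>y\<in>carrier SU2_ltimes_H. y \<otimes>\<^bsub>SU2_ltimes_H\<^esub> x = \<one>\<^bsub>SU2_ltimes_H\<^esub>"
    using x by (intro bexI[of _ "(b, - (b \<bullet>\<^sub>q q))"]) (auto simp: SU2_ltimes_H_def)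
qed (auto simp: SU2_ltimes_H_def norm_qmult qmult_assoc qmult_add_right)

lemma A_beta_mult: "A_beta s \<bullet>\<^sub>q A_beta t = A_beta (s + t)"
  by (simp add: A_beta_def qmult_def vec_eq_iff forall_4 cos_add sin_add)

lemma A_beta_0: "A_beta 0 = vector [1, 0, 0, 0]"
  by (simp add: A_beta_def)

lemma A_beta_carrier: "A_beta s \<in> carrier SU2"
proof -
  have "(norm (A_beta s))\<^sup>2 = 1\<^sup>2" by (simp add: norm_quat A_beta_def)
  then have "norm (A_beta s) = 1" by (subst (asm) power2_eq_iff_nonneg) auto
  then show ?thesis by (simp add: SU2_def)
qed

lemma A_beta_pow: "A_beta \<beta> [^]\<^bsub>SU2\<^esub> (m::int) = A_beta (of_int m * \<beta>)"
proof -
  interpret group SU2 by (rule group_SU2)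
  have nat: "A_beta \<beta> [^]\<^bsub>SU2\<^esub> (n::nat) = A_beta (of_nat n * \<beta>)" for n
  proof (induction n)
    case (Suc n)
    then have "A_beta \<beta> [^]\<^bsub>SU2\<^esub> Suc n = A_beta (of_nat n * \<beta>) \<bullet>\<^sub>q A_beta \<beta>"
      by (simp add: SU2_def)
    then show ?case by (simp only: A_beta_mult) (simp add: algebra_simps)
  qed (simp add: A_beta_0 SU2_def)
  have inv: "inv\<^bsub>SU2\<^esub> A_beta t = A_beta (- t)" for t
  proof (rule inv_equality)
    show "A_beta (- t) \<otimes>\<^bsub>SU2\<^esub> A_beta t = \<one>\<^bsub>SU2\<^esub>"
      using A_beta_mult[of "- t" t] by (simp add: SU2_def A_beta_0)
  qed (rule A_beta_carrier)+
  show ?thesis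
  proof (cases m)
    case (nonneg k)
    then show ?thesis by (simp only: int_pow_int nat of_int_of_nat_eq)
  next
    case (neg k)
    have "A_beta \<beta> [^]\<^bsub>SU2\<^esub> m = inv\<^bsub>SU2\<^esub> (A_beta \<beta> [^]\<^bsub>SU2\<^esub> Suc k)"
      unfolding neg int_pow_neg[OF A_beta_carrier] int_pow_int ..
    then show ?thesis
      by (simp only: nat inv neg of_int_minus of_int_of_nat_eq mult_minus_left)
  qed
qed

lemma subgroup_Gamma_beta:
  assumes root: "primitive_root_of_unity n (cis \<beta>)"
    and lin: "linear \<phi>"
    and inv: "\<forall>q\<in>\<phi> ` integer_lattice. A_beta \<beta> \<bullet>\<^sub>q q \<in> \<phi> ` integer_lattice"
  shows "subgroup (Gamma_beta \<phi> \<beta>) SU2_ltimes_H"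
proof -
  let ?L = "\<phi> ` integer_lattice"
  have n: "n > 0" and one: "cis (of_nat n * \<beta>) = 1"
    using root Complex.DeMoivre[of \<beta> n] by (auto simp: primitive_root_of_unity_def)
  have Lneg: "- x \<in> ?L" if "x \<in> ?L" for x
  proof -
    from that obtain r where r: "r \<in> integer_lattice" "x = \<phi> r" by auto
    then show ?thesis
      by (intro image_eqI[of _ _ "- r"]) (auto simp: integer_lattice_def linear_neg[OF lin])
  qed
  have Ladd: "x + y \<in> ?L" if "x \<in> ?L" "y \<in> ?L" for x y
  proof -
    from that obtain r s where "r \<in> integer_lattice" "x = \<phi> r" "s \<in> integer_lattice" "y = \<phi> s"
      by auto
    then show ?thesis
      by (intro image_eqI[of _ _ "r + s"]) (auto simp: integer_lattice_def linear_add[OF lin])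
  qed
  have Lnat: "A_beta (of_nat k * \<beta>) \<bullet>\<^sub>q x \<in> ?L" if "x \<in> ?L" for k x
  proof (induction k)
    case 0
    then show ?case using that by (simp add: A_beta_0)
  next
    case (Suc k)
    have "A_beta (of_nat (Suc k) * \<beta>) = A_beta \<beta> \<bullet>\<^sub>q A_beta (of_nat k * \<beta>)"
      unfolding A_beta_mult by (simp add: algebra_simps)
    then show ?case using inv Suc by (simp only: qmult_assoc)
  qed
  have per: "A_beta (of_int m * \<beta>) = A_beta (of_nat (nat (m mod int n)) * \<beta>)" for m
  proof -
    have "of_int m * \<beta> = of_int (m mod int n) * \<beta> + of_int (m div int n) * (of_nat n * \<beta>)"
    proof -
      have "real_of_int m = of_int (m mod int n) + of_int (m div int n) * of_nat n"
        by (metis mod_div_mult_eq of_int_add of_int_mult of_int_of_nat_eq)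
      then show ?thesis by (simp add: algebra_simps)
    qed
    then have "cis (of_int m * \<beta>) =
        cis (of_int (m mod int n) * \<beta>) * cis (of_nat n * \<beta>) powi (m div int n)"
      by (simp add: cis_mult cis_power_int)
    then have "cis (of_int m * \<beta>) = cis (of_nat (nat (m mod int n)) * \<beta>)"
      using n one by simp
    then show ?thesis by (simp add: A_beta_def complex_eq_iff)
  qed
  have Lint: "A_beta (of_int m * \<beta>) \<bullet>\<^sub>q x \<in> ?L" if "x \<in> ?L" for m x
    unfolding per using that by (rule Lnat)
  have Gamma: "Gamma_beta \<phi> \<beta> = {(A_beta (of_int m * \<beta>), x) | m x. x \<in> ?L}"
    unfolding Gamma_beta_def A_beta_pow by blast
  interpret group SU2_ltimes_H by (rule group_SU2_ltimes_H)
  have nrm: "norm (A_beta s) = 1" for s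
    using A_beta_carrier[of s] by (simp add: SU2_def)
  show ?thesis
  proof (rule subgroupI)
    show "Gamma_beta \<phi> \<beta> \<subseteq> carrier SU2_ltimes_H"
      by (auto simp: Gamma SU2_ltimes_H_def nrm)
    show "Gamma_beta \<phi> \<beta> \<noteq> {}"
      by (auto simp: Gamma_beta_def integer_lattice_def intro: exI[of _ 0])
  next
    fix a assume "a \<in> Gamma_beta \<phi> \<beta>"
    then obtain m x where a: "a = (A_beta (of_int m * \<beta>), x)" "x \<in> ?L" by (auto simp: Gamma)
    let ?b = "(A_beta (of_int (- m) * \<beta>), - (A_beta (of_int (- m) * \<beta>) \<bullet>\<^sub>q x))"
    have "inv\<^bsub>SU2_ltimes_H\<^esub> a = ?b"
      by (rule inv_equality) (auto simp: a SU2_ltimes_H_def nrm A_beta_mult A_beta_0)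
    moreover have "?b \<in> Gamma_beta \<phi> \<beta>"
      unfolding Gamma using Lneg[OF Lint[OF a(2), of "- m"]] by blast
    ultimately show "inv\<^bsub>SU2_ltimes_H\<^esub> a \<in> Gamma_beta \<phi> \<beta>" by simp
  next
    fix a b assume "a \<in> Gamma_beta \<phi> \<beta>" "b \<in> Gamma_beta \<phi> \<beta>"
    then obtain m x k y where a: "a = (A_beta (of_int m * \<beta>), x)" "x \<in> ?L"
      and b: "b = (A_beta (of_int k * \<beta>), y)" "y \<in> ?L" by (auto simp: Gamma)
    have "a \<otimes>\<^bsub>SU2_ltimes_H\<^esub> b =
        (A_beta (of_int (m + k) * \<beta>), A_beta (of_int m * \<beta>) \<bullet>\<^sub>q y + x)"
      by (simp add: a b SU2_ltimes_H_def A_beta_mult algebra_simps)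
    then show "a \<otimes>\<^bsub>SU2_ltimes_H\<^esub> b \<in> Gamma_beta \<phi> \<beta>"
      unfolding Gamma using Ladd[OF Lint[OF b(2), of m] a(2)] by blast
  qed
qed

end

theory Submission
  imports Defs
begin

text \<open>Write \<open>A\<^sup>-\<^sup>1 dA = \<sigma>\<^sub>1 i + \<sigma>\<^sub>2 j + \<sigma>\<^sub>3 k\<close> and
  \<open>A\<^sup>-\<^sup>1 dq = \<theta>\<^sub>0 + \<theta>\<^sub>1 i + \<theta>\<^sub>2 j + \<theta>\<^sub>3 k\<close> for the left-invariant Maurer--Cartan form. Then
  \<open>d\<theta>\<^sub>0 = \<Sum>\<^sub>i \<sigma>\<^sub>i \<and> \<theta>\<^sub>i\<close>, so \<open>\<alpha> = \<theta>\<^sub>0\<close> is a contact form with \<open>d\<alpha> = \<omega>\<close>, and with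
  \<open>\<psi>\<^sub>+ + i\<psi>\<^sub>- = - \<Prod>\<^sub>j (\<sigma>\<^sub>j + i\<theta>\<^sub>j)\<close> the structure equations give
  \<open>- d\<psi>\<^sub>- + H \<and> \<alpha> = \<psi>\<^sub>+ \<and> \<alpha>\<close> for the closed form \<open>H = 2 \<sigma>\<^sub>1 \<and> \<sigma>\<^sub>2 \<and> \<sigma>\<^sub>3\<close>. Hence the structure of odd type
  satisfies \<open>d\<^sub>H \<rho> = \<lambda> \<rho>'\<close>, where \<open>\<rho>'\<close> is the companion, with \<open>\<lambda> = 1\<close>. It descends to the quotient
  because \<open>\<Gamma>\<^sub>\<beta>\<close> acts by left translations; \<open>\<Gamma>\<^sub>\<beta>\<close> is discrete since its \<open>SU(2)\<close> part is finite, and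
  \<open>S\<^sup>3\<close> times a fundamental cell of the lattice is a compact set that meets every orbit.\<close>

section \<open>The algebra of alternating forms\<close>

text \<open>The atlas contains every diffeomorphism from an open piece of the group, so no preferred
  coordinates are available. All computations are therefore made for the inverse of an arbitrary
  chart, a smooth map \<open>(A, q)\<close> from an open set into R^8 with \<open>|A| = 1\<close>.
  Its Maurer-Cartan form obeys structure equations that need only the symmetry of second
  derivatives, and every other form is a constant-coefficient polynomial in seven 1-forms, so weak
  integrability becomes a comparison of monomials. Since d\<alpha> pairs each \<sigma> with the
  \<theta> of the same index, the complex coframe has to be \<sigma> + i\<theta>, pair by pair. The
  constant in H comes from degree 4: \<open>- d\<psi>\<^sub>-\<close> contains the monomial
  \<open>\<sigma>\<^sub>2 \<and> \<sigma>\<^sub>1 \<and> \<sigma>\<^sub>3 \<and> \<alpha>\<close>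
  three times, once for each of the three \<open>d\<theta>\<^sub>j\<close>, while
  \<open>\<psi>\<^sub>+ \<and> \<alpha>\<close> contains it once. H removes the surplus of two; all
  other monomials of this degree agree already.\<close>

definition contract :: "'v \<Rightarrow> ('v, 'b) form \<Rightarrow> ('v, 'b) form" where
  "contract v a vs = a (v # vs)"

text \<open>Carries the sign \<open>(-1)^k\<close> of all Leibniz rules as an operator, so that the
  rules hold for mixed-degree forms without any bookkeeping of degrees.\<close>

definition grade_inv :: "('v, 'b::comm_ring_1) form \<Rightarrow> ('v, 'b) form" where
  "grade_inv a vs = (-1) ^ length vs * a vs"

lemma wedge_Nil: "(a \<and>\<^sub>w b) [] = a [] * b []"
  by (simp add: wedge_def)

text \<open>Contraction is an antiderivation. This recursion over the list of arguments takes the place of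
  shuffles in all later proofs.\<close>

lemma wedge_Cons:
  "(a \<and>\<^sub>w b) (v # ws) = (contract v a \<and>\<^sub>w b) ws + (grade_inv a \<and>\<^sub>w contract v b) ws"
proof -
  define inversions where "inversions I = {(i, j). i \<in> I \<and> j < i \<and> j \<notin> I}" for I :: "nat set"
  let ?n = "length ws"
  let ?f = "\<lambda>I. (-1) ^ card (inversions I) * a (nths (v # ws) I) * b (nths (v # ws) (- I))"
  \<comment> \<open>The index sets are split by whether they contain 0, the position of
    \<open>v\<close>; all other positions are shifted by \<open>Suc\<close>.\<close>
  have split: "Pow {..<Suc ?n} = (\<lambda>I. Suc ` I) ` Pow {..<?n} \<union> (\<lambda>I. insert 0 (Suc ` I)) ` Pow {..<?n}"
    unfolding lessThan_Suc_eq_insert_0 Pow_insert image_Pow_surj[OF refl, of Suc, symmetric] image_image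
    by (simp add: image_Pow_surj)
  have disj: "(\<lambda>I. Suc ` I) ` Pow {..<?n} \<inter> (\<lambda>I. insert 0 (Suc ` I)) ` Pow {..<?n} = {}"
    by auto
  have inj: "inj_on (\<lambda>I. Suc ` I) A" "inj_on (\<lambda>I. insert 0 (Suc ` I)) A" for A
  proof -
    show "inj_on (\<lambda>I. Suc ` I) A" by (simp add: inj_on_def inj_image_eq_iff)
    have "insert 0 (Suc ` I) = insert 0 (Suc ` J) \<Longrightarrow> Suc ` I = Suc ` J" for I J by blast
    then show "inj_on (\<lambda>I. insert 0 (Suc ` I)) A"
      by (intro inj_onI) (metis inj_Suc inj_image_eq_iff)
  qed
  have nth1: "nths (v # ws) (Suc ` I) = nths ws I" "nths (v # ws) (- Suc ` I) = v # nths ws (- I)"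
    "nths (v # ws) (insert 0 (Suc ` I)) = v # nths ws I"
    "nths (v # ws) (- insert 0 (Suc ` I)) = nths ws (- I)" for I
  proof -
    have "{j. \<forall>x\<in>I. j \<noteq> x} = {x. x \<notin> I}" by blast
    then show "nths (v # ws) (Suc ` I) = nths ws I" "nths (v # ws) (- Suc ` I) = v # nths ws (- I)"
      "nths (v # ws) (insert 0 (Suc ` I)) = v # nths ws I"
      "nths (v # ws) (- insert 0 (Suc ` I)) = nths ws (- I)"
      by (simp_all add: nths_Cons image_iff Compl_eq)
  qed
  \<comment> \<open>Placing 0 in the left factor creates no inversion, since nothing lies below
    0.\<close>
  have c1: "card (inversions (insert 0 (Suc ` I))) = card (inversions I)" for I
  proof -
    have "inversions (insert 0 (Suc ` I)) = map_prod Suc Suc ` inversions I"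
    proof (intro equalityI subrelI)
      fix i j assume "(i, j) \<in> inversions (insert 0 (Suc ` I))"
      then obtain i' where "i = Suc i'" "i' \<in> I" "j < i" "j \<noteq> 0" "j \<notin> Suc ` I"
        by (auto simp: inversions_def)
      moreover then obtain j' where "j = Suc j'" by (cases j) auto
      ultimately show "(i, j) \<in> map_prod Suc Suc ` inversions I"
        by (auto simp: inversions_def intro!: image_eqI[of _ _ "(i', j')"])
    qed (auto simp: inversions_def)
    then show ?thesis by (simp add: card_image inj_on_def prod.inj_map inversions_def)
  qed
  \<comment> \<open>With 0 in the right factor every element of \<open>I\<close> has to pass it. The
    \<open>card I\<close> new inversions are the sign in \<open>grade_inv a\<close>.\<close>
  have c0: "card (inversions (Suc ` I)) = card (inversions I) + card I" if "I \<subseteq> {..<?n}" for I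
  proof -
    have fin: "finite I" using that finite_subset by blast
    have "inversions I \<subseteq> I \<times> {..<?n}" using that by (auto simp: inversions_def)
    then have fini: "finite (inversions I)" using fin finite_subset by blast
    have "inversions (Suc ` I) = map_prod Suc Suc ` inversions I \<union> (\<lambda>i. (Suc i, 0)) ` I"
    proof (intro equalityI subrelI)
      fix i j assume "(i, j) \<in> inversions (Suc ` I)"
      then obtain i' where i: "i = Suc i'" "i' \<in> I" "j < i" "j \<notin> Suc ` I"
        by (auto simp: inversions_def)
      show "(i, j) \<in> map_prod Suc Suc ` inversions I \<union> (\<lambda>i. (Suc i, 0)) ` I"
      proof (cases j)
        case 0
        then show ?thesis using i by auto
      next
        case (Suc j')
        then have "(i, j) \<in> map_prod Suc Suc ` inversions I"
          using i by (auto simp: inversions_def intro!: image_eqI[of _ _ "(i', j')"])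
        then show ?thesis ..
      qed
    qed (auto simp: inversions_def)
    moreover have "card (map_prod Suc Suc ` inversions I \<union> (\<lambda>i. (Suc i, 0)) ` I)
        = card (map_prod Suc Suc ` inversions I) + card ((\<lambda>i. (Suc i, 0::nat)) ` I)"
      using fin fini by (intro card_Un_disjoint) auto
    moreover have "inj_on (map_prod Suc Suc) (inversions I)" by (auto simp: inj_on_def)
    ultimately show ?thesis
      by (simp add: card_image inj_on_def)
  qed
  have len: "length (nths ws I) = card I" if "I \<subseteq> {..<?n}" for I
  proof -
    have "{i. i < length ws \<and> i \<in> I} = I" using that by auto
    then show ?thesis by (simp add: length_nths)
  qed
  have "(a \<and>\<^sub>w b) (v # ws) = sum ?f (Pow {..<Suc ?n})"
    by (simp add: wedge_def inversions_def)
  also have "\<dots> = (\<Sum>I\<in>Pow {..<?n}. ?f (Suc ` I)) + (\<Sum>I\<in>Pow {..<?n}. ?f (insert 0 (Suc ` I)))"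
    unfolding split by (subst sum.union_disjoint) (auto simp: disj sum.reindex inj)
  also have "(\<Sum>I\<in>Pow {..<?n}. ?f (insert 0 (Suc ` I))) = (contract v a \<and>\<^sub>w b) ws"
    unfolding wedge_def inversions_def[symmetric] by (simp add: nth1 c1 contract_def)
  also have "(\<Sum>I\<in>Pow {..<?n}. ?f (Suc ` I)) = (grade_inv a \<and>\<^sub>w contract v b) ws"
    unfolding wedge_def inversions_def[symmetric]
    by (intro sum.cong refl) (simp add: nth1 c0 contract_def grade_inv_def len power_add)
  finally show ?thesis by simp
qed

lemma contract_wedge:
  "contract v (a \<and>\<^sub>w b) = (\<lambda>ws. (contract v a \<and>\<^sub>w b) ws + (grade_inv a \<and>\<^sub>w contract v b) ws)"
  by (rule ext) (simp add: contract_def[of v "a \<and>\<^sub>w b"] wedge_Cons)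

lemma wedge_add_left: "(\<lambda>vs. a vs + b vs) \<and>\<^sub>w c = (\<lambda>vs. (a \<and>\<^sub>w c) vs + (b \<and>\<^sub>w c) vs)"
  by (simp add: wedge_def fun_eq_iff algebra_simps sum.distrib)

lemma wedge_add_right: "a \<and>\<^sub>w (\<lambda>vs. b vs + c vs) = (\<lambda>vs. (a \<and>\<^sub>w b) vs + (a \<and>\<^sub>w c) vs)"
  by (simp add: wedge_def fun_eq_iff algebra_simps sum.distrib)

lemma wedge_scale_left: "(\<lambda>vs. r * a vs) \<and>\<^sub>w b = (\<lambda>vs. r * (a \<and>\<^sub>w b) vs)"
  by (simp add: wedge_def fun_eq_iff algebra_simps sum_distrib_left)

lemma wedge_scale_right: "a \<and>\<^sub>w (\<lambda>vs. r * b vs) = (\<lambda>vs. r * (a \<and>\<^sub>w b) vs)"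
  by (simp add: wedge_def fun_eq_iff algebra_simps sum_distrib_left)

lemma wedge_minus_left: "(\<lambda>vs. - a vs) \<and>\<^sub>w b = (\<lambda>vs. - (a \<and>\<^sub>w b) vs)"
  by (simp add: wedge_def fun_eq_iff sum_negf)

lemma wedge_minus_right: "a \<and>\<^sub>w (\<lambda>vs. - b vs) = (\<lambda>vs. - (a \<and>\<^sub>w b) vs)"
  by (simp add: wedge_def fun_eq_iff sum_negf)

lemma wedge_diff_left: "(\<lambda>vs. a vs - b vs) \<and>\<^sub>w c = (\<lambda>vs. (a \<and>\<^sub>w c) vs - (b \<and>\<^sub>w c) vs)"
  by (simp add: wedge_def fun_eq_iff algebra_simps sum_subtractf)

lemma wedge_diff_right: "a \<and>\<^sub>w (\<lambda>vs. b vs - c vs) = (\<lambda>vs. (a \<and>\<^sub>w b) vs - (a \<and>\<^sub>w c) vs)"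
  by (simp add: wedge_def fun_eq_iff algebra_simps sum_subtractf)

lemma wedge_zero_left: "(\<lambda>vs. 0) \<and>\<^sub>w b = (\<lambda>vs. 0)"
  by (simp add: wedge_def fun_eq_iff)

lemma wedge_zero_right: "a \<and>\<^sub>w (\<lambda>vs. 0) = (\<lambda>vs. 0)"
  by (simp add: wedge_def fun_eq_iff)

lemmas wedge_linear = wedge_add_left wedge_add_right wedge_diff_left wedge_diff_right
  wedge_minus_left wedge_minus_right wedge_scale_left wedge_scale_right wedge_zero_left wedge_zero_right

lemma wedge_map: "(a \<and>\<^sub>w b) (map f vs) = ((\<lambda>us. a (map f us)) \<and>\<^sub>w (\<lambda>us. b (map f us))) vs"
  by (simp add: wedge_def nths_map)

lemma grade_inv_wedge:
  fixes a b :: "('v, 'b::comm_ring_1) form"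
  shows "grade_inv (a \<and>\<^sub>w b) = grade_inv a \<and>\<^sub>w grade_inv b"
proof
  fix vs :: "'v list"
  have *: "length (nths vs I) + length (nths vs (- I)) = length vs" for I
  proof -
    have "card {i. i < length vs \<and> i \<in> I} + card {i. i < length vs \<and> i \<in> - I} = card {..<length vs}"
      by (subst card_Un_disjoint[symmetric]) (auto intro!: arg_cong[where f=card] simp flip: card_lessThan)
    then show ?thesis by (simp add: length_nths)
  qed
  have sgn: "(-1::'b) ^ length vs = (-1) ^ length (nths vs I) * (-1) ^ length (nths vs (- I))" for I
    by (simp flip: power_add add: *)
  show "grade_inv (a \<and>\<^sub>w b) vs = (grade_inv a \<and>\<^sub>w grade_inv b) vs"
    unfolding grade_inv_def wedge_def sum_distrib_left
  proof (intro sum.cong refl)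
    fix I
    show "(-1) ^ length vs *
        ((-1) ^ card {(i, j). i \<in> I \<and> j < i \<and> j \<notin> I} * a (nths vs I) * b (nths vs (- I))) =
      (-1) ^ card {(i, j). i \<in> I \<and> j < i \<and> j \<notin> I} *
        ((-1) ^ length (nths vs I) * a (nths vs I)) * ((-1) ^ length (nths vs (- I)) * b (nths vs (- I)))"
      unfolding sgn[of I] by (simp add: mult_ac)
  qed
qed

lemma contract_grade_inv: "contract v (grade_inv a) = (\<lambda>vs. - grade_inv (contract v a) vs)"
  by (simp add: contract_def grade_inv_def fun_eq_iff)

lemma grade_inv_grade_inv: "grade_inv (grade_inv a) = a"
  by (simp add: grade_inv_def fun_eq_iff flip: mult.assoc power_add)

text \<open>Contracting either side yields the same three terms with the same signs, because
  \<open>grade_inv\<close> is multiplicative. The induction on the arguments thus closes for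
  arbitrary functions on lists, linear or not.\<close>

theorem wedge_assoc: "(a \<and>\<^sub>w b) \<and>\<^sub>w c = a \<and>\<^sub>w b \<and>\<^sub>w c"
proof
  fix vs show "((a \<and>\<^sub>w b) \<and>\<^sub>w c) vs = (a \<and>\<^sub>w b \<and>\<^sub>w c) vs"
    by (induction vs arbitrary: a b c)
      (simp_all add: wedge_Nil wedge_Cons contract_wedge wedge_linear grade_inv_wedge)
qed

text \<open>Anticommutation is required for 1-forms only, as everything later is a polynomial in the
  coframe. Two contractions annihilate a 1-form, so just the case of two arguments survives.\<close>

lemma wedge_antisym:
  fixes a b :: "('v, 'b::comm_ring_1) form"
  assumes "\<And>vs. length vs \<noteq> 1 \<Longrightarrow> a vs = 0" "\<And>vs. length vs \<noteq> 1 \<Longrightarrow> b vs = 0"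
  shows "b \<and>\<^sub>w a = (\<lambda>vs. - (a \<and>\<^sub>w b) vs)"
proof
  have *: "(a \<and>\<^sub>w b) vs = (case vs of [v, w] \<Rightarrow> a [v] * b [w] - a [w] * b [v] | _ \<Rightarrow> 0)"
    if a: "\<And>vs. length vs \<noteq> 1 \<Longrightarrow> a vs = 0" and b: "\<And>vs. length vs \<noteq> 1 \<Longrightarrow> b vs = 0"
    for a b :: "('v, 'b) form" and vs
  proof -
    have cc: "contract u (contract v a) = (\<lambda>_. 0)" "contract u (contract v b) = (\<lambda>_. 0)"
      "contract u (contract v (\<lambda>vs. (-1) ^ length vs * a vs)) = (\<lambda>_. 0)"
      "contract u (\<lambda>vs. (-1) ^ length vs * a (v # vs)) = (\<lambda>_. 0)" for u v
      by (simp_all add: contract_def a b fun_eq_iff)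
    have z: "a [] = 0" "b [] = 0" by (simp_all add: a b)
    show ?thesis
      by (cases vs rule: remdups_adj.cases; (cases "tl (tl vs)")?)
        (simp_all add: wedge_Nil wedge_Cons contract_wedge wedge_linear cc z contract_grade_inv
          grade_inv_grade_inv grade_inv_def[abs_def], simp_all add: contract_def cc wedge_linear)
  qed
  show "(b \<and>\<^sub>w a) vs = - (a \<and>\<^sub>w b) vs" for vs
    by (subst (1 2) *) (use assms in \<open>auto split: list.split\<close>)
qed

subsection \<open>Alternation\<close>

text \<open>Repetition of adjacent arguments is the form of alternation that is inherited by contractions.\<close>

definition multilinear :: "('v::real_vector, real) form \<Rightarrow> bool" where
  "multilinear a \<longleftrightarrow> (\<forall>us ws. linear (\<lambda>v. a (us @ v # ws)))"

definition adj_alternating :: "('v, 'b::zero) form \<Rightarrow> bool" where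
  "adj_alternating a \<longleftrightarrow> (\<forall>us v ws. a (us @ v # v # ws) = 0)"

lemma multilinear_contract: "multilinear a \<Longrightarrow> multilinear (contract v a)"
  unfolding multilinear_def contract_def by (simp flip: append_Cons)

lemma multilinear_grade_inv:
  assumes "multilinear a"
  shows "multilinear (grade_inv a)"
  unfolding multilinear_def
proof (intro allI)
  fix us ws :: "'a list"
  have "linear (\<lambda>v. (-1) ^ (Suc (length us + length ws)) *\<^sub>R a (us @ v # ws))"
    using assms by (intro linear_compose_scale_right) (simp add: multilinear_def)
  then show "linear (\<lambda>v. grade_inv a (us @ v # ws))" by (simp add: grade_inv_def)
qed

lemma adj_alternating_contract: "adj_alternating a \<Longrightarrow> adj_alternating (contract v a)"
  unfolding adj_alternating_def contract_def by (simp flip: append_Cons)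

lemma adj_alternating_grade_inv: "adj_alternating a \<Longrightarrow> adj_alternating (grade_inv a)"
  unfolding adj_alternating_def grade_inv_def by simp

lemma multilinear_wedge:
  assumes "multilinear a" "multilinear b"
  shows "multilinear (a \<and>\<^sub>w b)"
proof -
  have first: "linear (\<lambda>v. (contract v a \<and>\<^sub>w b) ws)" "linear (\<lambda>v. (b \<and>\<^sub>w contract v a) ws)"
    if "multilinear a" for a b :: "('a, real) form" and ws
  proof -
    have lin: "linear (\<lambda>v. a (v # us))" for us
      using that[unfolded multilinear_def, rule_format, of "[]"] by simp
    have "contract (v + w) a = (\<lambda>vs. contract v a vs + contract w a vs)"
      "contract (r *\<^sub>R v) a = (\<lambda>vs. r * contract v a vs)" for v w r
      by (simp_all add: contract_def fun_eq_iff linear_add[OF lin] linear_scale[OF lin])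
    then show "linear (\<lambda>v. (contract v a \<and>\<^sub>w b) ws)" "linear (\<lambda>v. (b \<and>\<^sub>w contract v a) ws)"
      by (auto intro!: linearI simp: wedge_linear)
  qed
  have "linear (\<lambda>v. (a \<and>\<^sub>w b) (us @ v # ws))" for us ws
    using assms
  proof (induction us arbitrary: a b)
    case Nil
    then show ?case by (auto simp: wedge_Cons intro!: linear_compose_add first)
  next
    case (Cons u us)
    then show ?case
      by (auto simp: wedge_Cons multilinear_contract multilinear_grade_inv intro!: linear_compose_add)
  qed
  then show ?thesis by (simp add: multilinear_def)
qed

lemma adj_alternating_wedge:
  fixes a b :: "('a, 'b::comm_ring_1) form"
  assumes "adj_alternating a" "adj_alternating b"
  shows "adj_alternating (a \<and>\<^sub>w b)"
proof -
  have "(a \<and>\<^sub>w b) (us @ v # v # ws) = 0" for us v ws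
    using assms
  proof (induction us arbitrary: a b)
    case Nil
    have "contract v (contract v c) = (\<lambda>_. 0)" if "adj_alternating c" for c :: "('a, 'b) form"
      using that[unfolded adj_alternating_def, rule_format, of "[]"]
      by (simp add: contract_def fun_eq_iff)
    with Nil have "contract v (contract v a) = (\<lambda>_. 0)" "contract v (contract v b) = (\<lambda>_. 0)"
      by blast+
    \<comment> \<open>The two cross terms cancel, since contraction anticommutes with
      \<open>grade_inv\<close>; the remaining terms contain a double contraction by
      \<open>v\<close>.\<close>
    then show ?case
      by (simp add: wedge_Cons contract_wedge contract_grade_inv wedge_linear)
  next
    case (Cons u us)
    then show ?case
      by (auto simp: wedge_Cons adj_alternating_contract adj_alternating_grade_inv)
  qed
  then show ?thesis by (simp add: adj_alternating_def)
qed

text \<open>From right to left, polarising the adjacent condition gives antisymmetry under adjacent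
  swaps, and such swaps bring two equal arguments at any positions next to each other.\<close>

lemma alternating_form_iff:
  "alternating_form k a \<longleftrightarrow>
     (\<forall>vs. length vs \<noteq> k \<longrightarrow> a vs = 0) \<and> multilinear a \<and> adj_alternating a"
proof
  assume a: "alternating_form k a"
  then have lin: "\<And>vs i. i < length vs \<Longrightarrow> linear (\<lambda>v. a (vs[i := v]))"
    and alt: "\<And>vs i j. i < length vs \<Longrightarrow> j < length vs \<Longrightarrow> i \<noteq> j \<Longrightarrow> vs ! i = vs ! j \<Longrightarrow> a vs = 0"
    unfolding alternating_form_def by blast+
  have "linear (\<lambda>v. a (us @ v # ws))" for us ws
  proof -
    have "linear (\<lambda>v. a ((us @ 0 # ws)[length us := v]))"
      by (rule lin) simp
    then show ?thesis by simp
  qed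
  moreover have "a (us @ v # v # ws) = 0" for us v ws
    by (rule alt[of "length us" _ "Suc (length us)"]) (simp_all add: nth_append)
  ultimately show "(\<forall>vs. length vs \<noteq> k \<longrightarrow> a vs = 0) \<and> multilinear a \<and> adj_alternating a"
    using a unfolding alternating_form_def multilinear_def adj_alternating_def by auto
next
  assume "(\<forall>vs. length vs \<noteq> k \<longrightarrow> a vs = 0) \<and> multilinear a \<and> adj_alternating a"
  then have deg: "\<And>vs. length vs \<noteq> k \<Longrightarrow> a vs = 0"
    and lin: "\<And>us ws. linear (\<lambda>v. a (us @ v # ws))" and adj: "\<And>us v ws. a (us @ v # v # ws) = 0"
    by (auto simp: multilinear_def adj_alternating_def)
  have swap: "a (us @ v # w # ws) = - a (us @ w # v # ws)" for us v w ws
  proof -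
    have l1: "a (us @ (x + y) # z # ws) = a (us @ x # z # ws) + a (us @ y # z # ws)" for x y z
      using linear_add[OF lin[of us "z # ws"]] by simp
    have l2: "a (us @ z # (x + y) # ws) = a (us @ z # x # ws) + a (us @ z # y # ws)" for x y z
      using linear_add[OF lin[of "us @ [z]" ws]] by simp
    have "0 = a (us @ (v + w) # (v + w) # ws)" by (simp only: adj)
    also have "\<dots> = a (us @ v # w # ws) + a (us @ w # v # ws)"
      by (subst l1, subst (1 2) l2) (simp add: adj)
    finally show ?thesis by linarith
  qed
  have rep: "a (us @ v # ts @ v # ws) = 0" for us v ts ws
  proof (induction ts arbitrary: us)
    case Nil then show ?case by (simp add: adj)
  next
    case (Cons t ts)
    have "a (us @ v # (t # ts) @ v # ws) = - a ((us @ [t]) @ v # ts @ v # ws)"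
      using swap[of us v t] by simp
    then show ?case by (simp only: Cons.IH minus_zero)
  qed
  have lt: "a vs = 0" if "i < j" "j < length vs" "vs ! i = vs ! j" for vs i j
  proof -
    have "vs = take i vs @ vs ! i # drop (Suc i) vs" using that by (intro id_take_nth_drop) simp
    moreover have "drop (Suc i) vs = take (j - Suc i) (drop (Suc i) vs) @ vs ! j # drop (Suc j) vs"
      using that id_take_nth_drop[of "j - Suc i" "drop (Suc i) vs"] by (simp add: Suc_leI)
    ultimately show ?thesis using rep that(3) by metis
  qed
  show "alternating_form k a"
    unfolding alternating_form_def
  proof (intro conjI allI impI)
    fix vs :: "'a list" and i assume "i < length vs"
    then show "linear (\<lambda>v. a (vs[i := v]))" by (simp add: upd_conv_take_nth_drop lin)
  next
    fix vs :: "'a list" and i j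
    assume "i < length vs" "j < length vs" "i \<noteq> j \<and> vs ! i = vs ! j"
    then show "a vs = 0" using lt[of i j vs] lt[of j i vs] by (cases i j rule: linorder_cases) auto
  qed (rule deg)
qed

lemma wedge_degree:
  assumes "\<And>vs. length vs \<noteq> k \<Longrightarrow> a vs = 0" "\<And>vs. length vs \<noteq> l \<Longrightarrow> b vs = 0" "length vs \<noteq> k + l"
  shows "(a \<and>\<^sub>w b) vs = 0"
  using assms
proof (induction vs arbitrary: a b k l)
  case Nil
  then show ?case by (auto simp: wedge_Nil)
next
  case (Cons v vs)
  have "(contract v a \<and>\<^sub>w b) vs = 0"
  proof (cases k)
    case 0
    then have "contract v a = (\<lambda>_. 0)" using Cons.prems(1) by (simp add: contract_def fun_eq_iff)
    then show ?thesis by (simp add: wedge_linear)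
  next
    case (Suc k')
    then show ?thesis using Cons.prems by (intro Cons.IH[of k' _ l]) (auto simp: contract_def)
  qed
  moreover have "(grade_inv a \<and>\<^sub>w contract v b) vs = 0"
  proof (cases l)
    case 0
    then have "contract v b = (\<lambda>_. 0)" using Cons.prems(2) by (simp add: contract_def fun_eq_iff)
    then show ?thesis by (simp add: wedge_linear)
  next
    case (Suc l')
    then show ?thesis using Cons.prems by (intro Cons.IH[of k _ l']) (auto simp: contract_def grade_inv_def)
  qed
  ultimately show ?case by (simp add: wedge_Cons)
qed

lemma alternating_form_wedge:
  "alternating_form k a \<Longrightarrow> alternating_form l b \<Longrightarrow> alternating_form (k + l) (a \<and>\<^sub>w b)"
  unfolding alternating_form_iff using wedge_degree[of k a l b]
  by (auto simp: multilinear_wedge adj_alternating_wedge)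

lemma alternating_form_add:
  "alternating_form k a \<Longrightarrow> alternating_form k b \<Longrightarrow> alternating_form k (\<lambda>vs. a vs + b vs)"
  by (auto simp: alternating_form_def linear_compose_add)

lemma alternating_form_diff:
  "alternating_form k a \<Longrightarrow> alternating_form k b \<Longrightarrow> alternating_form k (\<lambda>vs. a vs - b vs)"
  by (auto simp: alternating_form_def linear_compose_sub)

lemma alternating_form_scale:
  "alternating_form k a \<Longrightarrow> alternating_form k (\<lambda>vs. r * a vs)"
  by (auto simp: alternating_form_def linear_compose_scale_right simp flip: real_scaleR_def)

lemma alternating_form_map:
  assumes "alternating_form k a" "linear f"
  shows "alternating_form k (\<lambda>vs. a (map f vs))"
  using assms linear_compose[OF assms(2), unfolded o_def]
  unfolding alternating_form_iff multilinear_def adj_alternating_def by auto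

text \<open>Allows the complex volume form to be split into real forms before any differentiation
  takes place.\<close>

lemma cform_wedge:
  "cform a b \<and>\<^sub>w cform c d =
     cform (\<lambda>vs. (a \<and>\<^sub>w c) vs - (b \<and>\<^sub>w d) vs) (\<lambda>vs. (a \<and>\<^sub>w d) vs + (b \<and>\<^sub>w c) vs)"
proof
  fix vs
  have "(cform a b \<and>\<^sub>w cform c d) vs =
      (\<Sum>I\<in>Pow {..<length vs}. Complex
        ((-1) ^ card {(i, j). i \<in> I \<and> j < i \<and> j \<notin> I} *
           (a (nths vs I) * c (nths vs (- I)) - b (nths vs I) * d (nths vs (- I))))
        ((-1) ^ card {(i, j). i \<in> I \<and> j < i \<and> j \<notin> I} *
           (a (nths vs I) * d (nths vs (- I)) + b (nths vs I) * c (nths vs (- I)))))"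
    unfolding wedge_def
  proof (intro sum.cong refl)
    fix I
    have "(-1::complex) ^ n = Complex ((-1) ^ n) 0" for n
      by (induction n) (simp_all add: complex_eq_iff)
    then show "(-1) ^ card {(i, j). i \<in> I \<and> j < i \<and> j \<notin> I} * cform a b (nths vs I) * cform c d (nths vs (- I)) =
      Complex
        ((-1) ^ card {(i, j). i \<in> I \<and> j < i \<and> j \<notin> I} *
           (a (nths vs I) * c (nths vs (- I)) - b (nths vs I) * d (nths vs (- I))))
        ((-1) ^ card {(i, j). i \<in> I \<and> j < i \<and> j \<notin> I} *
           (a (nths vs I) * d (nths vs (- I)) + b (nths vs I) * c (nths vs (- I))))"
      by (simp add: cform_def complex_eq_iff algebra_simps)
  qed
  then show "(cform a b \<and>\<^sub>w cform c d) vs =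
    cform (\<lambda>vs. (a \<and>\<^sub>w c) vs - (b \<and>\<^sub>w d) vs) (\<lambda>vs. (a \<and>\<^sub>w d) vs + (b \<and>\<^sub>w c) vs) vs"
    by (simp add: cform_def complex_eq_iff Re_sum Im_sum wedge_def sum.distrib[symmetric]
        sum_subtractf[symmetric] algebra_simps)
qed

section \<open>Calculus of smooth maps\<close>

lemma frechet_derivative_eqI: "(f has_derivative f') (at x) \<Longrightarrow> frechet_derivative f (at x) v = f' v"
  by (metis frechet_derivative_at)

lemma differentiable_frechet: "f differentiable (at x) \<Longrightarrow> (f has_derivative frechet_derivative f (at x)) (at x)"
  by (simp add: frechet_derivative_works)

text \<open>On an open set the derivatives depend only on the values there. The lemma serves to
  replace \<open>frechet_derivative\<close> by a derivative formula that is known on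
  \<open>W\<close> alone.\<close>

lemma Ck_on_cong:
  assumes "open W" "\<And>x. x \<in> W \<Longrightarrow> f x = g x" "Ck_on k W f"
  shows "Ck_on k W g"
  using assms(2,3)
proof (induction k arbitrary: f g)
  case 0
  then show ?case by (simp cong: continuous_on_cong)
next
  case (Suc k)
  have "g differentiable (at x)" if "x \<in> W" for x
    using Suc.prems that assms(1)
    by (metis Ck_on.simps(2) differentiable_def has_derivative_transform_within_open)
  moreover have "frechet_derivative f (at x) = frechet_derivative g (at x)" if "x \<in> W" for x
    using Suc.prems that assms(1)
    by (intro frechet_derivative_transform_within_open[of _ _ W]) auto
  moreover have "Ck_on k W (\<lambda>x. frechet_derivative g (at x) v)" for v
    by (rule Suc.IH[of "\<lambda>x. frechet_derivative f (at x) v"]) (use calculation Suc.prems in auto)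
  ultimately show ?case by simp
qed

lemma Ck_on_subset: "Ck_on k W f \<Longrightarrow> V \<subseteq> W \<Longrightarrow> Ck_on k V f"
proof (induction k arbitrary: f)
  case 0
  then show ?case by (auto intro: continuous_on_subset)
qed auto

lemma Ck_on_Suc_imp: "Ck_on (Suc k) W f \<Longrightarrow> Ck_on k W f"
proof (induction k arbitrary: f)
  case 0
  then show ?case
    by (auto intro!: continuous_at_imp_continuous_on differentiable_imp_continuous_within)
next
  case (Suc k)
  from Suc.prems have "\<forall>x\<in>W. f differentiable (at x)"
    "\<And>v. Ck_on (Suc k) W (\<lambda>x. frechet_derivative f (at x) v)" by simp_all
  with Suc.IH show ?case by (simp del: Ck_on.simps(2) add: Ck_on.simps(2)[of k])
qed

lemma Ck_on_local:
  assumes "open S" "\<And>x. x \<in> S \<Longrightarrow> \<exists>W. open W \<and> x \<in> W \<and> Ck_on k (S \<inter> W) f"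
  shows "Ck_on k S f"
  using assms(2)
proof (induction k arbitrary: f)
  case 0
  have "isCont f x" if x: "x \<in> S" for x
  proof -
    obtain W where "open W" "x \<in> W" "continuous_on (S \<inter> W) f" using 0 x by auto
    then show ?thesis using x assms(1) by (metis Int_iff continuous_on_eq_continuous_at open_Int)
  qed
  then show ?case by (simp add: continuous_at_imp_continuous_on)
next
  case (Suc k)
  have "f differentiable (at x)" if x: "x \<in> S" for x
    using Suc.prems[OF x] x by auto
  moreover have "Ck_on k S (\<lambda>x. frechet_derivative f (at x) v)" for v
    using Suc.prems by (intro Suc.IH) fastforce
  ultimately show ?case by simp
qed

lemma Ck_on_const: "Ck_on k W (\<lambda>x. c)"
proof (induction k arbitrary: c)
  case (Suc k)
  have "frechet_derivative (\<lambda>x. c) (at x) v = 0" for x :: 'a and v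
    by (rule frechet_derivative_eqI) (auto intro: derivative_eq_intros)
  then show ?case using Suc by simp
qed simp

lemma Ck_on_bounded_linear_compose:
  assumes "open W" "bounded_linear h" "Ck_on k W f"
  shows "Ck_on k W (\<lambda>x. h (f x))"
  using assms(3)
proof (induction k arbitrary: f)
  case 0
  then show ?case using assms by (auto intro: bounded_linear.continuous_on)
next
  case (Suc k)
  have d: "((\<lambda>x. h (f x)) has_derivative (\<lambda>v. h (frechet_derivative f (at x) v))) (at x)"
    if "x \<in> W" for x
    using Suc.prems that by (intro bounded_linear.has_derivative[OF assms(2)] differentiable_frechet) simp
  have "Ck_on k W (\<lambda>x. h (frechet_derivative f (at x) v))" for v
    using Suc by simp
  then have "Ck_on k W (\<lambda>x. frechet_derivative (\<lambda>x. h (f x)) (at x) v)" for v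
    by (rule Ck_on_cong[OF assms(1), rotated]) (simp add: frechet_derivative_eqI[OF d])
  then show ?case using d by (auto simp: differentiable_def)
qed

lemma Ck_on_id: "open W \<Longrightarrow> Ck_on k W (\<lambda>x. x)"
proof (cases k)
  case (Suc j)
  have "frechet_derivative (\<lambda>x. x) (at x) v = v" for x v :: 'a
    by (rule frechet_derivative_eqI) (rule has_derivative_ident)
  then show ?thesis using Suc by (simp add: Ck_on_const)
qed simp

lemma Ck_on_add:
  assumes "open W" "Ck_on k W f" "Ck_on k W g"
  shows "Ck_on k W (\<lambda>x. f x + g x)"
  using assms(2,3)
proof (induction k arbitrary: f g)
  case 0
  then show ?case by (auto intro: continuous_on_add)
next
  case (Suc k)
  have d: "((\<lambda>x. f x + g x) has_derivative (\<lambda>v. frechet_derivative f (at x) v + frechet_derivative g (at x) v)) (at x)"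
    if "x \<in> W" for x
    using Suc.prems that by (intro has_derivative_add differentiable_frechet) simp_all
  have "Ck_on k W (\<lambda>x. frechet_derivative f (at x) v + frechet_derivative g (at x) v)" for v
    using Suc by simp
  then have "Ck_on k W (\<lambda>x. frechet_derivative (\<lambda>x. f x + g x) (at x) v)" for v
    by (rule Ck_on_cong[OF assms(1), rotated]) (simp add: frechet_derivative_eqI[OF d])
  then show ?case using d by (auto simp: differentiable_def)
qed

lemma Ck_on_sum:
  assumes "open W" "\<And>i. i \<in> I \<Longrightarrow> Ck_on k W (f i)"
  shows "Ck_on k W (\<lambda>x. \<Sum>i\<in>I. f i x)"
  using assms(2)
  by (induction I rule: infinite_finite_induct) (auto intro: Ck_on_add assms(1) Ck_on_const)

lemma Ck_on_bilinear:
  assumes "open W" "bounded_bilinear b" "Ck_on k W f" "Ck_on k W g"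
  shows "Ck_on k W (\<lambda>x. b (f x) (g x))"
  using assms(3,4)
proof (induction k arbitrary: f g)
  case 0
  then show ?case by (auto intro: bounded_bilinear.continuous_on[OF assms(2)])
next
  case (Suc k)
  have d: "((\<lambda>x. b (f x) (g x)) has_derivative
      (\<lambda>v. b (f x) (frechet_derivative g (at x) v) + b (frechet_derivative f (at x) v) (g x))) (at x)"
    if "x \<in> W" for x
    using Suc.prems that by (intro bounded_bilinear.FDERIV[OF assms(2)] differentiable_frechet) simp_all
  have "Ck_on k W (\<lambda>x. b (f x) (frechet_derivative g (at x) v) + b (frechet_derivative f (at x) v) (g x))" for v
    using Suc by (intro Ck_on_add assms(1) Suc.IH) (auto intro: Ck_on_Suc_imp)
  then have "Ck_on k W (\<lambda>x. frechet_derivative (\<lambda>x. b (f x) (g x)) (at x) v)" for v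
    by (rule Ck_on_cong[OF assms(1), rotated]) (simp add: frechet_derivative_eqI[OF d])
  then show ?case using d by (auto simp: differentiable_def)
qed

text \<open>The induction keeps \<open>f\<close> fixed: the derivative is a product of the
  derivative of \<open>f\<close> with two copies of the inverse, which the induction hypothesis
  covers one order lower.\<close>

lemma Ck_on_inverse:
  fixes f :: "'a::real_normed_vector \<Rightarrow> real"
  assumes "open W" "Ck_on k W f" "\<And>x. x \<in> W \<Longrightarrow> f x \<noteq> 0"
  shows "Ck_on k W (\<lambda>x. inverse (f x))"
  using assms(2)
proof (induction k)
  case 0
  then show ?case using assms by (auto intro: continuous_on_inverse)
next
  case (Suc k)
  have d: "((\<lambda>x. inverse (f x)) has_derivative
      (\<lambda>v. - (inverse (f x) * frechet_derivative f (at x) v * inverse (f x)))) (at x)"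
    if "x \<in> W" for x
    using Suc.prems that assms(3) by (intro Deriv.has_derivative_inverse differentiable_frechet) simp_all
  have "Ck_on k W (\<lambda>x. - (inverse (f x) * frechet_derivative f (at x) v * inverse (f x)))" for v
    using Suc Ck_on_Suc_imp[OF Suc.prems]
    by (intro Ck_on_bounded_linear_compose[OF assms(1) bounded_linear_minus[OF bounded_linear_ident]]
        Ck_on_bilinear[OF assms(1) bounded_bilinear_mult]) simp_all
  then have "Ck_on k W (\<lambda>x. frechet_derivative (\<lambda>x. inverse (f x)) (at x) v)" for v
    by (intro Ck_on_cong[OF assms(1) _ \<open>Ck_on k W (\<lambda>x. - (inverse (f x) * frechet_derivative f (at x) v * inverse (f x)))\<close>])
      (simp add: frechet_derivative_eqI[OF d])
  then show ?case using d by (auto simp: differentiable_def)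
qed

text \<open>\<open>Ck_on\<close> differentiates in fixed directions, but the chain rule applies the
  derivative of \<open>g\<close> to a direction that varies with \<open>x\<close>. Expanding this
  direction in \<open>Basis\<close> gives a finite sum of products of fixed-direction derivatives;
  hence the Euclidean type in the middle.\<close>

lemma Ck_on_compose:
  fixes f :: "'a::real_normed_vector \<Rightarrow> 'b::euclidean_space" and g :: "'b \<Rightarrow> 'c::real_normed_vector"
  assumes "open W" "Ck_on k W f" "Ck_on k V g" "f ` W \<subseteq> V"
  shows "Ck_on k W (\<lambda>x. g (f x))"
  using assms(2,3)
proof (induction k arbitrary: g)
  case 0
  then show ?case using continuous_on_compose2 assms(4) by auto
next
  case (Suc k)
  have d: "((\<lambda>x. g (f x)) has_derivative
      (\<lambda>v. \<Sum>b\<in>Basis. (frechet_derivative f (at x) v \<bullet> b) *\<^sub>R frechet_derivative g (at (f x)) b)) (at x)"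
    if x: "x \<in> W" for x
  proof -
    have df: "(f has_derivative frechet_derivative f (at x)) (at x)"
      and dg: "(g has_derivative frechet_derivative g (at (f x))) (at (f x))"
      using Suc.prems x assms(4) by (auto intro!: differentiable_frechet)
    have lin: "linear (frechet_derivative g (at (f x)))" using dg by (rule has_derivative_linear)
    have rep: "frechet_derivative g (at (f x)) u = (\<Sum>b\<in>Basis. (u \<bullet> b) *\<^sub>R frechet_derivative g (at (f x)) b)" for u
      by (subst euclidean_representation[of u, symmetric])
        (simp only: linear_sum[OF lin] linear_scale[OF lin])
    show ?thesis
      using diff_chain_at[OF df dg] unfolding o_def by (rule has_derivative_eq_rhs) (rule ext, rule rep)
  qed
  have "Ck_on k W (\<lambda>x. \<Sum>b\<in>Basis. (frechet_derivative f (at x) v \<bullet> b) *\<^sub>R frechet_derivative g (at (f x)) b)" for v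
  proof (intro Ck_on_sum assms(1) Ck_on_bilinear[OF assms(1) bounded_bilinear_scaleR])
    fix b :: 'b
    show "Ck_on k W (\<lambda>x. frechet_derivative f (at x) v \<bullet> b)"
      using Suc.prems by (intro Ck_on_bounded_linear_compose[OF assms(1) bounded_linear_inner_left]) simp
    show "Ck_on k W (\<lambda>x. frechet_derivative g (at (f x)) b)"
      using Suc.prems Ck_on_Suc_imp[OF Suc.prems(1)] by (intro Suc.IH) simp_all
  qed
  then have "Ck_on k W (\<lambda>x. frechet_derivative (\<lambda>x. g (f x)) (at x) v)" for v
    by (rule Ck_on_cong[OF assms(1), rotated]) (simp add: frechet_derivative_eqI[OF d])
  then show ?case using d by (auto simp: differentiable_def)
qed

section \<open>Smoothness on arbitrary subsets through local extensions\<close>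

lemma smooth_on_openI:
  assumes "open S" "\<And>k. Ck_on k S f"
  shows "smooth_on S f"
  unfolding smooth_on_def using assms by blast

lemma smooth_onE:
  assumes "smooth_on S f" "x \<in> S"
  obtains W F where "open W" "x \<in> W" "\<forall>k. Ck_on k W F" "\<forall>y\<in>S \<inter> W. F y = f y"
proof -
  obtain W F where "open W \<and> x \<in> W \<and> (\<forall>k. Ck_on k W F) \<and> (\<forall>y\<in>S \<inter> W. F y = f y)"
    using assms unfolding smooth_on_def by metis
  then show ?thesis by (intro that[of W F]) auto
qed

lemma smooth_onI:
  assumes "\<And>x. x \<in> S \<Longrightarrow> \<exists>W. open W \<and> x \<in> W \<and> (\<exists>F. (\<forall>k. Ck_on k W F) \<and> (\<forall>y\<in>S \<inter> W. F y = f y))"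
  shows "smooth_on S f"
  unfolding smooth_on_def using assms by simp

lemma smooth_on_open_iff:
  assumes "open S"
  shows "smooth_on S f \<longleftrightarrow> (\<forall>k. Ck_on k S f)"
proof
  assume f: "smooth_on S f"
  show "\<forall>k. Ck_on k S f"
  proof (intro allI Ck_on_local assms)
    fix k x assume "x \<in> S"
    then obtain W F where W: "open W" "x \<in> W" "\<forall>k. Ck_on k W F" "\<forall>y\<in>S \<inter> W. F y = f y"
      using f by (auto elim: smooth_onE)
    have "Ck_on k (S \<inter> W) f"
      by (rule Ck_on_cong[of _ F f, OF open_Int[OF assms W(1)] _ Ck_on_subset[OF W(3)[rule_format]]]) (use W(4) in auto)
    then show "\<exists>W. open W \<and> x \<in> W \<and> Ck_on k (S \<inter> W) f" using W by blast
  qed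
qed (use assms smooth_on_openI in blast)

lemma smooth_on_subset:
  assumes "smooth_on S f" "T \<subseteq> S"
  shows "smooth_on T f"
proof (rule smooth_onI)
  fix x assume "x \<in> T"
  then have "x \<in> S" using assms by auto
  with assms(1) obtain W F where W: "open W" "x \<in> W" "\<forall>k. Ck_on k W F" "\<forall>y\<in>S \<inter> W. F y = f y"
    by (rule smooth_onE)
  show "\<exists>W. open W \<and> x \<in> W \<and> (\<exists>F. (\<forall>k. Ck_on k W F) \<and> (\<forall>y\<in>T \<inter> W. F y = f y))"
    by (intro exI[of _ W] conjI exI[of _ F] allI W) (use W(4) assms(2) in auto)
qed

lemma smooth_on_cong:
  assumes "\<And>x. x \<in> S \<Longrightarrow> f x = g x" "smooth_on S f"
  shows "smooth_on S g"
  using assms unfolding smooth_on_def by simp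

lemma smooth_on_local:
  assumes "\<And>x. x \<in> S \<Longrightarrow> \<exists>W. open W \<and> x \<in> W \<and> smooth_on (S \<inter> W) f"
  shows "smooth_on S f"
proof (rule smooth_onI)
  fix x assume "x \<in> S"
  then obtain W where W: "open W" "x \<in> W" "smooth_on (S \<inter> W) f" using assms by blast
  have "x \<in> S \<inter> W" using \<open>x \<in> S\<close> W by simp
  with W(3) obtain V F where V: "open V" "x \<in> V" "\<forall>k. Ck_on k V F" "\<forall>y\<in>S \<inter> W \<inter> V. F y = f y"
    by (rule smooth_onE)
  show "\<exists>W. open W \<and> x \<in> W \<and> (\<exists>F. (\<forall>k. Ck_on k W F) \<and> (\<forall>y\<in>S \<inter> W. F y = f y))"
    by (intro exI[of _ "W \<inter> V"] conjI exI[of _ F] allI open_Int IntI V W Ck_on_subset[OF V(3)[rule_format]])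
      (use V(4) in auto)
qed

lemma smooth_on_compose:
  fixes f :: "'a::real_normed_vector \<Rightarrow> 'b::euclidean_space"
  assumes f: "smooth_on S f" and g: "smooth_on T g" and "f ` S \<subseteq> T"
  shows "smooth_on S (\<lambda>x. g (f x))"
proof (rule smooth_onI)
  fix x assume x: "x \<in> S"
  then have fx: "f x \<in> T" using assms(3) by auto
  from f x obtain W F where W: "open W" "x \<in> W" "\<forall>k. Ck_on k W F" "\<forall>y\<in>S \<inter> W. F y = f y"
    by (rule smooth_onE)
  from g fx obtain V G where V: "open V" "f x \<in> V" "\<forall>k. Ck_on k V G" "\<forall>y\<in>T \<inter> V. G y = g y"
    by (rule smooth_onE)
  have "continuous_on W F" using W(3)[rule_format, of 0] by simp
  \<comment> \<open>The preimage is taken under the extension \<open>F\<close>, which is continuous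
    on an open set; under \<open>f\<close> it would be open only relative to
    \<open>S\<close>.\<close>
  then have op: "open (W \<inter> F -` V)" using W(1) V(1) by (rule continuous_open_preimage)
  have "Ck_on k (W \<inter> F -` V) (\<lambda>x. G (F x))" for k
    by (rule Ck_on_compose[OF op Ck_on_subset[OF W(3)[rule_format]] V(3)[rule_format]]) auto
  then show "\<exists>W. open W \<and> x \<in> W \<and> (\<exists>F. (\<forall>k. Ck_on k W F) \<and> (\<forall>y\<in>S \<inter> W. F y = g (f y)))"
    using W V x assms(3) op
    by (intro exI[of _ "W \<inter> F -` V"] conjI exI[of _ "\<lambda>x. G (F x)"]) auto
qed

lemma smooth_on_bounded_linear: "bounded_linear h \<Longrightarrow> smooth_on S h"
  using smooth_on_subset[OF smooth_on_openI[OF open_UNIV Ck_on_bounded_linear_compose[OF open_UNIV _ Ck_on_id[OF open_UNIV]]]]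
  by blast

lemma smooth_on_const: "smooth_on S (\<lambda>x. c)"
  using smooth_on_subset[OF smooth_on_openI[OF open_UNIV Ck_on_const]] by blast

lemma smooth_on_bilinear:
  assumes "bounded_bilinear b" "smooth_on S f" "smooth_on S g"
  shows "smooth_on S (\<lambda>x. b (f x) (g x))"
proof (rule smooth_onI)
  fix x assume x: "x \<in> S"
  from assms(2) x obtain W F where W: "open W" "x \<in> W" "\<forall>k. Ck_on k W F" "\<forall>y\<in>S \<inter> W. F y = f y"
    by (rule smooth_onE)
  from assms(3) x obtain V G where V: "open V" "x \<in> V" "\<forall>k. Ck_on k V G" "\<forall>y\<in>S \<inter> V. G y = g y"
    by (rule smooth_onE)
  have "Ck_on k (W \<inter> V) (\<lambda>x. b (F x) (G x))" for k
    by (intro Ck_on_bilinear[OF _ assms(1)] open_Int W(1) V(1) Ck_on_subset[OF W(3)[rule_format]] Ck_on_subset[OF V(3)[rule_format]]) auto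
  then show "\<exists>W. open W \<and> x \<in> W \<and> (\<exists>F. (\<forall>k. Ck_on k W F) \<and> (\<forall>y\<in>S \<inter> W. F y = b (f y) (g y)))"
    using W V by (intro exI[of _ "W \<inter> V"] conjI exI[of _ "\<lambda>x. b (F x) (G x)"]) auto
qed

lemma smooth_on_add:
  assumes "smooth_on S f" "smooth_on S g"
  shows "smooth_on S (\<lambda>x. f x + g x)"
proof (rule smooth_onI)
  fix x assume x: "x \<in> S"
  from assms(1) x obtain W F where W: "open W" "x \<in> W" "\<forall>k. Ck_on k W F" "\<forall>y\<in>S \<inter> W. F y = f y"
    by (rule smooth_onE)
  from assms(2) x obtain V G where V: "open V" "x \<in> V" "\<forall>k. Ck_on k V G" "\<forall>y\<in>S \<inter> V. G y = g y"
    by (rule smooth_onE)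
  have "Ck_on k (W \<inter> V) (\<lambda>x. F x + G x)" for k
    by (intro Ck_on_add open_Int W(1) V(1) Ck_on_subset[OF W(3)[rule_format]] Ck_on_subset[OF V(3)[rule_format]]) auto
  then show "\<exists>W. open W \<and> x \<in> W \<and> (\<exists>F. (\<forall>k. Ck_on k W F) \<and> (\<forall>y\<in>S \<inter> W. F y = f y + g y))"
    using W V by (intro exI[of _ "W \<inter> V"] conjI exI[of _ "\<lambda>x. F x + G x"]) auto
qed

lemma smooth_on_sum:
  "(\<And>i. i \<in> I \<Longrightarrow> smooth_on S (f i)) \<Longrightarrow> smooth_on S (\<lambda>x. \<Sum>i\<in>I. f i x)"
  by (induction I rule: infinite_finite_induct) (auto intro: smooth_on_add smooth_on_const)

lemma smooth_on_linear_compose: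
  fixes f :: "'a::real_normed_vector \<Rightarrow> 'b::euclidean_space"
  assumes "bounded_linear h" "smooth_on S f"
  shows "smooth_on S (\<lambda>x. h (f x))"
  using smooth_on_compose[OF assms(2) smooth_on_bounded_linear[OF assms(1), of UNIV]] by simp

lemma smooth_on_inverse:
  fixes f :: "'a::real_normed_vector \<Rightarrow> real"
  assumes "smooth_on S f" "\<And>x. x \<in> S \<Longrightarrow> f x \<noteq> 0"
  shows "smooth_on S (\<lambda>x. inverse (f x))"
proof -
  have "smooth_on (- {0::real}) inverse"
    by (intro smooth_on_openI Ck_on_inverse[of _ _ "\<lambda>x. x"] Ck_on_id) auto
  then show ?thesis using assms by (intro smooth_on_compose[OF assms(1)]) auto
qed

lemma smooth_on_imp_continuous_on:
  assumes "smooth_on S f"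
  shows "continuous_on S f"
proof -
  have "continuous (at x within S) f" if x: "x \<in> S" for x
  proof -
    from assms x obtain W F where W: "open W" "x \<in> W" "\<forall>k. Ck_on k W F" "\<forall>y\<in>S \<inter> W. F y = f y"
      by (rule smooth_onE)
    have "continuous_on W F" using W(3)[rule_format, of 0] by simp
    then have "continuous (at x within S) F"
      using W by (meson continuous_at_imp_continuous_at_within continuous_on_eq_continuous_at)
    moreover have "\<forall>\<^sub>F y in at x within S. F y = f y"
      using W unfolding eventually_at_topological by blast
    ultimately show ?thesis
      using W(4) x W(2) by (simp add: continuous_within) (metis tendsto_cong)
  qed
  then show ?thesis by (simp add: continuous_on_eq_continuous_within)
qed

lemma smooth_on_differentiable: "open S \<Longrightarrow> smooth_on S f \<Longrightarrow> x \<in> S \<Longrightarrow> f differentiable (at x)"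
  unfolding smooth_on_open_iff by (metis Ck_on.simps(2))

lemma smooth_on_frechet:
  "open S \<Longrightarrow> smooth_on S f \<Longrightarrow> smooth_on S (\<lambda>x. frechet_derivative f (at x) v)"
  unfolding smooth_on_open_iff by (metis Ck_on.simps(2))

subsection \<open>Symmetry of second derivatives\<close>

text \<open>The second difference is the increment over \<open>[0, h]\<close> of a first difference.
  The mean value theorem is applied to that increment along \<open>v\<close>, and then to the
  resulting difference of derivatives along \<open>w\<close>.\<close>

lemma second_difference_mvt:
  fixes F :: "'a::real_normed_vector \<Rightarrow> real"
  assumes F: "\<And>y. y \<in> W \<Longrightarrow> (F has_derivative F' y) (at y)"
    and F': "\<And>y. y \<in> W \<Longrightarrow> ((\<lambda>y. F' y v) has_derivative F'' y) (at y)"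
    and h: "0 < h"
    and W: "\<And>s t. 0 \<le> s \<Longrightarrow> s \<le> h \<Longrightarrow> 0 \<le> t \<Longrightarrow> t \<le> h \<Longrightarrow> x + s *\<^sub>R v + t *\<^sub>R w \<in> W"
  obtains s t where "0 \<le> s" "s \<le> h" "0 \<le> t" "t \<le> h"
    "F (x + h *\<^sub>R v + h *\<^sub>R w) - F (x + h *\<^sub>R v) - F (x + h *\<^sub>R w) + F x =
      h * h * F'' (x + s *\<^sub>R v + t *\<^sub>R w) w"
proof -
  define g where "g s = F (x + s *\<^sub>R v + h *\<^sub>R w) - F (x + s *\<^sub>R v)" for s
  have chain: "((\<lambda>s. f (a + s *\<^sub>R u)) has_real_derivative f' u) (at s)"
    if "(f has_derivative f') (at (a + s *\<^sub>R u))" for f :: "'a \<Rightarrow> real" and f' a u s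
  proof -
    have "((\<lambda>s. a + s *\<^sub>R u) has_derivative (\<lambda>r. r *\<^sub>R u)) (at s)"
      by (auto intro!: derivative_eq_intros)
    from diff_chain_at[OF this that] have "((\<lambda>s. f (a + s *\<^sub>R u)) has_derivative (\<lambda>r. f' (r *\<^sub>R u))) (at s)"
      by (simp add: o_def)
    then show ?thesis
      using linear_scale[OF has_derivative_linear[OF that]]
      by (simp add: has_field_derivative_def mult.commute[of _ "f' u"])
  qed
  have W0: "x + s *\<^sub>R v \<in> W" if "0 \<le> s" "s \<le> h" for s
    using W[of s 0] that h by simp
  have "(g has_real_derivative F' (x + s *\<^sub>R v + h *\<^sub>R w) v - F' (x + s *\<^sub>R v) v) (at s)"
    if "0 \<le> s" "s \<le> h" for s
    unfolding g_def
  proof (rule DERIV_diff)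
    have "x + s *\<^sub>R v + h *\<^sub>R w \<in> W" using W that h by simp
    then show "((\<lambda>s. F (x + s *\<^sub>R v + h *\<^sub>R w)) has_real_derivative F' (x + s *\<^sub>R v + h *\<^sub>R w) v) (at s)"
      using chain[of F "F' (x + s *\<^sub>R v + h *\<^sub>R w)" "x + h *\<^sub>R w" s v] F[of "x + s *\<^sub>R v + h *\<^sub>R w"]
      by (simp add: add_ac)
    show "((\<lambda>s. F (x + s *\<^sub>R v)) has_real_derivative F' (x + s *\<^sub>R v) v) (at s)"
      using W0 that by (intro chain F) auto
  qed
  then obtain s where s: "0 < s" "s < h"
    "g h - g 0 = h * (F' (x + s *\<^sub>R v + h *\<^sub>R w) v - F' (x + s *\<^sub>R v) v)"
    using MVT2[of 0 h g "\<lambda>s. F' (x + s *\<^sub>R v + h *\<^sub>R w) v - F' (x + s *\<^sub>R v) v"] h by auto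
  have "((\<lambda>t. F' (x + s *\<^sub>R v + t *\<^sub>R w) v) has_real_derivative F'' (x + s *\<^sub>R v + t *\<^sub>R w) w) (at t)"
    if "0 \<le> t" "t \<le> h" for t
    using W s that by (intro chain[where f = "\<lambda>y. F' y v"] F') auto
  then obtain t where t: "0 < t" "t < h"
    "F' (x + s *\<^sub>R v + h *\<^sub>R w) v - F' (x + s *\<^sub>R v + 0 *\<^sub>R w) v = h * F'' (x + s *\<^sub>R v + t *\<^sub>R w) w"
    using MVT2[of 0 h "\<lambda>t. F' (x + s *\<^sub>R v + t *\<^sub>R w) v" "\<lambda>t. F'' (x + s *\<^sub>R v + t *\<^sub>R w) w"] h by auto
  show ?thesis
    by (rule that[of s t]) (use s t in \<open>auto simp: g_def\<close>)
qed

text \<open>The second difference does not change when \<open>v\<close> and \<open>w\<close> are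
  exchanged. Evaluating it in both orders yields equal values of the two mixed derivatives at two
  points near \<open>x\<close>, and continuity carries the equality to \<open>x\<close>.\<close>

lemma second_derivative_symmetric_real:
  fixes F :: "'a::real_normed_vector \<Rightarrow> real"
  assumes "open W" "x \<in> W" "Ck_on 2 W F"
  shows "frechet_derivative (\<lambda>y. frechet_derivative F (at y) v) (at x) w =
    frechet_derivative (\<lambda>y. frechet_derivative F (at y) w) (at x) v"
proof -
  define D where "D u u' y = frechet_derivative (\<lambda>y. frechet_derivative F (at y) u) (at y) u'" for u u' y
  have C: "F differentiable (at y)" "(\<lambda>y. frechet_derivative F (at y) u) differentiable (at y)"
    "continuous_on W (D u u')" if "y \<in> W" for y u u'
    using assms(3) that unfolding numeral_2_eq_2 D_def by auto
  have "\<bar>D v w x - D w v x\<bar> \<le> 2 * e" if e: "e > 0" for e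
  proof -
    have "\<forall>\<^sub>F y in nhds x. y \<in> W \<and> \<bar>D v w y - D v w x\<bar> < e \<and> \<bar>D w v y - D w v x\<bar> < e"
    proof (intro eventually_conj)
      show "\<forall>\<^sub>F y in nhds x. y \<in> W" using assms by (simp add: eventually_nhds_in_open)
      have near: "\<forall>\<^sub>F y in nhds x. \<bar>D u u' y - D u u' x\<bar> < e" for u u'
      proof -
        have "isCont (D u u') x" using C(3) assms by (simp add: continuous_on_eq_continuous_at)
        then have "(D u u' \<longlongrightarrow> D u u' x) (nhds x)" by (simp add: isCont_def tendsto_nhds_iff)
        then show ?thesis using e by (auto dest!: tendstoD simp: dist_real_def)
      qed
      show "\<forall>\<^sub>F y in nhds x. \<bar>D v w y - D v w x\<bar> < e" by (rule near)
      show "\<forall>\<^sub>F y in nhds x. \<bar>D w v y - D w v x\<bar> < e" by (rule near)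
    qed
    then obtain d where d: "d > 0" and near: "\<And>y. dist y x < d \<Longrightarrow>
        y \<in> W \<and> \<bar>D v w y - D v w x\<bar> < e \<and> \<bar>D w v y - D w v x\<bar> < e"
      unfolding eventually_nhds_metric by blast
    \<comment> \<open>Chosen so that the whole parallelogram with sides \<open>h v\<close> and
      \<open>h w\<close> stays within distance \<open>d\<close> of \<open>x\<close>; the summand 1
      keeps the denominator positive when both vectors vanish.\<close>
    define h where "h = d / (norm v + norm w + 1)"
    have n: "norm v + norm w + 1 > 0" by (meson add_nonneg_pos add_nonneg_nonneg norm_ge_zero zero_less_one)
    then have h: "h > 0" using d by (simp add: h_def)
    have close: "dist (x + s *\<^sub>R a + t *\<^sub>R b) x < d"
      if "0 \<le> s" "s \<le> h" "0 \<le> t" "t \<le> h" "norm a + norm b = norm v + norm w" for s t a b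
    proof -
      have "dist (x + s *\<^sub>R a + t *\<^sub>R b) x = norm (s *\<^sub>R a + t *\<^sub>R b)" by (simp add: dist_norm add.assoc)
      also have "\<dots> \<le> s * norm a + t * norm b" using that by (metis abs_of_nonneg norm_scaleR norm_triangle_ineq)
      also have "\<dots> \<le> h * norm a + h * norm b" using that by (intro add_mono mult_right_mono) auto
      also have "\<dots> = h * (norm v + norm w)" using that(5) by (simp flip: distrib_left)
      also have "\<dots> < h * (norm v + norm w + 1)" using h by (intro mult_strict_left_mono) auto
      also have "\<dots> = d" using n by (simp add: h_def)
      finally show ?thesis .
    qed
    have mvt: "\<exists>s t. 0 \<le> s \<and> s \<le> h \<and> 0 \<le> t \<and> t \<le> h \<and>
        F (x + h *\<^sub>R a + h *\<^sub>R b) - F (x + h *\<^sub>R a) - F (x + h *\<^sub>R b) + F x = h * h * D a b (x + s *\<^sub>R a + t *\<^sub>R b)"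
      if ab: "norm a + norm b = norm v + norm w" for a b
    proof -
      have F: "(F has_derivative frechet_derivative F (at y)) (at y)" if "y \<in> W" for y
        using C that by (intro differentiable_frechet)
      have F': "((\<lambda>y. frechet_derivative F (at y) a) has_derivative
          frechet_derivative (\<lambda>y. frechet_derivative F (at y) a) (at y)) (at y)" if "y \<in> W" for y
        using C that by (intro differentiable_frechet)
      have W: "x + s *\<^sub>R a + t *\<^sub>R b \<in> W" if "0 \<le> s" "s \<le> h" "0 \<le> t" "t \<le> h" for s t
        using near[OF close[OF that ab]] by blast
      show ?thesis
        unfolding D_def by (rule second_difference_mvt[OF F F' h W]) (assumption+, blast)
    qed
    obtain s t where st: "0 \<le> s" "s \<le> h" "0 \<le> t" "t \<le> h"
      "F (x + h *\<^sub>R v + h *\<^sub>R w) - F (x + h *\<^sub>R v) - F (x + h *\<^sub>R w) + F x = h * h * D v w (x + s *\<^sub>R v + t *\<^sub>R w)"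
      using mvt[OF refl] by blast
    obtain s' t' where st': "0 \<le> s'" "s' \<le> h" "0 \<le> t'" "t' \<le> h"
      "F (x + h *\<^sub>R w + h *\<^sub>R v) - F (x + h *\<^sub>R w) - F (x + h *\<^sub>R v) + F x = h * h * D w v (x + s' *\<^sub>R w + t' *\<^sub>R v)"
      using mvt[OF add.commute] by blast
    have "x + h *\<^sub>R w + h *\<^sub>R v = x + h *\<^sub>R v + h *\<^sub>R w" by (simp only: add_ac)
    then have "h * h * D v w (x + s *\<^sub>R v + t *\<^sub>R w) = h * h * D w v (x + s' *\<^sub>R w + t' *\<^sub>R v)"
      using st(5) st'(5) by (simp only:)
    moreover have "h * h \<noteq> 0" using h by (intro no_zero_divisors) auto
    ultimately have "D v w (x + s *\<^sub>R v + t *\<^sub>R w) = D w v (x + s' *\<^sub>R w + t' *\<^sub>R v)"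
      by (simp only: mult_cancel_left simp_thms)
    moreover have "\<bar>D v w (x + s *\<^sub>R v + t *\<^sub>R w) - D v w x\<bar> < e"
      using near[OF close[OF st(1-4) refl]] by simp
    moreover have "\<bar>D w v (x + s' *\<^sub>R w + t' *\<^sub>R v) - D w v x\<bar> < e"
      using near[OF close[OF st'(1-4) add.commute]] by simp
    ultimately show ?thesis by linarith
  qed
  \<comment> \<open>With a quarter of the difference as \<open>e\<close>, a nonzero difference would
    be at most half of itself.\<close>
  from this[of "\<bar>D v w x - D w v x\<bar> / 4"] have "D v w x = D w v x"
    by (cases "D v w x = D w v x") auto
  then show ?thesis by (simp add: D_def)
qed

text \<open>Reduced to components, because the mean value theorem behind the real case fails for
  vector values.\<close>

lemma second_derivative_symmetric:
  fixes F :: "'a::real_normed_vector \<Rightarrow> 'b::euclidean_space"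
  assumes "open W" "x \<in> W" "Ck_on 2 W F"
  shows "frechet_derivative (\<lambda>y. frechet_derivative F (at y) v) (at x) w =
    frechet_derivative (\<lambda>y. frechet_derivative F (at y) w) (at x) v"
proof (rule euclidean_eqI)
  fix b :: 'b
  have F1: "F differentiable (at y)" "(\<lambda>y. frechet_derivative F (at y) u) differentiable (at y)"
    if "y \<in> W" for y u
    using assms(3) that unfolding numeral_2_eq_2 by auto
  have 1: "frechet_derivative (\<lambda>y. F y \<bullet> b) (at y) u = frechet_derivative F (at y) u \<bullet> b" if "y \<in> W" for y u
    by (intro frechet_derivative_eqI bounded_linear.has_derivative[OF bounded_linear_inner_left]
        differentiable_frechet F1 that)
  have 2: "frechet_derivative (\<lambda>y. frechet_derivative (\<lambda>y. F y \<bullet> b) (at y) u) (at x) u' =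
      frechet_derivative (\<lambda>y. frechet_derivative F (at y) u) (at x) u' \<bullet> b" for u u'
  proof (rule frechet_derivative_eqI)
    have "((\<lambda>y. frechet_derivative F (at y) u \<bullet> b) has_derivative
        (\<lambda>u'. frechet_derivative (\<lambda>y. frechet_derivative F (at y) u) (at x) u' \<bullet> b)) (at x)"
      by (intro bounded_linear.has_derivative[OF bounded_linear_inner_left] differentiable_frechet F1 assms)
    then show "((\<lambda>y. frechet_derivative (\<lambda>y. F y \<bullet> b) (at y) u) has_derivative
        (\<lambda>u'. frechet_derivative (\<lambda>y. frechet_derivative F (at y) u) (at x) u' \<bullet> b)) (at x)"
      by (rule has_derivative_transform_within_open[OF _ assms(1,2)]) (simp add: 1)
  qed
  have "Ck_on 2 W (\<lambda>y. F y \<bullet> b)"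
    by (rule Ck_on_bounded_linear_compose[OF assms(1) bounded_linear_inner_left assms(3)])
  from second_derivative_symmetric_real[OF assms(1,2) this, of v w]
  show "frechet_derivative (\<lambda>y. frechet_derivative F (at y) v) (at x) w \<bullet> b =
      frechet_derivative (\<lambda>y. frechet_derivative F (at y) w) (at x) v \<bullet> b"
    unfolding 2 .
qed

section \<open>The exterior derivative\<close>

text \<open>The arguments stay fixed while the base point moves. These evaluations are all that
  \<open>ext_deriv\<close> differentiates, so no norm on a space of forms is involved.\<close>

definition differentiable_form :: "('v::real_normed_vector \<Rightarrow> ('w, real) form) \<Rightarrow> 'v \<Rightarrow> bool" where
  "differentiable_form a x \<longleftrightarrow> (\<forall>vs. (\<lambda>y. a y vs) differentiable (at x))"

lemma differentiable_formD:
  "differentiable_form a x \<Longrightarrow>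
    ((\<lambda>y. a y vs) has_derivative frechet_derivative (\<lambda>y. a y vs) (at x)) (at x)"
  by (simp add: differentiable_form_def frechet_derivative_works)

lemma ext_deriv_Nil: "ext_deriv a x [] = 0"
  by (simp add: ext_deriv_def)

text \<open>Cartan's formula for the constant vector field \<open>v\<close>, whose Lie derivative is
  the directional derivative. It is the counterpart of \<open>wedge_Cons\<close> for the exterior
  derivative.\<close>

lemma ext_deriv_Cons:
  "ext_deriv a x (v # ws) =
    frechet_derivative (\<lambda>y. a y ws) (at x) v - ext_deriv (\<lambda>y. contract v (a y)) x ws"
  by (simp add: ext_deriv_def contract_def sum.lessThan_Suc_shift sum_negf del: sum.lessThan_Suc)

lemma contract_ext_deriv:
  "contract v (ext_deriv a x) = (\<lambda>ws.
    frechet_derivative (\<lambda>y. a y ws) (at x) v - ext_deriv (\<lambda>y. contract v (a y)) x ws)"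
  by (rule ext) (simp add: contract_def[of v "ext_deriv a x"] ext_deriv_Cons)

lemma has_derivative_wedge:
  fixes a b :: "'v::real_normed_vector \<Rightarrow> ('w, real) form"
  assumes "differentiable_form a x" "differentiable_form b x"
  shows "((\<lambda>y. (a y \<and>\<^sub>w b y) vs) has_derivative
    (\<lambda>v. ((\<lambda>us. frechet_derivative (\<lambda>y. a y us) (at x) v) \<and>\<^sub>w b x) vs +
         (a x \<and>\<^sub>w (\<lambda>us. frechet_derivative (\<lambda>y. b y us) (at x) v)) vs)) (at x)"
  unfolding wedge_def
  by (rule has_derivative_eq_rhs, rule has_derivative_sum, rule has_derivative_mult,
      rule has_derivative_mult, rule has_derivative_const, rule differentiable_formD[OF assms(1)],
      rule differentiable_formD[OF assms(2)])
    (simp add: fun_eq_iff sum.distrib[symmetric] algebra_simps)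

lemma frechet_derivative_wedge:
  assumes "differentiable_form a x" "differentiable_form b x"
  shows "frechet_derivative (\<lambda>y. (a y \<and>\<^sub>w b y) vs) (at x) v =
    ((\<lambda>us. frechet_derivative (\<lambda>y. a y us) (at x) v) \<and>\<^sub>w b x) vs +
    (a x \<and>\<^sub>w (\<lambda>us. frechet_derivative (\<lambda>y. b y us) (at x) v)) vs"
  by (rule frechet_derivative_eqI[OF has_derivative_wedge[OF assms]])

lemma differentiable_form_wedge:
  "differentiable_form a x \<Longrightarrow> differentiable_form b x \<Longrightarrow> differentiable_form (\<lambda>y. a y \<and>\<^sub>w b y) x"
  unfolding differentiable_form_def[of "\<lambda>y. a y \<and>\<^sub>w b y"]
  using has_derivative_wedge by (blast intro: differentiableI)

lemma differentiable_form_contract: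
  "differentiable_form a x \<Longrightarrow> differentiable_form (\<lambda>y. contract v (a y)) x"
  by (simp add: differentiable_form_def contract_def)

lemma differentiable_form_add:
  "differentiable_form a x \<Longrightarrow> differentiable_form b x \<Longrightarrow> differentiable_form (\<lambda>y vs. a y vs + b y vs) x"
  by (simp add: differentiable_form_def)

lemma differentiable_form_diff:
  "differentiable_form a x \<Longrightarrow> differentiable_form b x \<Longrightarrow> differentiable_form (\<lambda>y vs. a y vs - b y vs) x"
  by (simp add: differentiable_form_def)

lemma differentiable_form_scale:
  "differentiable_form a x \<Longrightarrow> differentiable_form (\<lambda>y vs. r * a y vs) x"
  by (simp add: differentiable_form_def)

lemma differentiable_form_grade_inv:
  "differentiable_form a x \<Longrightarrow> differentiable_form (\<lambda>y. grade_inv (a y)) x"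
  by (simp add: differentiable_form_def grade_inv_def)

lemma ext_deriv_add:
  assumes "differentiable_form a x" "differentiable_form b x"
  shows "ext_deriv (\<lambda>y vs. a y vs + b y vs) x = (\<lambda>vs. ext_deriv a x vs + ext_deriv b x vs)"
proof -
  have "frechet_derivative (\<lambda>y. a y us + b y us) (at x) v =
      frechet_derivative (\<lambda>y. a y us) (at x) v + frechet_derivative (\<lambda>y. b y us) (at x) v" for us v
    by (intro frechet_derivative_eqI has_derivative_add differentiable_formD assms)
  then show ?thesis
    by (simp add: ext_deriv_def fun_eq_iff sum.distrib distrib_left)
qed

lemma ext_deriv_diff:
  assumes "differentiable_form a x" "differentiable_form b x"
  shows "ext_deriv (\<lambda>y vs. a y vs - b y vs) x = (\<lambda>vs. ext_deriv a x vs - ext_deriv b x vs)"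
proof -
  have "frechet_derivative (\<lambda>y. a y us - b y us) (at x) v =
      frechet_derivative (\<lambda>y. a y us) (at x) v - frechet_derivative (\<lambda>y. b y us) (at x) v" for us v
    by (intro frechet_derivative_eqI has_derivative_diff differentiable_formD assms)
  then show ?thesis
    by (simp add: ext_deriv_def fun_eq_iff sum_subtractf right_diff_distrib)
qed

lemma frechet_derivative_scale:
  assumes "differentiable_form a x"
  shows "frechet_derivative (\<lambda>y. r * a y us) (at x) v = r * frechet_derivative (\<lambda>y. a y us) (at x) v"
  by (intro frechet_derivative_eqI has_derivative_mult_right differentiable_formD assms)

lemma ext_deriv_scale:
  assumes "differentiable_form a x"
  shows "ext_deriv (\<lambda>y vs. r * a y vs) x = (\<lambda>vs. r * ext_deriv a x vs)"
  by (simp add: ext_deriv_def fun_eq_iff sum_distrib_left frechet_derivative_scale[OF assms] algebra_simps)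

lemma ext_deriv_minus:
  assumes "differentiable_form a x"
  shows "ext_deriv (\<lambda>y vs. - a y vs) x = (\<lambda>vs. - ext_deriv a x vs)"
  using ext_deriv_scale[OF assms, of "-1"] by simp

text \<open>The minus sign arises because the exterior derivative raises the degree by one.\<close>

lemma ext_deriv_grade_inv:
  assumes "differentiable_form a x"
  shows "ext_deriv (\<lambda>y. grade_inv (a y)) x = (\<lambda>vs. - grade_inv (ext_deriv a x) vs)"
proof
  fix vs :: "'a list"
  have "frechet_derivative (\<lambda>y. grade_inv (a y) (take i vs @ drop (Suc i) vs)) (at x) v =
      - ((-1) ^ length vs * frechet_derivative (\<lambda>y. a y (take i vs @ drop (Suc i) vs)) (at x) v)"
    if "i < length vs" for i v
  proof -
    have "Suc (length (take i vs @ drop (Suc i) vs)) = length vs" using that by simp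
    then have "(-1::real) ^ length (take i vs @ drop (Suc i) vs) = - ((-1) ^ length vs)"
      by (metis minus_minus mult_minus1 power_Suc)
    then show ?thesis
      using frechet_derivative_scale[OF assms, of "(-1) ^ length (take i vs @ drop (Suc i) vs)"]
      by (simp only: grade_inv_def mult_minus_left)
  qed
  then show "ext_deriv (\<lambda>y. grade_inv (a y)) x vs = - grade_inv (ext_deriv a x) vs"
    by (simp add: ext_deriv_def grade_inv_def[of "ext_deriv a x"] sum_distrib_left sum_negf algebra_simps)
qed

text \<open>Leibniz rule by recursion over the arguments: Cartan's formula on the left and the
  antiderivation property of contraction on the right leave directional derivatives, which obey the
  product rule, and instances of the induction hypothesis for contracted forms.\<close>

theorem ext_deriv_wedge:
  fixes a b :: "'v::real_normed_vector \<Rightarrow> ('v, real) form"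
  assumes "differentiable_form a x" "differentiable_form b x"
  shows "ext_deriv (\<lambda>y. a y \<and>\<^sub>w b y) x =
    (\<lambda>vs. (ext_deriv a x \<and>\<^sub>w b x) vs + (grade_inv (a x) \<and>\<^sub>w ext_deriv b x) vs)"
proof
  fix vs :: "'v list"
  show "ext_deriv (\<lambda>y. a y \<and>\<^sub>w b y) x vs =
      (ext_deriv a x \<and>\<^sub>w b x) vs + (grade_inv (a x) \<and>\<^sub>w ext_deriv b x) vs"
    using assms
  proof (induction vs arbitrary: a b)
    case Nil
    then show ?case by (simp add: ext_deriv_Nil wedge_Nil)
  next
    case (Cons v vs)
    note d = Cons.prems differentiable_form_contract[OF Cons.prems(1), of v]
      differentiable_form_contract[OF Cons.prems(2), of v] differentiable_form_grade_inv[OF Cons.prems(1)]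
    show ?case
      by (simp add: ext_deriv_Cons wedge_Cons contract_wedge contract_ext_deriv wedge_linear
          ext_deriv_add differentiable_form_wedge d Cons.IH frechet_derivative_wedge
          ext_deriv_grade_inv grade_inv_grade_inv contract_grade_inv)
  qed
qed

section \<open>The Maurer--Cartan form of \<open>SU(2) \<ltimes> \<bbbH>\<close> in a chart\<close>

definition qconj :: "quat \<Rightarrow> quat" where
  "qconj a = vector [a$1, - a$2, - a$3, - a$4]"

lemma qconj_nth [simp]:
  "qconj a $ 1 = a $ 1" "qconj a $ 2 = - a $ 2" "qconj a $ 3 = - a $ 3" "qconj a $ 4 = - a $ 4"
  by (simp_all add: qconj_def)

lemma qmult_nth:
  "(a \<bullet>\<^sub>q b) $ 1 = a$1 * b$1 - a$2 * b$2 - a$3 * b$3 - a$4 * b$4"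
  "(a \<bullet>\<^sub>q b) $ 2 = a$1 * b$2 + a$2 * b$1 + a$3 * b$4 - a$4 * b$3"
  "(a \<bullet>\<^sub>q b) $ 3 = a$1 * b$3 - a$2 * b$4 + a$3 * b$1 + a$4 * b$2"
  "(a \<bullet>\<^sub>q b) $ 4 = a$1 * b$4 + a$2 * b$3 - a$3 * b$2 + a$4 * b$1"
  by (simp_all add: qmult_def)

lemma qconj_qmult: "qconj (a \<bullet>\<^sub>q b) = qconj b \<bullet>\<^sub>q qconj a"
  by (simp add: vec_eq_iff forall_4 qmult_nth algebra_simps)

lemma qconj_qmult_self:
  assumes "norm a = 1"
  shows "qconj a \<bullet>\<^sub>q a = vector [1, 0, 0, 0]" "a \<bullet>\<^sub>q qconj a = vector [1, 0, 0, 0]"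
  using norm_quat[of a] assms
  by (simp_all add: vec_eq_iff forall_4 qmult_nth power2_eq_square algebra_simps)

lemma norm_qconj [simp]: "norm (qconj a) = norm a"
  by (rule power2_eq_imp_eq) (simp_all add: norm_quat)

lemma qmult_conj_cancel:
  assumes "norm a = 1"
  shows "qconj a \<bullet>\<^sub>q (a \<bullet>\<^sub>q b) = b" "a \<bullet>\<^sub>q (qconj a \<bullet>\<^sub>q b) = b"
  by (simp_all add: qmult_assoc[symmetric] qconj_qmult_self[OF assms])

lemma qconj_qmult_real: "(qconj a \<bullet>\<^sub>q b) $ 1 = a \<bullet> b"
  by (simp add: qmult_nth inner_vec_def sum_4)

lemma bounded_linear_qconj: "bounded_linear qconj"
  unfolding linear_conv_bounded_linear[symmetric]
  by (rule linearI) (simp_all add: vec_eq_iff forall_4)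

lemma bounded_bilinear_qmult: "bounded_bilinear (\<bullet>\<^sub>q)"
  unfolding bilinear_conv_bounded_bilinear[symmetric] bilinear_def
  by (auto intro!: linearI simp: vec_eq_iff forall_4 qmult_nth algebra_simps)

text \<open>The left-invariant Maurer-Cartan form pulled back along \<open>f\<close>. On unit
  quaternions \<open>qconj\<close> is the inverse, so with \<open>f = (A, q)\<close> the components
  are \<open>A^-1 dA\<close> and \<open>A^-1 dq\<close>.\<close>

definition maurer :: "('e::real_normed_vector \<Rightarrow> quat \<times> quat) \<Rightarrow> 'e \<Rightarrow> 'e \<Rightarrow> quat \<times> quat" where
  "maurer f x v =
     (qconj (fst (f x)) \<bullet>\<^sub>q fst (frechet_derivative f (at x) v),
      qconj (fst (f x)) \<bullet>\<^sub>q snd (frechet_derivative f (at x) v))"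

lemma linear_maurer:
  assumes "f differentiable (at x)"
  shows "linear (maurer f x)"
proof -
  interpret qm: bounded_bilinear "(\<bullet>\<^sub>q)" by (rule bounded_bilinear_qmult)
  have "linear (frechet_derivative f (at x))" by (rule linear_frechet_derivative[OF assms])
  then show ?thesis
    by (intro linearI) (simp_all add: maurer_def linear_add linear_scale qm.add_right qm.scaleR_right)
qed

text \<open>The coframe on the Lie algebra. With \<open>A\<^sup>-\<^sup>1 dA = \<sigma>\<^sub>1 i + \<sigma>\<^sub>2 j + \<sigma>\<^sub>3 k\<close> and
  \<open>A\<^sup>-\<^sup>1 dq = \<theta>\<^sub>0 + \<theta>\<^sub>1 i + \<theta>\<^sub>2 j + \<theta>\<^sub>3 k\<close> it is
  \<open>(\<sigma>\<^sub>2, \<theta>\<^sub>2, \<sigma>\<^sub>1, \<theta>\<^sub>1, \<sigma>\<^sub>3, \<theta>\<^sub>3, \<theta>\<^sub>0)\<close>; the order of the first two pairs matters for the sign of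
  \<open>\<psi>\<^sub>+ + i\<psi>\<^sub>-\<close>.\<close>

definition coframe_fun :: "nat \<Rightarrow> quat \<times> quat \<Rightarrow> real" where
  "coframe_fun i w =
     (if i = 1 then fst w $ 3 else if i = 2 then snd w $ 3 else if i = 3 then fst w $ 2
      else if i = 4 then snd w $ 2 else if i = 5 then fst w $ 4 else if i = 6 then snd w $ 4
      else snd w $ 1)"

definition coframe :: "nat \<Rightarrow> (quat \<times> quat, real) form" where
  "coframe i vs = (if length vs = 1 then coframe_fun i (hd vs) else 0)"

lemma linear_coframe_fun: "linear (coframe_fun i)"
  by (rule linearI) (simp_all add: coframe_fun_def)

lemma alternating_form_coframe: "alternating_form 1 (coframe i)"
proof -
  have "linear (\<lambda>v. coframe i (us @ v # ws))" for us ws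
    using linear_coframe_fun[of i]
    by (cases "length us + length ws = 0") (auto simp: coframe_def linear_zero)
  then show ?thesis
    by (auto simp: alternating_form_iff multilinear_def adj_alternating_def coframe_def)
qed

text \<open>Everything the computations require of an inverse chart, regarded as a map into the
  ambient R^8. Injectivity of the derivative enters separately, only where linear independence of
  the coframe is at stake.\<close>

locale unit_lift =
  fixes U :: "'e::euclidean_space set" and f :: "'e \<Rightarrow> quat \<times> quat"
  assumes open_dom: "open U" and smooth: "smooth_on U f"
    and unit: "\<And>x. x \<in> U \<Longrightarrow> norm (fst (f x)) = 1"
begin

definition e :: "nat \<Rightarrow> 'e \<Rightarrow> ('e, real) form" where
  "e i y vs = coframe i (map (maurer f y) vs)"

lemma differentiable: "x \<in> U \<Longrightarrow> f differentiable (at x)"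
  using open_dom smooth by (rule smooth_on_differentiable)

text \<open>The real part of \<open>A^-1 dA\<close> is the inner product of \<open>A\<close> and
  \<open>dA\<close>, which vanishes on differentiating \<open>|A|^2 = 1\<close>.\<close>

lemma maurer_real:
  assumes "x \<in> U"
  shows "fst (maurer f x v) $ 1 = 0"
proof -
  have df: "(f has_derivative frechet_derivative f (at x)) (at x)"
    using differentiable[OF assms] by (rule differentiable_frechet)
  have "((\<lambda>y. fst (f y) \<bullet> fst (f y)) has_derivative
      (\<lambda>v. fst (f x) \<bullet> fst (frechet_derivative f (at x) v) + fst (frechet_derivative f (at x) v) \<bullet> fst (f x))) (at x)"
    by (intro has_derivative_inner has_derivative_fst df)
  moreover have "((\<lambda>y. fst (f y) \<bullet> fst (f y)) has_derivative (\<lambda>v. 0)) (at x)"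
  proof (rule has_derivative_transform_within_open[OF has_derivative_const open_dom assms])
    show "1 = fst (f y) \<bullet> fst (f y)" if "y \<in> U" for y
      using unit[OF that] by (simp add: dot_square_norm)
  qed
  ultimately have "(\<lambda>v. fst (f x) \<bullet> fst (frechet_derivative f (at x) v) +
      fst (frechet_derivative f (at x) v) \<bullet> fst (f x)) = (\<lambda>v. 0)"
    by (rule has_derivative_unique)
  then have "fst (f x) \<bullet> fst (frechet_derivative f (at x) v) = 0"
    by (simp add: fun_eq_iff inner_commute)
  then show ?thesis by (simp add: maurer_def qconj_qmult_real)
qed

lemma smooth_maurer: "smooth_on U (\<lambda>x. maurer f x v)"
proof -
  have D: "smooth_on U (\<lambda>x. frechet_derivative f (at x) v)"
    by (rule smooth_on_frechet[OF open_dom smooth])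
  have q: "smooth_on U (\<lambda>x. qconj (fst (f x)))"
    by (rule smooth_on_linear_compose[OF _ smooth])
      (use bounded_linear_compose[OF bounded_linear_qconj bounded_linear_fst] in \<open>simp add: o_def\<close>)
  have 1: "smooth_on U (\<lambda>x. qconj (fst (f x)) \<bullet>\<^sub>q fst (frechet_derivative f (at x) v))"
    by (rule smooth_on_bilinear[OF bounded_bilinear_qmult q smooth_on_linear_compose[OF bounded_linear_fst D]])
  have 2: "smooth_on U (\<lambda>x. qconj (fst (f x)) \<bullet>\<^sub>q snd (frechet_derivative f (at x) v))"
    by (rule smooth_on_bilinear[OF bounded_bilinear_qmult q smooth_on_linear_compose[OF bounded_linear_snd D]])
  have l: "bounded_linear (\<lambda>a::quat. (a, 0::quat))" "bounded_linear (\<lambda>a::quat. (0::quat, a))"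
    by (intro bounded_linear_Pair bounded_linear_ident bounded_linear_zero)+
  show ?thesis
    using smooth_on_add[OF smooth_on_linear_compose[OF l(1) 1] smooth_on_linear_compose[OF l(2) 2]]
    by (simp add: maurer_def)
qed

lemma smooth_e: "smooth_on U (\<lambda>x. e i x vs)"
proof (cases "length vs = 1")
  case True
  then obtain v where "vs = [v]" by (auto simp: length_Suc_conv)
  then show ?thesis
    using smooth_on_linear_compose[OF linear_coframe_fun[unfolded linear_conv_bounded_linear] smooth_maurer]
    by (simp add: e_def coframe_def)
next
  case False
  then show ?thesis by (simp add: e_def coframe_def smooth_on_const)
qed

lemma alternating_e: "x \<in> U \<Longrightarrow> alternating_form 1 (e i x)"
  unfolding e_def[abs_def]
  by (rule alternating_form_map[OF alternating_form_coframe linear_maurer[OF differentiable]])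

lemma differentiable_e: "x \<in> U \<Longrightarrow> differentiable_form (e i) x"
  unfolding differentiable_form_def using smooth_on_differentiable[OF open_dom smooth_e] by blast

text \<open>The second derivatives of \<open>f\<close> cancel by symmetry, leaving the products of
  \<open>qconj (dA)\<close> with \<open>dA\<close> and with \<open>dq\<close>. As
  \<open>A^-1 dA\<close> is imaginary, its conjugate is its negative, and the right-hand side is the
  usual negative wedge product.\<close>

lemma maurer_cartan:
  assumes x: "x \<in> U"
  shows "frechet_derivative (\<lambda>y. maurer f y w) (at x) v - frechet_derivative (\<lambda>y. maurer f y v) (at x) w =
    (qconj (fst (maurer f x v)) \<bullet>\<^sub>q fst (maurer f x w) - qconj (fst (maurer f x w)) \<bullet>\<^sub>q fst (maurer f x v),
     qconj (fst (maurer f x v)) \<bullet>\<^sub>q snd (maurer f x w) - qconj (fst (maurer f x w)) \<bullet>\<^sub>q snd (maurer f x v))"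
proof -
  let ?D = "frechet_derivative f (at x)"
  let ?D2 = "\<lambda>w. frechet_derivative (\<lambda>y. frechet_derivative f (at y) w) (at x)"
  let ?c = "qconj (fst (f x))"
  have df: "(f has_derivative ?D) (at x)"
    using differentiable[OF x] by (rule differentiable_frechet)
  have d2: "((\<lambda>y. frechet_derivative f (at y) w) has_derivative ?D2 w) (at x)" for w
    by (intro differentiable_frechet smooth_on_differentiable[OF open_dom _ x] smooth_on_frechet open_dom smooth)
  have "((\<lambda>y. maurer f y w) has_derivative (\<lambda>v.
      (?c \<bullet>\<^sub>q fst (?D2 w v) + qconj (fst (?D v)) \<bullet>\<^sub>q fst (?D w),
       ?c \<bullet>\<^sub>q snd (?D2 w v) + qconj (fst (?D v)) \<bullet>\<^sub>q snd (?D w)))) (at x)" for w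
    unfolding maurer_def
    by (intro has_derivative_Pair bounded_bilinear.FDERIV[OF bounded_bilinear_qmult] has_derivative_fst
        has_derivative_snd bounded_linear.has_derivative[OF bounded_linear_qconj] df d2)
  then have D: "frechet_derivative (\<lambda>y. maurer f y w) (at x) v =
      (?c \<bullet>\<^sub>q fst (?D2 w v) + qconj (fst (?D v)) \<bullet>\<^sub>q fst (?D w),
       ?c \<bullet>\<^sub>q snd (?D2 w v) + qconj (fst (?D v)) \<bullet>\<^sub>q snd (?D w))" for v w
    by (rule frechet_derivative_eqI)
  have sym: "?D2 w v = ?D2 v w"
    using smooth by (intro second_derivative_symmetric[OF open_dom x]) (simp add: smooth_on_open_iff open_dom)
  \<comment> \<open>Inserts the product of \<open>fst (f x)\<close> with its conjugate between the
    factors, which turns bare derivatives into Maurer-Cartan components.\<close>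
  have insert_unit: "qconj a \<bullet>\<^sub>q b = qconj (?c \<bullet>\<^sub>q a) \<bullet>\<^sub>q (?c \<bullet>\<^sub>q b)" for a b
  proof -
    have "qconj (?c \<bullet>\<^sub>q a) \<bullet>\<^sub>q (?c \<bullet>\<^sub>q b) = qconj a \<bullet>\<^sub>q (qconj ?c \<bullet>\<^sub>q (?c \<bullet>\<^sub>q b))"
      by (simp only: qconj_qmult qmult_assoc)
    then show ?thesis using qmult_conj_cancel(1)[of ?c b] unit[OF x] by simp
  qed
  show ?thesis
    unfolding D sym by (simp add: maurer_def insert_unit[symmetric])
qed

lemma ext_deriv_e:
  assumes x: "x \<in> U"
  shows "ext_deriv (e i) x vs = (if length vs = 2 then
    coframe_fun i
      (qconj (fst (maurer f x (vs!0))) \<bullet>\<^sub>q fst (maurer f x (vs!1)) - qconj (fst (maurer f x (vs!1))) \<bullet>\<^sub>q fst (maurer f x (vs!0)),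
       qconj (fst (maurer f x (vs!0))) \<bullet>\<^sub>q snd (maurer f x (vs!1)) - qconj (fst (maurer f x (vs!1))) \<bullet>\<^sub>q snd (maurer f x (vs!0)))
    else 0)"
proof -
  have z: "frechet_derivative (\<lambda>y. 0::real) (at x) v = 0" for v
    by (rule frechet_derivative_eqI) (rule has_derivative_const)
  show ?thesis
  proof (cases "length vs = 2")
    case False
    have "e i y (take j vs @ drop (Suc j) vs) = 0" if "j < length vs" for j y
    proof -
      have "length (take j vs @ drop (Suc j) vs) \<noteq> 1" using False that by simp
      then show ?thesis by (simp add: e_def coframe_def)
    qed
    then show ?thesis using False by (simp add: ext_deriv_def z)
  next
    case True
    then obtain v w where vs: "vs = [v, w]" by (auto simp: numeral_2_eq_2 length_Suc_conv)
    have "frechet_derivative (\<lambda>y. coframe_fun i (maurer f y w)) (at x) v =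
        coframe_fun i (frechet_derivative (\<lambda>y. maurer f y w) (at x) v)" for v w
      by (intro frechet_derivative_eqI
          bounded_linear.has_derivative[OF linear_coframe_fun[unfolded linear_conv_bounded_linear]]
          differentiable_frechet smooth_on_differentiable[OF open_dom smooth_maurer x])
    then have "ext_deriv (e i) x [v, w] =
        coframe_fun i (frechet_derivative (\<lambda>y. maurer f y w) (at x) v - frechet_derivative (\<lambda>y. maurer f y v) (at x) w)"
      by (simp add: ext_deriv_Cons ext_deriv_Nil e_def coframe_def contract_def linear_diff[OF linear_coframe_fun])
    then show ?thesis unfolding maurer_cartan[OF x] by (simp add: vs)
  qed
qed

lemma e_degree: "length vs \<noteq> 1 \<Longrightarrow> e i x vs = 0"
  by (simp add: e_def coframe_def)

lemma e_wedge_e: "(e i x \<and>\<^sub>w e j x) vs =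
  (if length vs = 2 then e i x [vs!0] * e j x [vs!1] - e i x [vs!1] * e j x [vs!0] else 0)"
proof (cases "length vs = 2")
  case True
  then obtain v w where vs: "vs = [v, w]" by (auto simp: numeral_2_eq_2 length_Suc_conv)
  show ?thesis
    by (simp add: vs wedge_Cons wedge_Nil contract_wedge)
      (simp add: contract_def grade_inv_def e_degree wedge_Nil)
next
  case False
  then show ?thesis using wedge_degree[of 1 "e i x" 1 "e j x" vs] by (simp add: e_degree)
qed

text \<open>The quaternion multiplication table applied to the Maurer-Cartan equation. The units i,
  j, k belong to \<open>e 3\<close>, \<open>e 1\<close>, \<open>e 5\<close> in this order, so the
  signs are not cyclic in the indices.\<close>

lemma structure_equations:
  assumes x: "x \<in> U"
  shows "ext_deriv (e 1) x = (\<lambda>vs. 2 * (e 3 x \<and>\<^sub>w e 5 x) vs)"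
    "ext_deriv (e 3) x = (\<lambda>vs. - 2 * (e 1 x \<and>\<^sub>w e 5 x) vs)"
    "ext_deriv (e 5) x = (\<lambda>vs. 2 * (e 1 x \<and>\<^sub>w e 3 x) vs)"
    "ext_deriv (e 2) x = (\<lambda>vs. - (e 1 x \<and>\<^sub>w e 7 x) vs - (e 5 x \<and>\<^sub>w e 4 x) vs + (e 3 x \<and>\<^sub>w e 6 x) vs)"
    "ext_deriv (e 4) x = (\<lambda>vs. - (e 3 x \<and>\<^sub>w e 7 x) vs - (e 1 x \<and>\<^sub>w e 6 x) vs + (e 5 x \<and>\<^sub>w e 2 x) vs)"
    "ext_deriv (e 6) x = (\<lambda>vs. - (e 5 x \<and>\<^sub>w e 7 x) vs - (e 3 x \<and>\<^sub>w e 2 x) vs + (e 1 x \<and>\<^sub>w e 4 x) vs)"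
    "ext_deriv (e 7) x = (\<lambda>vs. (e 1 x \<and>\<^sub>w e 2 x) vs + (e 3 x \<and>\<^sub>w e 4 x) vs + (e 5 x \<and>\<^sub>w e 6 x) vs)"
  by (simp_all add: fun_eq_iff ext_deriv_e[OF x] e_wedge_e e_def coframe_def coframe_fun_def qmult_nth
      maurer_real[OF x] algebra_simps)

text \<open>The coframe separates tangent vectors because \<open>A\<^sup>-\<^sup>1 dA\<close> is purely imaginary, so seven of the
  eight components of the Maurer--Cartan form determine it.\<close>

lemma e_injective:
  assumes x: "x \<in> U" and inj: "inj (frechet_derivative f (at x))"
    and z: "\<And>i. i \<in> {1..7} \<Longrightarrow> e i x [v] = 0"
  shows "v = 0"
proof -
  have "coframe_fun i (maurer f x v) = 0" if "i \<in> {1..7}" for i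
    using z[OF that] by (simp add: e_def coframe_def)
  from this[of 1] this[of 2] this[of 3] this[of 4] this[of 5] this[of 6] this[of 7]
  have "maurer f x v = 0"
    using maurer_real[OF x, of v] by (simp add: coframe_fun_def prod_eq_iff vec_eq_iff forall_4)
  then have "fst (f x) \<bullet>\<^sub>q (qconj (fst (f x)) \<bullet>\<^sub>q fst (frechet_derivative f (at x) v)) = fst (f x) \<bullet>\<^sub>q 0"
    "fst (f x) \<bullet>\<^sub>q (qconj (fst (f x)) \<bullet>\<^sub>q snd (frechet_derivative f (at x) v)) = fst (f x) \<bullet>\<^sub>q 0"
    by (simp_all add: maurer_def prod_eq_iff)
  then have "frechet_derivative f (at x) v = 0"
    unfolding qmult_conj_cancel(2)[OF unit[OF x]] bounded_bilinear.zero_right[OF bounded_bilinear_qmult]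
    by (simp add: prod_eq_iff)
  then show ?thesis
    using inj linear_injective_0[OF linear_frechet_derivative[OF differentiable[OF x]]] by blast
qed

end

text \<open>Left translation by \<open>(a, b)\<close> multiplies both derivatives by
  \<open>a\<close>, and this factor cancels against the conjugate of \<open>a\<close> in the
  inverse. Here \<tau> is the translation in coordinates.\<close>

lemma maurer_translate:
  fixes f :: "'e::real_normed_vector \<Rightarrow> quat \<times> quat" and h :: "'e \<Rightarrow> quat \<times> quat"
  assumes f: "f differentiable (at x)" and h: "h differentiable (at (\<tau> x))"
    and \<tau>: "\<tau> differentiable (at x)" and a: "norm a = 1"
    and W: "open W" "x \<in> W" "\<And>y. y \<in> W \<Longrightarrow> h (\<tau> y) = (a \<bullet>\<^sub>q fst (f y), a \<bullet>\<^sub>q snd (f y) + b)"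
  shows "maurer h (\<tau> x) (frechet_derivative \<tau> (at x) v) = maurer f x v"
proof -
  have "((\<lambda>y. h (\<tau> y)) has_derivative (\<lambda>v. frechet_derivative h (at (\<tau> x)) (frechet_derivative \<tau> (at x) v))) (at x)"
    using diff_chain_at[OF differentiable_frechet[OF \<tau>] differentiable_frechet[OF h]] by (simp add: o_def)
  moreover have "((\<lambda>y. (a \<bullet>\<^sub>q fst (f y), a \<bullet>\<^sub>q snd (f y) + b)) has_derivative
      (\<lambda>v. (a \<bullet>\<^sub>q fst (frechet_derivative f (at x) v), a \<bullet>\<^sub>q snd (frechet_derivative f (at x) v) + 0))) (at x)"
    by (intro has_derivative_Pair has_derivative_add has_derivative_const has_derivative_fst has_derivative_snd
        bounded_linear.has_derivative[OF bounded_bilinear.bounded_linear_right[OF bounded_bilinear_qmult]]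
        differentiable_frechet f)
  then have "((\<lambda>y. h (\<tau> y)) has_derivative
      (\<lambda>v. (a \<bullet>\<^sub>q fst (frechet_derivative f (at x) v), a \<bullet>\<^sub>q snd (frechet_derivative f (at x) v) + 0))) (at x)"
    by (rule has_derivative_transform_within_open[OF _ W(1,2)]) (simp add: W(3))
  ultimately have D: "frechet_derivative h (at (\<tau> x)) (frechet_derivative \<tau> (at x) v) =
      (a \<bullet>\<^sub>q fst (frechet_derivative f (at x) v), a \<bullet>\<^sub>q snd (frechet_derivative f (at x) v))"
    by (metis (no_types, lifting) has_derivative_unique add.right_neutral)
  have "qconj (a \<bullet>\<^sub>q c) \<bullet>\<^sub>q (a \<bullet>\<^sub>q d) = qconj c \<bullet>\<^sub>q d" for c d
    by (simp only: qconj_qmult qmult_assoc qmult_conj_cancel[OF a])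
  then show ?thesis by (simp add: maurer_def D W(3)[OF W(2)])
qed

section \<open>The weakly integrable structure on the Lie algebra\<close>

definition omega0 :: "(quat \<times> quat, real) form" where
  "omega0 = (\<lambda>vs. (coframe 1 \<and>\<^sub>w coframe 2) vs + (coframe 3 \<and>\<^sub>w coframe 4) vs + (coframe 5 \<and>\<^sub>w coframe 6) vs)"

definition psi0 :: "(quat \<times> quat, complex) form" where
  "psi0 = cform (coframe 1) (coframe 2) \<and>\<^sub>w cform (coframe 3) (coframe 4) \<and>\<^sub>w cform (coframe 5) (coframe 6)"

definition psip0 :: "(quat \<times> quat, real) form" where
  "psip0 = (\<lambda>vs. Re (psi0 vs))"

definition psim0 :: "(quat \<times> quat, real) form" where
  "psim0 = (\<lambda>vs. Im (psi0 vs))"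

definition flux0 :: "(quat \<times> quat, real) form" where
  "flux0 = (\<lambda>vs. 2 * (coframe 3 \<and>\<^sub>w coframe 1 \<and>\<^sub>w coframe 5) vs)"

lemma psi0_eq:
  "psip0 = (\<lambda>vs.
     (coframe 1 \<and>\<^sub>w (\<lambda>us. (coframe 3 \<and>\<^sub>w coframe 5) us - (coframe 4 \<and>\<^sub>w coframe 6) us)) vs -
     (coframe 2 \<and>\<^sub>w (\<lambda>us. (coframe 3 \<and>\<^sub>w coframe 6) us + (coframe 4 \<and>\<^sub>w coframe 5) us)) vs)"
  "psim0 = (\<lambda>vs.
     (coframe 1 \<and>\<^sub>w (\<lambda>us. (coframe 3 \<and>\<^sub>w coframe 6) us + (coframe 4 \<and>\<^sub>w coframe 5) us)) vs +
     (coframe 2 \<and>\<^sub>w (\<lambda>us. (coframe 3 \<and>\<^sub>w coframe 5) us - (coframe 4 \<and>\<^sub>w coframe 6) us)) vs)"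
  by (simp_all add: psip0_def psim0_def psi0_def cform_wedge) (simp_all add: cform_def)

lemma alternating_form_0:
  "alternating_form 2 omega0" "alternating_form 3 psip0" "alternating_form 3 psim0" "alternating_form 3 flux0"
proof -
  have 2: "alternating_form 2 (coframe i \<and>\<^sub>w coframe j)" for i j
    using alternating_form_wedge[OF alternating_form_coframe alternating_form_coframe] by (simp add: numeral_2_eq_2)
  have 3: "alternating_form 3 (coframe i \<and>\<^sub>w a)" if "alternating_form 2 a" for i a
    using alternating_form_wedge[OF alternating_form_coframe that, of i] by (simp add: numeral_3_eq_3)
  show "alternating_form 2 omega0"
    unfolding omega0_def by (intro alternating_form_add 2)
  show "alternating_form 3 psip0" "alternating_form 3 psim0"
    unfolding psi0_eq by (intro alternating_form_add alternating_form_diff 2 3)+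
  show "alternating_form 3 flux0"
    unfolding flux0_def by (intro alternating_form_scale 2 3)
qed

section \<open>Weak integrability as an identity between coframe monomials\<close>

context unit_lift
begin

definition pull :: "(quat \<times> quat, real) form \<Rightarrow> 'e \<Rightarrow> ('e, real) form" where
  "pull S y vs = S (map (maurer f y) vs)"

lemma pull_coframe: "pull (coframe i) y = e i y"
  by (simp add: fun_eq_iff pull_def e_def)

lemma pull_wedge: "pull (a \<and>\<^sub>w b) y = pull a y \<and>\<^sub>w pull b y"
  by (simp add: fun_eq_iff pull_def[abs_def] wedge_map)

lemma pull_linear:
  "pull (\<lambda>vs. a vs + b vs) y = (\<lambda>vs. pull a y vs + pull b y vs)"
  "pull (\<lambda>vs. a vs - b vs) y = (\<lambda>vs. pull a y vs - pull b y vs)"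
  "pull (\<lambda>vs. r * a vs) y = (\<lambda>vs. r * pull a y vs)"
  by (simp_all add: fun_eq_iff pull_def)

lemmas pull_simps = pull_coframe pull_wedge pull_linear

text \<open>The condition \<open>i < j\<close> makes these usable as terminating rewrite rules:
  monomials are sorted by index and those with a repeated factor vanish. Together with linearity and
  associativity this yields a normal form for polynomials in the coframe.\<close>

lemma e_reorder:
  "i < j \<Longrightarrow> e j x \<and>\<^sub>w e i x = (\<lambda>vs. - (e i x \<and>\<^sub>w e j x) vs)"
  "i < j \<Longrightarrow> e j x \<and>\<^sub>w e i x \<and>\<^sub>w b = (\<lambda>vs. - (e i x \<and>\<^sub>w e j x \<and>\<^sub>w b) vs)"
  "e i x \<and>\<^sub>w e i x = (\<lambda>vs. 0)"
  "e i x \<and>\<^sub>w e i x \<and>\<^sub>w b = (\<lambda>vs. 0)"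
proof -
  have 1: "e j x \<and>\<^sub>w e i x = (\<lambda>vs. - (e i x \<and>\<^sub>w e j x) vs)" for i j
    by (rule wedge_antisym) (simp_all add: e_degree)
  show "e j x \<and>\<^sub>w e i x = (\<lambda>vs. - (e i x \<and>\<^sub>w e j x) vs)" by (rule 1)
  show "e j x \<and>\<^sub>w e i x \<and>\<^sub>w b = (\<lambda>vs. - (e i x \<and>\<^sub>w e j x \<and>\<^sub>w b) vs)"
    by (simp only: 1[of j i] wedge_assoc[symmetric] wedge_minus_left)
  show 2: "e i x \<and>\<^sub>w e i x = (\<lambda>vs. 0)" by (simp add: fun_eq_iff e_wedge_e)
  show "e i x \<and>\<^sub>w e i x \<and>\<^sub>w b = (\<lambda>vs. 0)"
    by (simp only: 2 wedge_assoc[symmetric] wedge_zero_left)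
qed

lemma ext_deriv_e_wedge:
  assumes "x \<in> U" "differentiable_form b x"
  shows "ext_deriv (\<lambda>y. e i y \<and>\<^sub>w b y) x =
    (\<lambda>vs. (ext_deriv (e i) x \<and>\<^sub>w b x) vs - (e i x \<and>\<^sub>w ext_deriv b x) vs)"
proof -
  have "grade_inv (e i x) = (\<lambda>vs. - e i x vs)"
  proof
    fix vs show "grade_inv (e i x) vs = - e i x vs"
      by (cases "length vs = 1") (simp_all add: grade_inv_def e_degree)
  qed
  then show ?thesis
    using ext_deriv_wedge[OF differentiable_e[OF assms(1)] assms(2)] by (simp add: wedge_linear)
qed

lemma differentiable_e_wedge:
  "x \<in> U \<Longrightarrow> differentiable_form b x \<Longrightarrow> differentiable_form (\<lambda>y. e i y \<and>\<^sub>w b y) x"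
  by (intro differentiable_form_wedge differentiable_e)

lemmas ext_deriv_simps = ext_deriv_add ext_deriv_diff ext_deriv_scale ext_deriv_minus ext_deriv_e_wedge
  differentiable_form_add differentiable_form_diff differentiable_form_scale differentiable_e_wedge
  differentiable_e structure_equations

text \<open>The derivative of each \<sigma> is a multiple of the product of the other two, so every
  term of the Leibniz expansion contains a repeated factor.\<close>

lemma closed_flux:
  assumes "x \<in> U"
  shows "ext_deriv (pull flux0) x vs = 0"
proof -
  have "pull flux0 = (\<lambda>y vs. 2 * (e 3 y \<and>\<^sub>w e 1 y \<and>\<^sub>w e 5 y) vs)"
    unfolding flux0_def by (rule ext) (simp only: pull_simps)
  then show ?thesis
    \<comment> \<open>Without \<open>One_nat_def\<close> the index 1 remains a numeral, so that
      \<open>e 1\<close> matches the structure equations and the rules for sorting.\<close>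
    using assms by (simp add: ext_deriv_simps wedge_linear wedge_assoc e_reorder del: One_nat_def)
qed

text \<open>Both sides are brought to sorted monomials. Degree 6 balances as -1/2 + 1/3 = -1/6: the
  derivative of \<omega> \<and> \<omega> \<and> \<alpha> is the cube of \<omega>, and the flux
  wedged with minus \<open>psim0\<close> is a third of that cube. In degree 8 every term of the left
  side repeats some \<sigma>.\<close>

lemma weakly_integrable_pull:
  assumes x: "x \<in> U"
  defines "\<rho> \<equiv> \<lambda>y vs. e 7 y vs - pull psim0 y vs - 1/2 * (pull omega0 y \<and>\<^sub>w pull omega0 y \<and>\<^sub>w e 7 y) vs"
  shows "ext_deriv \<rho> x vs + (pull flux0 x \<and>\<^sub>w \<rho> x) vs =
    pull omega0 x vs + (pull psip0 x \<and>\<^sub>w e 7 x) vs - 1/6 * (pull omega0 x \<and>\<^sub>w pull omega0 x \<and>\<^sub>w pull omega0 x) vs"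
proof -
  have om: "pull omega0 y = (\<lambda>vs. (e 1 y \<and>\<^sub>w e 2 y) vs + (e 3 y \<and>\<^sub>w e 4 y) vs + (e 5 y \<and>\<^sub>w e 6 y) vs)" for y
    unfolding omega0_def by (simp only: pull_simps)
  \<comment> \<open>In the square of \<omega> each mixed product of two pairs occurs twice, which
    absorbs the factor 1/2.\<close>
  have \<rho>: "\<rho> = (\<lambda>y vs. e 7 y vs
      - ((e 1 y \<and>\<^sub>w e 3 y \<and>\<^sub>w e 6 y) vs + (e 1 y \<and>\<^sub>w e 4 y \<and>\<^sub>w e 5 y) vs
         + ((e 2 y \<and>\<^sub>w e 3 y \<and>\<^sub>w e 5 y) vs - (e 2 y \<and>\<^sub>w e 4 y \<and>\<^sub>w e 6 y) vs))
      - ((e 1 y \<and>\<^sub>w e 2 y \<and>\<^sub>w e 3 y \<and>\<^sub>w e 4 y \<and>\<^sub>w e 7 y) vs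
         + (e 1 y \<and>\<^sub>w e 2 y \<and>\<^sub>w e 5 y \<and>\<^sub>w e 6 y \<and>\<^sub>w e 7 y) vs
         + (e 3 y \<and>\<^sub>w e 4 y \<and>\<^sub>w e 5 y \<and>\<^sub>w e 6 y \<and>\<^sub>w e 7 y) vs))"
    unfolding \<rho>_def psi0_eq
    by (intro ext) (simp add: pull_simps om wedge_linear wedge_assoc e_reorder algebra_simps del: One_nat_def)
  have psip: "pull psip0 x = (\<lambda>vs. (e 1 x \<and>\<^sub>w e 3 x \<and>\<^sub>w e 5 x) vs - (e 1 x \<and>\<^sub>w e 4 x \<and>\<^sub>w e 6 x) vs
      - ((e 2 x \<and>\<^sub>w e 3 x \<and>\<^sub>w e 6 x) vs + (e 2 x \<and>\<^sub>w e 4 x \<and>\<^sub>w e 5 x) vs))"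
    unfolding psi0_eq by (simp add: pull_simps wedge_linear wedge_assoc)
  have flux: "pull flux0 x = (\<lambda>vs. - 2 * (e 1 x \<and>\<^sub>w e 3 x \<and>\<^sub>w e 5 x) vs)"
    unfolding flux0_def by (simp add: pull_simps wedge_linear wedge_assoc e_reorder del: One_nat_def)
  show ?thesis
    unfolding \<rho> psip flux om
    by (simp add: x ext_deriv_simps wedge_linear wedge_assoc e_reorder algebra_simps del: One_nat_def)
qed

end

section \<open>Charts of the group\<close>

lemma chart_inv_simps:
  assumes "inj_on (snd c) (fst c)"
  shows "p \<in> fst c \<Longrightarrow> chart_inv c (snd c p) = p"
    "y \<in> chart_image c \<Longrightarrow> chart_inv c y \<in> fst c"
    "y \<in> chart_image c \<Longrightarrow> snd c (chart_inv c y) = y"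
  using assms by (simp_all add: chart_inv_def chart_image_def inv_into_into f_inv_into_f)

lemma embedded_atlasI:
  fixes s :: "'x::euclidean_space \<Rightarrow> 'e::euclidean_space"
  assumes "openin (top_of_set S) D" "open E" "smooth_on D s" "smooth_on E t"
    and st: "\<And>x. x \<in> D \<Longrightarrow> s x \<in> E" "\<And>x. x \<in> D \<Longrightarrow> t (s x) = x"
      "\<And>y. y \<in> E \<Longrightarrow> t y \<in> D" "\<And>y. y \<in> E \<Longrightarrow> s (t y) = y"
  shows "(D, s) \<in> embedded_atlas S"
proof -
  have inj: "inj_on s D" by (metis inj_onI st(2))
  have im: "chart_image (D, s) = E"
  proof (intro equalityI subsetI)
    fix y assume "y \<in> E"
    then have "y = s (t y)" "t y \<in> D" by (simp_all add: st)
    then show "y \<in> chart_image (D, s)" by (auto simp: chart_image_def)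
  qed (auto simp: chart_image_def st)
  have "smooth_on E (chart_inv (D, s))"
  proof (rule smooth_on_cong[OF _ assms(4)])
    fix y assume "y \<in> E"
    then show "t y = chart_inv (D, s) y"
      using chart_inv_simps(1)[of "(D, s)" "t y"] inj st by simp
  qed
  then show ?thesis using assms inj im by (simp add: embedded_atlas_def)
qed

context
  fixes c :: "('x::euclidean_space, 'e::euclidean_space) chart" and S
  assumes c: "c \<in> embedded_atlas S"
begin

lemma embedded_atlasD:
  "openin (top_of_set S) (fst c)" "inj_on (snd c) (fst c)" "open (chart_image c)"
  "smooth_on (fst c) (snd c)" "smooth_on (chart_image c) (chart_inv c)" "fst c \<subseteq> S"
  using c openin_imp_subset unfolding embedded_atlas_def by auto

lemmas embedded_chart_inv = chart_inv_simps[OF embedded_atlasD(2)]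

text \<open>The chart extends smoothly to an open subset of the ambient space near the point. The
  derivative of this extension is a left inverse of the derivative of
  \<open>chart_inv c\<close>.\<close>

lemma frechet_chart_inv_injective:
  assumes y: "y \<in> chart_image c"
  shows "inj (frechet_derivative (chart_inv c) (at y))"
proof -
  let ?f = "chart_inv c"
  from embedded_atlasD(4) embedded_chart_inv(2)[OF y]
  obtain W F where W: "open W" "?f y \<in> W" "\<forall>k. Ck_on k W F" "\<forall>p\<in>fst c \<inter> W. F p = snd c p"
    by (rule smooth_onE)
  have f: "?f differentiable (at y)"
    by (rule smooth_on_differentiable[OF embedded_atlasD(3,5) y])
  have "F differentiable (at (?f y))" using W(2) W(3)[rule_format, of 1] by simp
  from diff_chain_at[OF differentiable_frechet[OF f] differentiable_frechet[OF this]]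
  have D: "((\<lambda>z. F (?f z)) has_derivative
      (\<lambda>v. frechet_derivative F (at (?f y)) (frechet_derivative ?f (at y) v))) (at y)"
    by (simp add: o_def)
  have cont: "continuous_on (chart_image c) ?f"
    by (rule smooth_on_imp_continuous_on[OF embedded_atlasD(5)])
  have op: "open (chart_image c \<inter> ?f -` W)"
    by (rule continuous_open_preimage[OF cont embedded_atlasD(3) W(1)])
  have "((\<lambda>z. z) has_derivative (\<lambda>v. frechet_derivative F (at (?f y)) (frechet_derivative ?f (at y) v))) (at y)"
    by (rule has_derivative_transform_within_open[OF D op])
      (use y W(2,4) in \<open>auto simp: embedded_chart_inv\<close>)
  then have "(\<lambda>v. frechet_derivative F (at (?f y)) (frechet_derivative ?f (at y) v)) = (\<lambda>v. v)"
    using has_derivative_ident has_derivative_unique by blast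
  then show ?thesis by (metis (no_types, lifting) injI)
qed

lemma embedded_transition:
  fixes d :: "('y::euclidean_space, 'e) chart"
  assumes d: "openin (top_of_set T) (fst d)" "smooth_on (fst d) (snd d)"
    and h: "smooth_on S h" "h ` S \<subseteq> T"
  defines "X \<equiv> {y \<in> chart_image c. h (chart_inv c y) \<in> fst d}"
  shows "open X" "smooth_on X (\<lambda>y. snd d (h (chart_inv c y)))"
proof -
  have "chart_inv c ` chart_image c \<subseteq> S" using embedded_chart_inv(2) embedded_atlasD(6) by auto
  then have sm: "smooth_on (chart_image c) (\<lambda>y. h (chart_inv c y))"
    and im: "(\<lambda>y. h (chart_inv c y)) ` chart_image c \<subseteq> T"
    using smooth_on_compose[OF embedded_atlasD(5) h(1)] h(2) by auto
  have "openin (top_of_set (chart_image c)) (chart_image c \<inter> (\<lambda>y. h (chart_inv c y)) -` fst d)"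
    by (rule continuous_openin_preimage[OF smooth_on_imp_continuous_on[OF sm] _ d(1)]) (use im in auto)
  moreover have "chart_image c \<inter> (\<lambda>y. h (chart_inv c y)) -` fst d = X" by (auto simp: X_def)
  ultimately show "open X" using embedded_atlasD(3) by (simp add: openin_open_eq)
  have "smooth_on X (\<lambda>y. h (chart_inv c y))" by (rule smooth_on_subset[OF sm]) (auto simp: X_def)
  then show "smooth_on X (\<lambda>y. snd d (h (chart_inv c y)))"
    by (rule smooth_on_compose[OF _ d(2)]) (auto simp: X_def)
qed

end

section \<open>Group operations in ambient coordinates and charts around every point\<close>

abbreviation G :: "(quat \<times> quat) monoid" where "G \<equiv> SU2_ltimes_H"

lemma carrier_G: "x \<in> carrier G \<longleftrightarrow> norm (fst x) = 1"
  by (cases x) (simp add: SU2_ltimes_H_def)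

lemma mult_G: "x \<otimes>\<^bsub>G\<^esub> y = (fst x \<bullet>\<^sub>q fst y, fst x \<bullet>\<^sub>q snd y + snd x)"
  by (cases x; cases y) (simp add: SU2_ltimes_H_def)

lemma one_G: "\<one>\<^bsub>G\<^esub> = (vector [1, 0, 0, 0], 0)"
  by (simp add: SU2_ltimes_H_def)

lemma inv_G:
  assumes "x \<in> carrier G"
  shows "inv\<^bsub>G\<^esub> x = (qconj (fst x), - (qconj (fst x) \<bullet>\<^sub>q snd x))"
  by (rule group.inv_equality[OF group_SU2_ltimes_H _ assms])
    (use assms in \<open>simp_all add: mult_G carrier_G one_G qconj_qmult_self\<close>)

lemma smooth_on_qmult:
  "smooth_on S f \<Longrightarrow> smooth_on S g \<Longrightarrow> smooth_on S (\<lambda>x. f x \<bullet>\<^sub>q g x)"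
  by (rule smooth_on_bilinear[OF bounded_bilinear_qmult])

lemma smooth_on_Pair:
  fixes f :: "'a::real_normed_vector \<Rightarrow> 'b::euclidean_space" and g :: "'a \<Rightarrow> 'c::euclidean_space"
  assumes "smooth_on S f" "smooth_on S g"
  shows "smooth_on S (\<lambda>x. (f x, g x))"
proof -
  have l: "bounded_linear (\<lambda>a::'b. (a, 0::'c))" "bounded_linear (\<lambda>a::'c. (0::'b, a))"
    by (intro bounded_linear_Pair bounded_linear_ident bounded_linear_zero)+
  show ?thesis
    using smooth_on_add[OF smooth_on_linear_compose[OF l(1) assms(1)] smooth_on_linear_compose[OF l(2) assms(2)]]
    by simp
qed

lemma smooth_on_translation: "smooth_on S (\<lambda>x. g \<otimes>\<^bsub>G\<^esub> x)"
  unfolding mult_G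
  by (intro smooth_on_Pair smooth_on_add smooth_on_qmult smooth_on_const
      smooth_on_bounded_linear bounded_linear_fst bounded_linear_snd)

lemma translation_image: "g \<in> carrier G \<Longrightarrow> (\<lambda>x. g \<otimes>\<^bsub>G\<^esub> x) ` carrier G \<subseteq> carrier G"
  using group.is_monoid[OF group_SU2_ltimes_H] by (auto intro: monoid.m_closed)

text \<open>Numbers the standard basis of the model space by the indices 1 to 7 of the
  coframe.\<close>

lemma enumerated_basis:
  obtains b :: "nat \<Rightarrow> real^7" where "bij_betw b {1..7} Basis"
    "\<And>i j. i \<in> {1..7} \<Longrightarrow> j \<in> {1..7} \<Longrightarrow> b i \<bullet> b j = (if i = j then 1 else 0)"
proof -
  have "card (Basis :: (real^7) set) = 7" by simp
  then obtain b where b: "bij_betw b {1..7::nat} (Basis :: (real^7) set)"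
    using ex_bij_betw_nat_finite_1[of "Basis :: (real^7) set"] by auto
  have "b i \<bullet> b j = (if i = j then 1 else 0)" if "i \<in> {1..7}" "j \<in> {1..7}" for i j
  proof -
    have "b i \<in> Basis" "b j \<in> Basis" using that bij_betwE[OF b] by blast+
    moreover have "b i = b j \<longleftrightarrow> i = j" using that bij_betw_imp_inj_on[OF b] by (simp only: inj_on_eq_iff)
    ultimately show ?thesis by (simp only: inner_Basis)
  qed
  with b show ?thesis by (rule that)
qed

text \<open>Identifies the model space with the Lie algebra, which consists of an imaginary and an
  arbitrary quaternion; the seven coframe functionals are the coordinates.\<close>

lemma coframe_coordinates:
  obtains enc :: "quat \<times> quat \<Rightarrow> real^7" and dec :: "real^7 \<Rightarrow> quat \<times> quat" where
    "bounded_linear enc" "bounded_linear dec" "\<And>y. enc (dec y) = y" "\<And>y. fst (dec y) $ 1 = 0"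
    "\<And>w. fst w $ 1 = 0 \<Longrightarrow> dec (enc w) = w"
proof -
  obtain b :: "nat \<Rightarrow> real^7" where b: "bij_betw b {1..7} Basis"
    and bb: "\<And>i j. i \<in> {1..7} \<Longrightarrow> j \<in> {1..7} \<Longrightarrow> b i \<bullet> b j = (if i = j then 1 else 0)"
    using enumerated_basis by metis
  define enc where "enc w = (\<Sum>i\<in>{1..7}. coframe_fun i w *\<^sub>R b i)" for w
  define dec :: "real^7 \<Rightarrow> quat \<times> quat" where
    "dec y = (vector [0, y \<bullet> b 3, y \<bullet> b 1, y \<bullet> b 5], vector [y \<bullet> b 7, y \<bullet> b 4, y \<bullet> b 2, y \<bullet> b 6])" for y
  have ib: "enc w \<bullet> b j = coframe_fun j w" if "j \<in> {1..7}" for w j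
    using that by (simp add: enc_def inner_sum_left bb if_distrib sum.delta cong: if_cong)
  have "linear enc"
    unfolding enc_def
    by (intro linear_compose_sum ballI linearI)
      (simp_all add: linear_add[OF linear_coframe_fun] linear_scale[OF linear_coframe_fun] scaleR_left_distrib)
  moreover have "linear dec"
    by (rule linearI) (simp_all add: dec_def vec_eq_iff forall_4 inner_add_left)
  moreover have "enc (dec y) = y" for y
  proof -
    have cf: "coframe_fun i (dec y) = y \<bullet> b i" if "i \<in> {1..7}" for i
    proof -
      have "i = 1 \<or> i = 2 \<or> i = 3 \<or> i = 4 \<or> i = 5 \<or> i = 6 \<or> i = 7" using that by auto
      then show ?thesis by (auto simp: coframe_fun_def dec_def)
    qed
    have "enc (dec y) = (\<Sum>i\<in>{1..7}. (y \<bullet> b i) *\<^sub>R b i)" unfolding enc_def by (simp add: cf)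
    also have "\<dots> = (\<Sum>u\<in>Basis. (y \<bullet> u) *\<^sub>R u)"
      by (rule sum.reindex_bij_betw[OF b])
    finally show ?thesis by (simp add: euclidean_representation)
  qed
  moreover have "dec (enc w) = w" if "fst w $ 1 = 0" for w
    using that by (simp add: dec_def ib prod_eq_iff vec_eq_iff forall_4) (simp add: coframe_fun_def)
  moreover have "fst (dec y) $ 1 = 0" for y by (simp add: dec_def)
  ultimately show ?thesis using that by (simp add: linear_conv_bounded_linear)
qed

text \<open>Stereographic projection of the unit quaternions from \<open>-1\<close>, translated by \<^term>\<open>g\<close>.\<close>

lemma G_atlas_cover:
  assumes V: "openin (top_of_set (carrier G)) V" and g: "g \<in> V"
  obtains c where "c \<in> G_atlas" "g \<in> fst c" "fst c \<subseteq> V"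
proof -
  obtain enc :: "quat \<times> quat \<Rightarrow> real^7" and dec where ed: "bounded_linear enc" "bounded_linear dec"
    "\<And>y. enc (dec y) = y" "\<And>y. fst (dec y) $ 1 = 0" "\<And>w. fst w $ 1 = 0 \<Longrightarrow> dec (enc w) = w"
    using coframe_coordinates by metis
  define one :: quat where "one = vector [1, 0, 0, 0]"
  have one_nth: "one $ 1 = 1" "one $ 2 = 0" "one $ 3 = 0" "one $ 4 = 0" by (simp_all add: one_def)
  interpret GG: group G by (rule group_SU2_ltimes_H)
  have gc: "g \<in> carrier G" using V g openin_imp_subset by blast
  \<comment> \<open>Stereographic projection divides the imaginary part of the unit quaternion by 1
    plus its real part; the second component is kept.\<close>
  define s where "s x = enc (inverse (1 + fst x $ 1) *\<^sub>R (fst x - (fst x $ 1) *\<^sub>R one), snd x)" for x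
  \<comment> \<open>The line from -1 in direction \<open>1 + u\<close>, with \<open>u\<close>
    imaginary, meets the unit sphere again at parameter \<open>2 / (1 + |u|^2)\<close>.\<close>
  define t where "t y = (inverse (1 + fst (dec y) \<bullet> fst (dec y)) *\<^sub>R (2 *\<^sub>R (one + fst (dec y))) - one, snd (dec y))" for y
  \<comment> \<open>Only the pole is removed from \<open>V\<close>. After translation by the inverse
    of \<open>g\<close>, the point \<open>g\<close> itself sits at the identity, away from the
    pole.\<close>
  define D where "D = {x \<in> V. fst (inv\<^bsub>G\<^esub> g \<otimes>\<^bsub>G\<^esub> x) $ 1 \<noteq> - 1}"
  define E where "E = {y. g \<otimes>\<^bsub>G\<^esub> t y \<in> V}"
  have pos: "1 + u \<bullet> u > 0" for u :: quat by (simp add: add_pos_nonneg)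
  have dot1: "one \<bullet> a = a $ 1" "a \<bullet> one = a $ 1" for a
    by (simp_all add: one_nth inner_vec_def sum_4)
  have t_unit: "t y \<in> carrier G" and t_re: "fst (t y) $ 1 \<noteq> -1" and s_t: "s (t y) = y" for y
  proof -
    define u where "u = fst (dec y)"
    define n where "n = 1 + u \<bullet> u"
    have n: "n > 0" using pos by (simp add: n_def)
    have u: "u $ 1 = 0" by (simp add: u_def ed)
    have ft: "fst (t y) = (2 / n) *\<^sub>R (one + u) - one"
      by (simp add: t_def u_def n_def divide_inverse mult.commute)
    define w where "w = one + u"
    have ww: "w \<bullet> w = n" unfolding w_def by (simp add: inner_vec_def sum_4 one_nth u n_def algebra_simps)
    have w1: "w $ 1 = 1" by (simp add: w_def u one_nth)
    have "fst (t y) \<bullet> fst (t y) = (2/n) * (2/n) * n - 2 * (2/n) + 1"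
      unfolding ft w_def[symmetric]
      by (simp add: inner_diff_left inner_diff_right dot1 w1 one_nth ww)
    also have "\<dots> = 1" using n by (simp add: field_simps)
    finally show "t y \<in> carrier G" by (simp add: carrier_G norm_eq_1)
    have re: "1 + fst (t y) $ 1 = 2 / n" by (simp add: ft u one_nth)
    then show "fst (t y) $ 1 \<noteq> -1" using n by auto
    have "fst (t y) - (fst (t y) $ 1) *\<^sub>R one = (2 / n) *\<^sub>R u"
      by (simp add: ft vec_eq_iff forall_4 one_nth u)
    then have "inverse (1 + fst (t y) $ 1) *\<^sub>R (fst (t y) - (fst (t y) $ 1) *\<^sub>R one) = u"
      unfolding re using n by simp
    then show "s (t y) = y" by (simp add: s_def u_def) (simp add: t_def ed)
  qed
  have t_s: "t (s x) = x" if x: "x \<in> carrier G" "fst x $ 1 \<noteq> - 1" for x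
  proof -
    define r where "r = fst x $ 1"
    have r: "1 + r \<noteq> 0" using x by (auto simp: r_def)
    define u where "u = inverse (1 + r) *\<^sub>R (fst x - r *\<^sub>R one)"
    have "u $ 1 = 0" by (simp add: u_def r_def one_nth)
    then have d: "dec (s x) = (u, snd x)" unfolding s_def u_def r_def by (intro ed(5)) simp
    have x1: "fst x \<bullet> fst x = 1" using x by (simp add: carrier_G norm_eq_1)
    have "(fst x - r *\<^sub>R one) \<bullet> (fst x - r *\<^sub>R one) = (1 + r) * (1 - r)"
      by (simp add: inner_diff_left inner_diff_right dot1 one_nth x1 r_def[symmetric] algebra_simps)
    moreover have "u \<bullet> u = inverse (1 + r) * (inverse (1 + r) * ((fst x - r *\<^sub>R one) \<bullet> (fst x - r *\<^sub>R one)))"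
      unfolding u_def by (simp only: inner_scaleR_left inner_scaleR_right)
    ultimately have "u \<bullet> u = inverse (1 + r) * (inverse (1 + r) * ((1 + r) * (1 - r)))" by simp
    then have "u \<bullet> u = (1 - r) / (1 + r)" using r by (simp add: divide_simps)
    then have "1 + u \<bullet> u = 2 / (1 + r)" using r by (simp add: field_simps)
    then have "fst (t (s x)) = (1 + r) *\<^sub>R (one + u) - one" by (simp add: t_def d)
    also have "\<dots> = fst x" using r by (simp add: u_def scaleR_add_right scaleR_add_left)
    finally show ?thesis by (simp add: prod_eq_iff) (simp add: t_def d)
  qed
  have smooth_s: "smooth_on {x. fst x $ 1 \<noteq> - 1} s"
  proof -
    have bl: "bounded_linear (\<lambda>x::quat \<times> quat. fst x $ 1)"
      by (rule bounded_linear_compose[OF bounded_linear_vec_nth bounded_linear_fst])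
    have "smooth_on {x. fst x $ 1 \<noteq> - 1} (\<lambda>x::quat \<times> quat. inverse (1 + fst x $ 1))"
      by (intro smooth_on_inverse smooth_on_add smooth_on_const smooth_on_bounded_linear bl) (auto simp: add_eq_0_iff)
    moreover have "smooth_on {x. fst x $ 1 \<noteq> - 1} (\<lambda>x::quat \<times> quat. fst x - (fst x $ 1) *\<^sub>R one)"
      by (intro smooth_on_bounded_linear bounded_linear_sub bounded_linear_fst bounded_linear_scaleR_const bl)
    ultimately show ?thesis
      unfolding s_def
      by (intro smooth_on_linear_compose[OF ed(1)] smooth_on_Pair smooth_on_bounded_linear[OF bounded_linear_snd]
          smooth_on_bilinear[OF bounded_bilinear_scaleR])
  qed
  have smooth_t: "smooth_on UNIV t"
  proof -
    have bl: "bounded_linear (\<lambda>y. fst (dec y))" "bounded_linear (\<lambda>y. snd (dec y))"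
      by (rule bounded_linear_compose[OF bounded_linear_fst ed(2)] bounded_linear_compose[OF bounded_linear_snd ed(2)])+
    have inv: "smooth_on UNIV (\<lambda>y. inverse (1 + fst (dec y) \<bullet> fst (dec y)))"
      by (intro smooth_on_inverse smooth_on_add smooth_on_const smooth_on_bilinear[OF bounded_bilinear_inner]
          smooth_on_bounded_linear bl) (use pos in \<open>auto simp: less_le\<close>)
    have "smooth_on UNIV (\<lambda>y. (inverse (1 + fst (dec y) \<bullet> fst (dec y)) *\<^sub>R (2 *\<^sub>R (one + fst (dec y))) + (- one), snd (dec y)))"
      by (intro inv smooth_on_Pair smooth_on_add smooth_on_const smooth_on_bilinear[OF bounded_bilinear_scaleR]
          smooth_on_bounded_linear bl)
    then show ?thesis by (simp add: t_def[abs_def])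
  qed
  have invg: "inv\<^bsub>G\<^esub> g \<in> carrier G" using gc by simp
  have "(D, \<lambda>x. s (inv\<^bsub>G\<^esub> g \<otimes>\<^bsub>G\<^esub> x)) \<in> embedded_atlas (carrier G)"
  proof (rule embedded_atlasI[where t = "\<lambda>y. g \<otimes>\<^bsub>G\<^esub> t y" and E = E])
    have "open {x. fst (inv\<^bsub>G\<^esub> g \<otimes>\<^bsub>G\<^esub> x) $ 1 \<noteq> - 1}"
    proof -
      have "continuous_on UNIV (\<lambda>x. fst (inv\<^bsub>G\<^esub> g \<otimes>\<^bsub>G\<^esub> x) $ 1)"
        using smooth_on_imp_continuous_on[OF smooth_on_translation] by (intro continuous_intros)
      then show ?thesis by (intro open_Collect_neq continuous_on_const)
    qed
    moreover have "D = V \<inter> {x. fst (inv\<^bsub>G\<^esub> g \<otimes>\<^bsub>G\<^esub> x) $ 1 \<noteq> - 1}" by (auto simp: D_def)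
    ultimately show "openin (top_of_set (carrier G)) D" using V by (simp add: openin_Int_open)
    have sm: "smooth_on UNIV (\<lambda>y. g \<otimes>\<^bsub>G\<^esub> t y)"
      by (rule smooth_on_compose[OF smooth_t smooth_on_translation[of UNIV]]) simp
    then show "smooth_on E (\<lambda>y. g \<otimes>\<^bsub>G\<^esub> t y)" by (rule smooth_on_subset) simp
    have "openin (top_of_set UNIV) (UNIV \<inter> (\<lambda>y. g \<otimes>\<^bsub>G\<^esub> t y) -` V)"
      by (rule continuous_openin_preimage[OF smooth_on_imp_continuous_on[OF sm] _ V]) (use gc t_unit in auto)
    then show "open E" by (simp add: E_def vimage_def)
    show "smooth_on D (\<lambda>x. s (inv\<^bsub>G\<^esub> g \<otimes>\<^bsub>G\<^esub> x))"
      by (rule smooth_on_compose[OF smooth_on_translation smooth_s]) (auto simp: D_def)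
  next
    fix x assume x: "x \<in> D"
    then have xc: "x \<in> carrier G" using V openin_imp_subset by (fastforce simp: D_def)
    have "inv\<^bsub>G\<^esub> g \<otimes>\<^bsub>G\<^esub> x \<in> carrier G" using xc invg by simp
    then have "t (s (inv\<^bsub>G\<^esub> g \<otimes>\<^bsub>G\<^esub> x)) = inv\<^bsub>G\<^esub> g \<otimes>\<^bsub>G\<^esub> x" using x by (intro t_s) (auto simp: D_def)
    then show 1: "g \<otimes>\<^bsub>G\<^esub> t (s (inv\<^bsub>G\<^esub> g \<otimes>\<^bsub>G\<^esub> x)) = x"
      using xc gc by (simp add: GG.m_assoc[symmetric])
    show "s (inv\<^bsub>G\<^esub> g \<otimes>\<^bsub>G\<^esub> x) \<in> E" using x by (simp add: E_def 1) (simp add: D_def)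
  next
    fix y assume y: "y \<in> E"
    have 1: "inv\<^bsub>G\<^esub> g \<otimes>\<^bsub>G\<^esub> (g \<otimes>\<^bsub>G\<^esub> t y) = t y"
      using gc t_unit by (simp add: GG.m_assoc[symmetric])
    show "g \<otimes>\<^bsub>G\<^esub> t y \<in> D" using y t_re by (simp add: D_def 1) (simp add: E_def)
    show "s (inv\<^bsub>G\<^esub> g \<otimes>\<^bsub>G\<^esub> (g \<otimes>\<^bsub>G\<^esub> t y)) = y" by (simp only: 1 s_t)
  qed
  moreover have "g \<in> D" using g gc by (simp add: D_def) (simp add: one_G)
  ultimately show ?thesis
    by (intro that[of "(D, \<lambda>x. s (inv\<^bsub>G\<^esub> g \<otimes>\<^bsub>G\<^esub> x))"]) (auto simp: G_atlas_def D_def)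
qed

section \<open>Quotients by discrete subgroups\<close>

lemma G_atlasD:
  assumes "c \<in> G_atlas"
  shows "openin (top_of_set (carrier G)) (fst c)" "inj_on (snd c) (fst c)" "open (chart_image c)"
    "smooth_on (fst c) (snd c)" "smooth_on (chart_image c) (chart_inv c)" "fst c \<subseteq> carrier G"
  using embedded_atlasD[OF assms[unfolded G_atlas_def]] by auto

lemmas G_chart_inv = chart_inv_simps[OF G_atlasD(2)]

lemma G_transition:
  assumes c: "c \<in> G_atlas" and d: "d \<in> G_atlas" and g: "g \<in> carrier G"
  defines "X \<equiv> {y \<in> chart_image c. g \<otimes>\<^bsub>G\<^esub> chart_inv c y \<in> fst d}"
  shows "open X" "smooth_on X (\<lambda>y. snd d (g \<otimes>\<^bsub>G\<^esub> chart_inv c y))"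
  unfolding X_def
  using embedded_transition[OF c[unfolded G_atlas_def] G_atlasD(1)[OF d] G_atlasD(4)[OF d]
      smooth_on_translation translation_image[OF g]] by blast+

lemma second_countable_top_of_set: "second_countable (top_of_set (S :: 'a::second_countable_topology set))"
proof (rule second_countable_subtopology)
  obtain B :: "'a set set" where B: "countable B" "topological_basis B" using ex_countable_basis by auto
  show "second_countable (euclidean :: 'a topology)"
    unfolding second_countable_def
  proof (intro exI[of _ B] conjI ballI allI impI)
    fix U and x :: 'a assume "openin euclidean U \<and> x \<in> U"
    then have "open U" "x \<in> U" by simp_all
    with B(2) show "\<exists>V\<in>B. x \<in> V \<and> V \<subseteq> U" by (rule topological_basisE) blast
  qed (use B topological_basis_open[OF B(2)] in auto)
qed

text \<open>Discreteness in this form serves two purposes: it makes \<Gamma> closed, which separates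
  distinct orbits, and it isolates the identity in \<Gamma>, which makes the projection locally
  injective.\<close>

locale discrete_quotient =
  fixes \<Gamma> :: "(quat \<times> quat) set"
  assumes subgroup: "subgroup \<Gamma> G" and discrete: "closed (\<Gamma> - {\<one>\<^bsub>G\<^esub>})"
begin

sublocale group G by (rule group_SU2_ltimes_H)

definition proj :: "quat \<times> quat \<Rightarrow> (quat \<times> quat) set" where
  "proj g = \<Gamma> #>\<^bsub>G\<^esub> g"

definition qtop :: "(quat \<times> quat) set topology" where
  "qtop = quotient_topology (top_of_set (carrier G)) proj"

definition qatlas :: "((quat \<times> quat) set, real^7) chart set" where
  "qatlas = quotient_atlas G_atlas proj"

section \<open>Topology of the orbit space\<close>

lemma Gamma_carrier: "\<gamma> \<in> \<Gamma> \<Longrightarrow> \<gamma> \<in> carrier G"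
  using subgroup.subset[OF subgroup] by blast

lemma proj_eq_iff:
  assumes "x \<in> carrier G" "y \<in> carrier G"
  shows "proj x = proj y \<longleftrightarrow> (\<exists>\<gamma>\<in>\<Gamma>. y = \<gamma> \<otimes>\<^bsub>G\<^esub> x)"
proof
  assume "proj x = proj y"
  moreover have "y \<in> proj y" unfolding proj_def by (rule rcos_self[OF assms(2) subgroup])
  ultimately show "\<exists>\<gamma>\<in>\<Gamma>. y = \<gamma> \<otimes>\<^bsub>G\<^esub> x" by (auto simp: proj_def r_coset_def)
next
  assume "\<exists>\<gamma>\<in>\<Gamma>. y = \<gamma> \<otimes>\<^bsub>G\<^esub> x"
  then have "y \<in> \<Gamma> #>\<^bsub>G\<^esub> x" by (auto simp: r_coset_def)
  then show "proj x = proj y" unfolding proj_def by (rule repr_independence[OF _ assms(1) subgroup])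
qed

lemma openin_translate:
  assumes "g \<in> carrier G" "openin (top_of_set (carrier G)) V"
  shows "openin (top_of_set (carrier G)) {x \<in> carrier G. g \<otimes>\<^bsub>G\<^esub> x \<in> V}"
proof -
  have "openin (top_of_set (carrier G)) (carrier G \<inter> (\<lambda>x. g \<otimes>\<^bsub>G\<^esub> x) -` V)"
    using translation_image[OF assms(1)]
    by (intro continuous_openin_preimage[OF smooth_on_imp_continuous_on[OF smooth_on_translation] _ assms(2)]) auto
  moreover have "carrier G \<inter> (\<lambda>x. g \<otimes>\<^bsub>G\<^esub> x) -` V = {x \<in> carrier G. g \<otimes>\<^bsub>G\<^esub> x \<in> V}" by auto
  ultimately show ?thesis by simp
qed

lemma openin_qtop:
  "openin qtop U \<longleftrightarrow> U \<subseteq> proj ` carrier G \<and> openin (top_of_set (carrier G)) {x \<in> carrier G. proj x \<in> U}"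
  by (simp add: qtop_def openin_quotient_topology)

text \<open>The union of all orbits meeting \<open>V\<close> is the union of the preimages of
  \<open>V\<close> under the translations by \<Gamma>. Openness of the projection supplies second
  countability and the chart domains downstairs.\<close>

lemma openin_proj_image:
  assumes "openin (top_of_set (carrier G)) V"
  shows "openin qtop (proj ` V)"
proof -
  have V: "V \<subseteq> carrier G" using assms by (rule openin_imp_subset)
  have "{x \<in> carrier G. proj x \<in> proj ` V} = (\<Union>\<gamma>\<in>\<Gamma>. {x \<in> carrier G. \<gamma> \<otimes>\<^bsub>G\<^esub> x \<in> V})"
  proof (intro equalityI subsetI)
    fix x assume "x \<in> {x \<in> carrier G. proj x \<in> proj ` V}"
    then obtain y where y: "x \<in> carrier G" "y \<in> V" "proj x = proj y" by auto
    then obtain \<gamma> where "\<gamma> \<in> \<Gamma>" "y = \<gamma> \<otimes>\<^bsub>G\<^esub> x" using V proj_eq_iff[of x y] by blast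
    then show "x \<in> (\<Union>\<gamma>\<in>\<Gamma>. {x \<in> carrier G. \<gamma> \<otimes>\<^bsub>G\<^esub> x \<in> V})" using y by auto
  next
    fix x assume "x \<in> (\<Union>\<gamma>\<in>\<Gamma>. {x \<in> carrier G. \<gamma> \<otimes>\<^bsub>G\<^esub> x \<in> V})"
    then obtain \<gamma> where "x \<in> carrier G" "\<gamma> \<in> \<Gamma>" "\<gamma> \<otimes>\<^bsub>G\<^esub> x \<in> V" by auto
    moreover then have "proj x = proj (\<gamma> \<otimes>\<^bsub>G\<^esub> x)" using V by (subst proj_eq_iff) auto
    ultimately show "x \<in> {x \<in> carrier G. proj x \<in> proj ` V}" by auto
  qed
  moreover have "openin (top_of_set (carrier G)) (\<Union>\<gamma>\<in>\<Gamma>. {x \<in> carrier G. \<gamma> \<otimes>\<^bsub>G\<^esub> x \<in> V})"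
    by (intro openin_clauses(3)) (auto intro: openin_translate[OF Gamma_carrier assms])
  ultimately show ?thesis using V by (auto simp: openin_qtop)
qed

lemma topspace_qtop: "topspace qtop = proj ` carrier G"
proof
  show "topspace qtop \<subseteq> proj ` carrier G" unfolding topspace_def by (auto simp: openin_qtop)
  have "openin qtop (proj ` carrier G)" by (rule openin_proj_image) simp
  then show "proj ` carrier G \<subseteq> topspace qtop" by (rule openin_subset)
qed

lemma continuous_map_proj: "continuous_map (top_of_set (carrier G)) qtop proj"
  unfolding continuous_map_def by (auto simp: topspace_qtop openin_qtop)

lemma compact_space_qtop:
  assumes "compact K" "K \<subseteq> carrier G" "proj ` carrier G \<subseteq> proj ` K"
  shows "compact_space qtop"
proof -
  have "compactin (top_of_set (carrier G)) K" using assms by (simp add: compactin_subtopology)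
  then have "compactin qtop (proj ` K)" by (rule image_compactin[OF _ continuous_map_proj])
  moreover have "proj ` K = topspace qtop" using assms by (auto simp: topspace_qtop)
  ultimately show ?thesis by (simp add: compact_space_def)
qed

lemma second_countable_qtop: "second_countable qtop"
  by (rule second_countable_open_map_image[OF continuous_map_proj _ _ second_countable_top_of_set])
    (auto simp: open_map_def openin_proj_image topspace_qtop)

text \<open>The product of \<open>y\<close> with the inverse of \<open>x\<close> for the pair
  \<open>(x, y)\<close>, written with \<open>qconj\<close> so that the formula is polynomial and
  continuous on the whole ambient space; it has this meaning for \<open>x\<close> in the
  group.\<close>

definition ratio :: "(quat \<times> quat) \<times> (quat \<times> quat) \<Rightarrow> quat \<times> quat" where
  "ratio z = (fst (snd z) \<bullet>\<^sub>q qconj (fst (fst z)),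
     fst (snd z) \<bullet>\<^sub>q (- (qconj (fst (fst z)) \<bullet>\<^sub>q snd (fst z))) + snd (snd z))"

lemma ratio_eq: "x \<in> carrier G \<Longrightarrow> ratio (x, y) = y \<otimes>\<^bsub>G\<^esub> inv\<^bsub>G\<^esub> x"
  by (simp add: ratio_def mult_G inv_G)

lemma continuous_ratio: "continuous_on UNIV ratio"
  unfolding ratio_def
  by (intro continuous_intros bounded_bilinear.continuous_on[OF bounded_bilinear_qmult]
      bounded_linear.continuous_on[OF bounded_linear_qconj])

lemma ratio_in_iff:
  assumes "x \<in> carrier G" "y \<in> carrier G"
  shows "ratio (x, y) \<in> \<Gamma> \<longleftrightarrow> proj x = proj y"
  unfolding proj_eq_iff[OF assms] ratio_eq[OF assms(1)]
proof
  assume "y \<otimes>\<^bsub>G\<^esub> inv\<^bsub>G\<^esub> x \<in> \<Gamma>"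
  moreover have "y = y \<otimes>\<^bsub>G\<^esub> inv\<^bsub>G\<^esub> x \<otimes>\<^bsub>G\<^esub> x" using assms by (simp add: m_assoc)
  ultimately show "\<exists>\<gamma>\<in>\<Gamma>. y = \<gamma> \<otimes>\<^bsub>G\<^esub> x" by blast
next
  assume "\<exists>\<gamma>\<in>\<Gamma>. y = \<gamma> \<otimes>\<^bsub>G\<^esub> x"
  then obtain \<gamma> where "\<gamma> \<in> \<Gamma>" "y = \<gamma> \<otimes>\<^bsub>G\<^esub> x" by blast
  then show "y \<otimes>\<^bsub>G\<^esub> inv\<^bsub>G\<^esub> x \<in> \<Gamma>" using assms Gamma_carrier by (simp add: m_assoc)
qed

text \<open>Used with \<open>C\<close> equal to \<Gamma> for the Hausdorff property and with
  \<Gamma> minus the identity for local injectivity.\<close>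

lemma avoid_nbhds:
  assumes "closed C" "ratio (x, y) \<notin> C" "x \<in> carrier G" "y \<in> carrier G"
  obtains V W where "openin (top_of_set (carrier G)) V" "openin (top_of_set (carrier G)) W"
    "x \<in> V" "y \<in> W" "\<And>a b. a \<in> V \<Longrightarrow> b \<in> W \<Longrightarrow> ratio (a, b) \<notin> C"
proof -
  have "open (ratio -` (- C))"
    using continuous_open_preimage[OF continuous_ratio open_UNIV, of "- C"] assms(1) by (simp add: open_Compl)
  moreover have "(x, y) \<in> ratio -` (- C)" using assms by simp
  ultimately obtain A B where "open A" "open B" "(x, y) \<in> A \<times> B" "A \<times> B \<subseteq> ratio -` (- C)"
    by (rule open_prod_elim)
  then show ?thesis
    using assms by (intro that[of "carrier G \<inter> A" "carrier G \<inter> B"]) (auto simp: openin_open)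
qed

lemma Hausdorff_qtop: "Hausdorff_space qtop"
  unfolding Hausdorff_space_def topspace_qtop
proof (intro allI impI)
  fix X Y assume *: "X \<in> proj ` carrier G \<and> Y \<in> proj ` carrier G \<and> X \<noteq> Y"
  then obtain x y where xy: "x \<in> carrier G" "y \<in> carrier G" "X = proj x" "Y = proj y" by auto
  have "closed \<Gamma>"
  proof -
    have "\<Gamma> = insert \<one>\<^bsub>G\<^esub> (\<Gamma> - {\<one>\<^bsub>G\<^esub>})" using subgroup.one_closed[OF subgroup] by auto
    then show ?thesis using discrete closed_insert by metis
  qed
  moreover have "ratio (x, y) \<notin> \<Gamma>" using xy * by (simp add: ratio_in_iff)
  ultimately obtain V W where VW: "openin (top_of_set (carrier G)) V" "openin (top_of_set (carrier G)) W"
    "x \<in> V" "y \<in> W" "\<And>a b. a \<in> V \<Longrightarrow> b \<in> W \<Longrightarrow> ratio (a, b) \<notin> \<Gamma>"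
    using avoid_nbhds xy by metis
  have "disjnt (proj ` V) (proj ` W)"
  proof -
    have "proj a \<noteq> proj b" if "a \<in> V" "b \<in> W" for a b
      using VW(5)[OF that] openin_imp_subset[OF VW(1)] openin_imp_subset[OF VW(2)] that
      by (subst ratio_in_iff[symmetric]) auto
    then show ?thesis by (auto simp: disjnt_def)
  qed
  then show "\<exists>U V. openin qtop U \<and> openin qtop V \<and> X \<in> U \<and> Y \<in> V \<and> disjnt U V"
    using VW openin_proj_image xy by blast
qed

lemma locally_injective:
  assumes x: "x \<in> carrier G"
  obtains V where "openin (top_of_set (carrier G)) V" "x \<in> V" "inj_on proj V"
proof -
  have "ratio (x, x) \<notin> \<Gamma> - {\<one>\<^bsub>G\<^esub>}" using x by (simp add: ratio_eq)
  then obtain V W where VW: "openin (top_of_set (carrier G)) V" "openin (top_of_set (carrier G)) W"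
    "x \<in> V" "x \<in> W" "\<And>a b. a \<in> V \<Longrightarrow> b \<in> W \<Longrightarrow> ratio (a, b) \<notin> \<Gamma> - {\<one>\<^bsub>G\<^esub>}"
    using avoid_nbhds[OF discrete _ x x] by metis
  have "inj_on proj (V \<inter> W)"
  proof (rule inj_onI)
    fix a b assume ab: "a \<in> V \<inter> W" "b \<in> V \<inter> W" "proj a = proj b"
    then have c: "a \<in> carrier G" "b \<in> carrier G" using openin_imp_subset[OF VW(1)] by auto
    then have "ratio (a, b) \<in> \<Gamma>" using ab by (simp add: ratio_in_iff)
    then have "ratio (a, b) = \<one>\<^bsub>G\<^esub>" using VW(5)[of a b] ab by auto
    then have "b \<otimes>\<^bsub>G\<^esub> inv\<^bsub>G\<^esub> a = \<one>\<^bsub>G\<^esub>" using c by (simp add: ratio_eq)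
    then have "b = inv\<^bsub>G\<^esub> (inv\<^bsub>G\<^esub> a)" using c by (metis inv_equality inv_closed)
    then show "a = b" using c by simp
  qed
  then show ?thesis using VW by (intro that[of "V \<inter> W"]) auto
qed

section \<open>Charts of the quotient from charts on which the projection is injective\<close>

definition qchart :: "(quat \<times> quat, real^7) chart \<Rightarrow> ((quat \<times> quat) set, real^7) chart" where
  "qchart c = (proj ` fst c, snd c \<circ> inv_into (fst c) proj)"

definition injective_charts :: "(quat \<times> quat, real^7) chart set" where
  "injective_charts = {c \<in> G_atlas. inj_on proj (fst c)}"

lemma qatlas_eq: "qatlas = qchart ` injective_charts"
  by (simp only: qatlas_def quotient_atlas_def qchart_def[abs_def] injective_charts_def setcompr_eq_image)

lemma injective_chartsD: "c \<in> injective_charts \<Longrightarrow> c \<in> G_atlas" "c \<in> injective_charts \<Longrightarrow> inj_on proj (fst c)"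
  by (auto simp: injective_charts_def)

context
  fixes c assumes c: "c \<in> injective_charts"
begin

lemma fst_qchart: "fst (qchart c) = proj ` fst c"
  by (simp add: qchart_def)

lemma snd_qchart: "p \<in> fst c \<Longrightarrow> snd (qchart c) (proj p) = snd c p"
  using injective_chartsD(2)[OF c] by (simp add: qchart_def inv_into_f_f)

lemma chart_image_qchart: "chart_image (qchart c) = chart_image c"
  by (auto simp: chart_image_def fst_qchart snd_qchart image_image intro!: image_cong)

lemma inj_qchart: "inj_on (snd (qchart c)) (fst (qchart c))"
proof (rule inj_onI)
  fix P Q assume "P \<in> fst (qchart c)" "Q \<in> fst (qchart c)" and eq: "snd (qchart c) P = snd (qchart c) Q"
  then obtain p q where pq: "p \<in> fst c" "q \<in> fst c" "P = proj p" "Q = proj q" by (auto simp: fst_qchart)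
  then have "snd c p = snd c q" using eq by (simp add: snd_qchart)
  then have "p = q" using pq G_atlasD(2)[OF injective_chartsD(1)[OF c]] by (simp add: inj_on_eq_iff)
  then show "P = Q" using pq by simp
qed

lemma chart_inv_qchart: "y \<in> chart_image c \<Longrightarrow> chart_inv (qchart c) y = proj (chart_inv c y)"
  using chart_inv_simps(1)[OF inj_qchart, of "proj (chart_inv c y)"]
    G_chart_inv[OF injective_chartsD(1)[OF c]] by (simp add: fst_qchart snd_qchart)

lemma fst_carrier: "p \<in> fst c \<Longrightarrow> p \<in> carrier G"
  using G_atlasD(6)[OF injective_chartsD(1)[OF c]] by blast

lemma openin_fst_qchart: "openin qtop (fst (qchart c))"
  unfolding fst_qchart by (rule openin_proj_image[OF G_atlasD(1)[OF injective_chartsD(1)[OF c]]])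

text \<open>Continuity of the chart rests on the projection being open: the preimage of
  \<open>B\<close> downstairs is the projection of its preimage upstairs. The inverse is continuous
  as a composition.\<close>

lemma homeomorphic_map_qchart:
  "homeomorphic_map (subtopology qtop (fst (qchart c))) (top_of_set (chart_image (qchart c))) (snd (qchart c))"
proof (rule homeomorphic_maps_imp_map)
  note cG = injective_chartsD(1)[OF c]
  show "homeomorphic_maps (subtopology qtop (fst (qchart c))) (top_of_set (chart_image (qchart c)))
      (snd (qchart c)) (\<lambda>y. proj (chart_inv c y))"
    unfolding homeomorphic_maps_def chart_image_qchart
  proof (intro conjI ballI)
    have "continuous_map (top_of_set (chart_image c)) (top_of_set (carrier G)) (chart_inv c)"
      using smooth_on_imp_continuous_on[OF G_atlasD(5)[OF cG]] G_chart_inv(2)[OF cG] fst_carrier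
      by (auto simp: continuous_map_in_subtopology)
    from continuous_map_compose[OF this continuous_map_proj]
    show "continuous_map (top_of_set (chart_image c)) (subtopology qtop (fst (qchart c))) (\<lambda>y. proj (chart_inv c y))"
      using G_chart_inv(2)[OF cG] by (auto simp: continuous_map_in_subtopology o_def fst_qchart)
    show "continuous_map (subtopology qtop (fst (qchart c))) (top_of_set (chart_image c)) (snd (qchart c))"
      unfolding continuous_map_def
    proof (intro conjI allI impI)
      show "snd (qchart c) \<in> topspace (subtopology qtop (fst (qchart c))) \<rightarrow> topspace (top_of_set (chart_image c))"
        by (auto simp: fst_qchart snd_qchart chart_image_def)
      fix B assume "openin (top_of_set (chart_image c)) B"
      then have "openin (top_of_set (fst c)) (fst c \<inter> snd c -` B)"
        by (intro continuous_openin_preimage[OF smooth_on_imp_continuous_on[OF G_atlasD(4)[OF cG]]])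
          (auto simp: chart_image_def)
      then have "openin (top_of_set (carrier G)) (fst c \<inter> snd c -` B)"
        using G_atlasD(1)[OF cG] by (rule openin_trans)
      then have "openin qtop (proj ` (fst c \<inter> snd c -` B))" by (rule openin_proj_image)
      then have "openin (subtopology qtop (fst (qchart c))) (proj ` (fst c \<inter> snd c -` B))"
        using openin_fst_qchart by (subst openin_open_subtopology) (auto simp: fst_qchart)
      moreover have "{P \<in> topspace (subtopology qtop (fst (qchart c))). snd (qchart c) P \<in> B} = proj ` (fst c \<inter> snd c -` B)"
        using fst_carrier by (auto simp: topspace_qtop fst_qchart snd_qchart)
      ultimately show "openin (subtopology qtop (fst (qchart c)))
          {P \<in> topspace (subtopology qtop (fst (qchart c))). snd (qchart c) P \<in> B}" by simp
    qed
    show "proj (chart_inv c (snd (qchart c) P)) = P" if "P \<in> topspace (subtopology qtop (fst (qchart c)))" for P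
      using that G_chart_inv(1)[OF cG] by (auto simp: fst_qchart snd_qchart)
    show "snd (qchart c) (proj (chart_inv c y)) = y" if "y \<in> topspace (top_of_set (chart_image c))" for y
      using that G_chart_inv[OF cG] by (simp add: snd_qchart)
  qed
qed

end

text \<open>Downstairs a change of charts is locally a change of charts upstairs composed with a left
  translation.\<close>

lemma qchart_lift:
  assumes c: "c \<in> G_atlas" and d: "d \<in> injective_charts"
    and p: "p \<in> fst c" "proj p \<in> fst (qchart d)"
  obtains \<gamma> where "\<gamma> \<in> \<Gamma>" "\<gamma> \<otimes>\<^bsub>G\<^esub> p \<in> fst d" "snd (qchart d) (proj p) = snd d (\<gamma> \<otimes>\<^bsub>G\<^esub> p)"
proof -
  obtain q where q: "q \<in> fst d" "proj p = proj q" using p by (auto simp: fst_qchart[OF d])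
  moreover have "p \<in> carrier G" "q \<in> carrier G" using p q G_atlasD(6)[OF c] fst_carrier[OF d] by auto
  ultimately obtain \<gamma> where "\<gamma> \<in> \<Gamma>" "q = \<gamma> \<otimes>\<^bsub>G\<^esub> p" by (auto simp: proj_eq_iff)
  then show ?thesis using q by (intro that[of \<gamma>]) (simp_all add: snd_qchart[OF d])
qed

lemma snd_qchart_translate:
  assumes d: "d \<in> injective_charts" and "\<gamma> \<in> \<Gamma>" "x \<in> carrier G" "\<gamma> \<otimes>\<^bsub>G\<^esub> x \<in> fst d"
  shows "proj x \<in> fst (qchart d)" "snd (qchart d) (proj x) = snd d (\<gamma> \<otimes>\<^bsub>G\<^esub> x)"
proof -
  have "proj x = proj (\<gamma> \<otimes>\<^bsub>G\<^esub> x)"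
    using assms Gamma_carrier by (subst proj_eq_iff) auto
  then show "proj x \<in> fst (qchart d)" "snd (qchart d) (proj x) = snd d (\<gamma> \<otimes>\<^bsub>G\<^esub> x)"
    using assms by (simp_all add: fst_qchart snd_qchart)
qed

text \<open>The element \<gamma> relating the two lifts depends on the point. Smoothness is
  therefore shown locally, on the open set \<open>X\<close> where one \<gamma> carries one lift into
  the domain of the other.\<close>

lemma smooth_transition_qchart:
  assumes c: "c \<in> injective_charts" and d: "d \<in> injective_charts"
  shows "smooth_on (snd (qchart c) ` (fst (qchart c) \<inter> fst (qchart d))) (snd (qchart d) \<circ> chart_inv (qchart c))"
proof (rule smooth_on_local)
  note cG = injective_chartsD(1)[OF c] and dG = injective_chartsD(1)[OF d]
  fix y assume "y \<in> snd (qchart c) ` (fst (qchart c) \<inter> fst (qchart d))"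
  then obtain p where p: "p \<in> fst c" "proj p \<in> fst (qchart d)" "y = snd c p"
    by (auto simp: fst_qchart[OF c] snd_qchart[OF c])
  then obtain \<gamma> where \<gamma>: "\<gamma> \<in> \<Gamma>" "\<gamma> \<otimes>\<^bsub>G\<^esub> p \<in> fst d" using qchart_lift[OF cG d] by metis
  define X where "X = {y \<in> chart_image c. \<gamma> \<otimes>\<^bsub>G\<^esub> chart_inv c y \<in> fst d}"
  have "smooth_on X (snd (qchart d) \<circ> chart_inv (qchart c))"
  proof (rule smooth_on_cong)
    show "smooth_on X (\<lambda>y. snd d (\<gamma> \<otimes>\<^bsub>G\<^esub> chart_inv c y))"
      unfolding X_def by (rule G_transition(2)[OF cG dG Gamma_carrier[OF \<gamma>(1)]])
    fix z assume "z \<in> X"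
    then show "snd d (\<gamma> \<otimes>\<^bsub>G\<^esub> chart_inv c z) = (snd (qchart d) \<circ> chart_inv (qchart c)) z"
      using snd_qchart_translate(2)[OF d \<gamma>(1)] G_chart_inv(2)[OF cG] fst_carrier[OF c]
      by (simp add: X_def chart_inv_qchart[OF c])
  qed
  moreover have "open X" unfolding X_def by (rule G_transition(1)[OF cG dG Gamma_carrier[OF \<gamma>(1)]])
  moreover have "y \<in> X" using p \<gamma> G_chart_inv(1)[OF cG] by (auto simp: X_def chart_image_def)
  ultimately show "\<exists>W. open W \<and> y \<in> W \<and>
      smooth_on (snd (qchart c) ` (fst (qchart c) \<inter> fst (qchart d)) \<inter> W) (snd (qchart d) \<circ> chart_inv (qchart c))"
    by (intro exI[of _ X] conjI) (auto intro: smooth_on_subset)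
qed

theorem smooth_manifold_quotient: "smooth_manifold qtop qatlas"
  unfolding smooth_manifold_def qatlas_eq
proof (intro conjI ballI)
  show "Hausdorff_space qtop" by (rule Hausdorff_qtop)
  show "second_countable qtop" by (rule second_countable_qtop)
  show "(\<Union>C\<in>qchart ` injective_charts. fst C) = topspace qtop"
    unfolding topspace_qtop
  proof (intro equalityI subsetI)
    fix P assume "P \<in> (\<Union>C\<in>qchart ` injective_charts. fst C)"
    then show "P \<in> proj ` carrier G" using fst_carrier by (auto simp: fst_qchart)
  next
    fix P assume "P \<in> proj ` carrier G"
    then obtain p where p: "p \<in> carrier G" "P = proj p" by auto
    obtain V where V: "openin (top_of_set (carrier G)) V" "p \<in> V" "inj_on proj V"
      using locally_injective[OF p(1)] by metis
    \<comment> \<open>The chart has to fit inside \<open>V\<close>: this makes the projection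
      injective on its domain.\<close>
    obtain c where c: "c \<in> G_atlas" "p \<in> fst c" "fst c \<subseteq> V"
      using G_atlas_cover[OF V(1,2)] by metis
    then have "c \<in> injective_charts" using V(3) by (auto simp: injective_charts_def intro: inj_on_subset)
    then show "P \<in> (\<Union>C\<in>qchart ` injective_charts. fst C)" using c p by (auto simp: fst_qchart)
  qed
next
  fix C assume "C \<in> qchart ` injective_charts"
  then obtain c where c: "c \<in> injective_charts" "C = qchart c" by auto
  show "openin qtop (fst C)" unfolding c by (rule openin_fst_qchart[OF c(1)])
  show "open (chart_image C)"
    unfolding c chart_image_qchart[OF c(1)] by (rule G_atlasD(3)[OF injective_chartsD(1)[OF c(1)]])
  show "homeomorphic_map (subtopology qtop (fst C)) (top_of_set (chart_image C)) (snd C)"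
    unfolding c by (rule homeomorphic_map_qchart[OF c(1)])
next
  fix C D assume "C \<in> qchart ` injective_charts" "D \<in> qchart ` injective_charts"
  then show "smooth_on (snd C ` (fst C \<inter> fst D)) (snd D \<circ> chart_inv C)"
    using smooth_transition_qchart by blast
qed

end

section \<open>Invariant forms\<close>

text \<open>The left-invariant form with value \<open>S\<close> at the identity, represented in the
  chart \<open>c\<close>. \<open>S\<close> is given on all pairs of quaternions, but is evaluated
  only on Maurer-Cartan vectors.\<close>

definition left_form :: "(quat \<times> quat, real) form \<Rightarrow> (quat \<times> quat, real^7) mform" where
  "left_form S c x vs = S (map (maurer (chart_inv c) x) vs)"

definition smooth_left_form :: "(quat \<times> quat, real) form \<Rightarrow> bool" where
  "smooth_left_form S \<longleftrightarrow> (\<forall>c\<in>G_atlas. \<forall>vs. smooth_on (chart_image c) (\<lambda>x. left_form S c x vs))"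

lemma unit_lift_chart:
  assumes "c \<in> G_atlas"
  shows "unit_lift (chart_image c) (chart_inv c)"
proof
  show "norm (fst (chart_inv c x)) = 1" if "x \<in> chart_image c" for x
    using G_chart_inv(2)[OF assms that] G_atlasD(6)[OF assms] by (auto simp: carrier_G)
qed (use G_atlasD[OF assms] in auto)

lemma left_form_pull: "c \<in> G_atlas \<Longrightarrow> left_form S c = unit_lift.pull (chart_inv c) S"
  by (intro ext) (simp add: left_form_def unit_lift.pull_def[OF unit_lift_chart])

lemma smooth_left_form_coframe: "smooth_left_form (coframe i)"
  unfolding smooth_left_form_def
  by (auto simp: left_form_pull unit_lift.pull_coframe[OF unit_lift_chart] intro: unit_lift.smooth_e[OF unit_lift_chart])

lemma smooth_left_form_add:
  "smooth_left_form a \<Longrightarrow> smooth_left_form b \<Longrightarrow> smooth_left_form (\<lambda>vs. a vs + b vs)"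
  unfolding smooth_left_form_def left_form_def by (auto intro: smooth_on_add)

lemma smooth_left_form_scale: "smooth_left_form a \<Longrightarrow> smooth_left_form (\<lambda>vs. r * a vs)"
  unfolding smooth_left_form_def left_form_def
  by (auto intro: smooth_on_bilinear[OF bounded_bilinear_mult] smooth_on_const)

lemma smooth_left_form_diff:
  assumes "smooth_left_form a" "smooth_left_form b"
  shows "smooth_left_form (\<lambda>vs. a vs - b vs)"
  using smooth_left_form_add[OF assms(1) smooth_left_form_scale[OF assms(2), of "-1"]] by simp

lemma smooth_left_form_wedge:
  assumes "smooth_left_form a" "smooth_left_form b"
  shows "smooth_left_form (a \<and>\<^sub>w b)"
  unfolding smooth_left_form_def
proof (intro ballI allI)
  fix c :: "(quat \<times> quat, real^7) chart" and vs assume c: "c \<in> G_atlas"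
  have "smooth_on (chart_image c) (\<lambda>x. \<Sum>I\<in>Pow {..<length vs}.
      (-1) ^ card {(i, j). i \<in> I \<and> j < i \<and> j \<notin> I} * left_form a c x (nths vs I) * left_form b c x (nths vs (- I)))"
    using assms c unfolding smooth_left_form_def
    by (intro smooth_on_sum smooth_on_bilinear[OF bounded_bilinear_mult] smooth_on_const) auto
  then show "smooth_on (chart_image c) (\<lambda>x. left_form (a \<and>\<^sub>w b) c x vs)"
    by (simp add: left_form_def wedge_def nths_map)
qed

lemma smooth_left_form_0:
  "smooth_left_form omega0" "smooth_left_form psip0" "smooth_left_form psim0" "smooth_left_form flux0"
  unfolding omega0_def psi0_eq flux0_def
  by (intro smooth_left_form_add smooth_left_form_diff smooth_left_form_scale smooth_left_form_wedge
      smooth_left_form_coframe)+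

lemma left_form_alternating:
  assumes "c \<in> G_atlas" "alternating_form k S" "x \<in> chart_image c"
  shows "alternating_form k (left_form S c x)"
  unfolding left_form_def[abs_def]
  by (rule alternating_form_map[OF assms(2) linear_maurer[OF unit_lift.differentiable[OF unit_lift_chart]]])
    (use assms in auto)

text \<open>The coordinate map \<open>h\<close> is prescribed only where the translated point lies
  in the domain of \<open>d\<close>. This covers left translations, changes of charts with
  \<open>g\<close> the identity, and the projection to the quotient with \<open>g\<close> in
  \<Gamma>.\<close>

lemma left_form_translate:
  assumes c: "c \<in> G_atlas" and d: "d \<in> G_atlas" and g: "g \<in> carrier G"
    and p: "p \<in> fst c" "g \<otimes>\<^bsub>G\<^esub> p \<in> fst d"
    and h: "\<And>y. y \<in> chart_image c \<Longrightarrow> g \<otimes>\<^bsub>G\<^esub> chart_inv c y \<in> fst d \<Longrightarrow> h y = snd d (g \<otimes>\<^bsub>G\<^esub> chart_inv c y)"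
  shows "left_form S c (snd c p) vs =
    left_form S d (snd d (g \<otimes>\<^bsub>G\<^esub> p)) (map (frechet_derivative h (at (snd c p))) vs)"
proof -
  define X where "X = {y \<in> chart_image c. g \<otimes>\<^bsub>G\<^esub> chart_inv c y \<in> fst d}"
  have X: "open X" and smX: "smooth_on X (\<lambda>y. snd d (g \<otimes>\<^bsub>G\<^esub> chart_inv c y))"
    unfolding X_def by (rule G_transition[OF c d g])+
  have smh: "smooth_on X h" by (rule smooth_on_cong[OF _ smX]) (simp add: X_def h)
  have pX: "snd c p \<in> X" using p G_chart_inv(1)[OF c] by (auto simp: X_def chart_image_def)
  have hp: "h (snd c p) = snd d (g \<otimes>\<^bsub>G\<^esub> p)" using pX G_chart_inv(1)[OF c p(1)] by (simp add: X_def h)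
  interpret c: unit_lift "chart_image c" "chart_inv c" by (rule unit_lift_chart[OF c])
  interpret d: unit_lift "chart_image d" "chart_inv d" by (rule unit_lift_chart[OF d])
  have "maurer (chart_inv d) (h (snd c p)) (frechet_derivative h (at (snd c p)) v) = maurer (chart_inv c) (snd c p) v" for v
  proof (rule maurer_translate[OF _ _ _ _ X pX])
    show "chart_inv c differentiable at (snd c p)" using pX by (intro c.differentiable) (simp add: X_def)
    show "chart_inv d differentiable at (h (snd c p))"
      unfolding hp using p by (intro d.differentiable) (simp add: chart_image_def)
    show "h differentiable at (snd c p)" by (rule smooth_on_differentiable[OF X smh pX])
    show "norm (fst g) = 1" using g by (simp add: carrier_G)
    show "chart_inv d (h y) = (fst g \<bullet>\<^sub>q fst (chart_inv c y), fst g \<bullet>\<^sub>q snd (chart_inv c y) + snd g)" if "y \<in> X" for y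
      using that G_chart_inv(1)[OF d] by (simp add: X_def h flip: mult_G)
  qed
  then show ?thesis by (simp add: left_form_def hp[symmetric] o_def)
qed

lemma left_invariant_left_form: "left_invariant (left_form S)"
  unfolding left_invariant_def pulls_back_def
proof (intro ballI impI allI)
  fix g p :: "quat \<times> quat" and c d :: "(quat \<times> quat, real^7) chart" and vs
  assume "g \<in> carrier G" "c \<in> G_atlas" "d \<in> G_atlas" "p \<in> fst c" "g \<otimes>\<^bsub>G\<^esub> p \<in> fst d"
  then show "left_form S c (snd c p) vs = left_form S d (snd d (g \<otimes>\<^bsub>G\<^esub> p))
      (map (frechet_derivative (snd d \<circ> (\<lambda>x. g \<otimes>\<^bsub>G\<^esub> x) \<circ> chart_inv c) (at (snd c p))) vs)"
    by (intro left_form_translate) auto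
qed

lemma diff_form_left_form:
  assumes "alternating_form k S" "smooth_left_form S"
  shows "diff_form G_atlas k (left_form S)"
  unfolding diff_form_def pulls_back_def
proof (intro conjI ballI allI impI)
  interpret group G by (rule group_SU2_ltimes_H)
  fix c d :: "(quat \<times> quat, real^7) chart" and p vs
  assume *: "c \<in> G_atlas" "d \<in> G_atlas" "p \<in> fst c" "id p \<in> fst d"
  have G: "x \<in> carrier G" if "x \<in> fst c" for x using G_atlasD(6)[OF *(1)] that by auto
  have "left_form S c (snd c p) vs = left_form S d (snd d (\<one>\<^bsub>G\<^esub> \<otimes>\<^bsub>G\<^esub> p))
      (map (frechet_derivative (snd d \<circ> id \<circ> chart_inv c) (at (snd c p))) vs)"
    by (rule left_form_translate) (use * G G_chart_inv(2)[OF *(1)] in auto)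
  then show "left_form S c (snd c p) vs = left_form S d (snd d (id p))
      (map (frechet_derivative (snd d \<circ> id \<circ> chart_inv c) (at (snd c p))) vs)"
    using G[OF *(3)] by simp
qed (use assms left_form_alternating in \<open>auto simp: smooth_left_form_def\<close>)

section \<open>Descent of left-invariant forms to the quotient\<close>

context discrete_quotient
begin

text \<open>A chart downstairs may have many lifts, so one is chosen. Left invariance under \<Gamma>
  makes the forms read in different lifts compatible.\<close>

definition lift_chart :: "((quat \<times> quat) set, real^7) chart \<Rightarrow> (quat \<times> quat, real^7) chart" where
  "lift_chart C = (SOME c. c \<in> injective_charts \<and> C = qchart c)"

definition quotient_form :: "(quat \<times> quat, real) form \<Rightarrow> ((quat \<times> quat) set, real^7) mform" where
  "quotient_form S C = left_form S (lift_chart C)"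

lemma lift_chart:
  assumes "C \<in> qatlas"
  shows "lift_chart C \<in> injective_charts" "qchart (lift_chart C) = C" "lift_chart C \<in> G_atlas"
    "chart_image (lift_chart C) = chart_image C"
proof -
  have "\<exists>c. c \<in> injective_charts \<and> C = qchart c" using assms by (auto simp: qatlas_eq)
  then have *: "lift_chart C \<in> injective_charts \<and> C = qchart (lift_chart C)"
    unfolding lift_chart_def by (rule someI_ex)
  then show "lift_chart C \<in> injective_charts" "qchart (lift_chart C) = C" by simp_all
  then show "lift_chart C \<in> G_atlas" "chart_image (lift_chart C) = chart_image C"
    using injective_chartsD(1) chart_image_qchart by metis+
qed

text \<open>Near \<open>p\<close> the projection, read in a chart upstairs and the lift of a chart
  downstairs, is a left translation by some \<gamma> in \<Gamma>, and left-invariant forms are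
  preserved by it.\<close>

lemma pulls_back_proj: "pulls_back G_atlas qatlas proj (quotient_form S) (left_form S)"
  unfolding pulls_back_def
proof (intro ballI impI allI)
  fix c :: "(quat \<times> quat, real^7) chart" and D p vs
  assume c: "c \<in> G_atlas" and D: "D \<in> qatlas" and p: "p \<in> fst c" "proj p \<in> fst D"
  define d where "d = lift_chart D"
  note d = lift_chart[OF D, folded d_def]
  obtain \<gamma> where \<gamma>: "\<gamma> \<in> \<Gamma>" "\<gamma> \<otimes>\<^bsub>G\<^esub> p \<in> fst d" "snd D (proj p) = snd d (\<gamma> \<otimes>\<^bsub>G\<^esub> p)"
    using qchart_lift[OF c d(1) p(1)] p(2) unfolding d(2) by metis
  have "left_form S c (snd c p) vs = left_form S d (snd d (\<gamma> \<otimes>\<^bsub>G\<^esub> p))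
      (map (frechet_derivative (snd D \<circ> proj \<circ> chart_inv c) (at (snd c p))) vs)"
  proof (rule left_form_translate[OF c d(3) Gamma_carrier[OF \<gamma>(1)] p(1) \<gamma>(2)])
    fix y assume y: "y \<in> chart_image c" "\<gamma> \<otimes>\<^bsub>G\<^esub> chart_inv c y \<in> fst d"
    have "chart_inv c y \<in> carrier G" using G_chart_inv(2)[OF c y(1)] G_atlasD(6)[OF c] by blast
    then show "(snd D \<circ> proj \<circ> chart_inv c) y = snd d (\<gamma> \<otimes>\<^bsub>G\<^esub> chart_inv c y)"
      using snd_qchart_translate(2)[OF d(1) \<gamma>(1) _ y(2)] by (simp add: d(2))
  qed
  then show "left_form S c (snd c p) vs = quotient_form S D (snd D (proj p))
      (map (frechet_derivative (snd D \<circ> proj \<circ> chart_inv c) (at (snd c p))) vs)"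
    by (simp add: quotient_form_def \<gamma>(3) d_def)
qed

text \<open>Compatibility on overlaps reduces to \<open>pulls_back_proj\<close>: in coordinates the
  identity from \<open>C\<close> to \<open>D\<close> is the projection from the lift of
  \<open>C\<close> to \<open>D\<close>.\<close>

lemma diff_form_quotient_form:
  assumes "alternating_form k S" "smooth_left_form S"
  shows "diff_form qatlas k (quotient_form S)"
  unfolding diff_form_def
proof (intro conjI ballI allI)
  fix C assume C: "C \<in> qatlas"
  show "alternating_form k (quotient_form S C x)" if "x \<in> chart_image C" for x
    using that left_form_alternating[OF lift_chart(3)[OF C] assms(1)]
    by (simp add: quotient_form_def lift_chart(4)[OF C])
  show "smooth_on (chart_image C) (\<lambda>x. quotient_form S C x vs)" for vs
    using assms(2) lift_chart(3)[OF C]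
    by (auto simp: quotient_form_def smooth_left_form_def simp flip: lift_chart(4)[OF C])
next
  show "pulls_back qatlas qatlas id (quotient_form S) (quotient_form S)"
    unfolding pulls_back_def
  proof (intro ballI impI allI)
    fix C D :: "((quat \<times> quat) set, real^7) chart" and P vs
    assume C: "C \<in> qatlas" and D: "D \<in> qatlas" and P: "P \<in> fst C" "id P \<in> fst D"
    define c where "c = lift_chart C"
    note c = lift_chart[OF C, folded c_def]
    obtain p where p: "p \<in> fst c" "P = proj p" using P(1) fst_qchart[OF c(1)] by (auto simp: c(2))
    have sC: "snd C P = snd c p" using snd_qchart[OF c(1) p(1)] by (simp add: c(2) p(2))
    have inv: "(snd D \<circ> id \<circ> chart_inv C) y = (snd D \<circ> proj \<circ> chart_inv c) y" if "y \<in> chart_image c" for y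
      using chart_inv_qchart[OF c(1) that] by (simp add: c(2))
    have y: "snd c p \<in> chart_image c" using p by (simp add: chart_image_def)
    have op: "open (chart_image c)" by (rule G_atlasD(3)[OF c(3)])
    \<comment> \<open>The two coordinate maps agree on an open set, so they have the same candidates
      \<open>f'\<close> for a derivative at the point. As \<open>frechet_derivative\<close> chooses
      among these, differentiability need not be established here.\<close>
    have "frechet_derivative (snd D \<circ> id \<circ> chart_inv C) (at (snd c p)) =
        frechet_derivative (snd D \<circ> proj \<circ> chart_inv c) (at (snd c p))"
    proof -
      have "(f has_derivative f') (at (snd c p))"
        if "\<And>y. y \<in> chart_image c \<Longrightarrow> g y = f y" "(g has_derivative f') (at (snd c p))"
        for f g :: "real^7 \<Rightarrow> real^7" and f'
        using has_derivative_transform_within_open[OF that(2) op y] that(1) by blast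
      note * = this[of "snd D \<circ> proj \<circ> chart_inv c" "snd D \<circ> id \<circ> chart_inv C"]
        this[of "snd D \<circ> id \<circ> chart_inv C" "snd D \<circ> proj \<circ> chart_inv c"]
      have "(snd D \<circ> id \<circ> chart_inv C has_derivative f') (at (snd c p)) =
          (snd D \<circ> proj \<circ> chart_inv c has_derivative f') (at (snd c p))" for f'
        using *(1)[of f'] *(2)[of f'] inv by fastforce
      then show ?thesis by (simp add: frechet_derivative_def)
    qed
    moreover have "quotient_form S C (snd C P) vs = left_form S c (snd c p) vs"
      by (simp only: quotient_form_def c_def[symmetric] sC)
    moreover have "left_form S c (snd c p) vs = quotient_form S D (snd D (id P))
        (map (frechet_derivative (snd D \<circ> proj \<circ> chart_inv c) (at (snd c p))) vs)"
      using pulls_back_proj[of S, unfolded pulls_back_def, rule_format, OF c(3) D p(1), of vs] P(2)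
      by (simp add: p(2))
    ultimately show "quotient_form S C (snd C P) vs = quotient_form S D (snd D (id P))
        (map (frechet_derivative (snd D \<circ> id \<circ> chart_inv C) (at (snd C P))) vs)"
      by (simp only: sC)
  qed
qed

text \<open>The seven 1-forms are the components of a linear map \<open>L\<close> of the model space
  to itself. Since they separate tangent vectors, \<open>L\<close> is injective, hence surjective,
  and dual vectors exist.\<close>

lemma local_coframe_quotient:
  assumes C: "C \<in> qatlas"
  shows "local_coframe (chart_image C) (\<lambda>i. left_form (coframe i) (lift_chart C))"
proof -
  define c where "c = lift_chart C"
  note c = lift_chart[OF C, folded c_def]
  interpret unit_lift "chart_image c" "chart_inv c" by (rule unit_lift_chart[OF c(3)])
  have eq: "left_form (coframe i) c = e i" for i
    by (simp add: left_form_pull[OF c(3)] fun_eq_iff pull_coframe)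
  have indep: "a i = 0"
    if x: "x \<in> chart_image c" and z: "\<And>vs. (\<Sum>i\<in>{1..7}. a i * e i x vs) = 0" and i: "i \<in> {1..7}"
    for x and a :: "nat \<Rightarrow> real" and i
  proof -
    obtain b :: "nat \<Rightarrow> real^7" where bb:
      "\<And>i j. i \<in> {1..7} \<Longrightarrow> j \<in> {1..7} \<Longrightarrow> b i \<bullet> b j = (if i = j then 1 else 0)"
      using enumerated_basis by metis
    define L where "L v = (\<Sum>i\<in>{1..7}. e i x [v] *\<^sub>R b i)" for v
    have Lb: "L v \<bullet> b j = e j x [v]" if "j \<in> {1..7}" for v j
      using that by (simp add: L_def inner_sum_left bb if_distrib sum.delta cong: if_cong)
    have lin: "linear (\<lambda>v. e i x [v])" for i
    proof -
      have "multilinear (e i x)" using alternating_e[OF x, of i] by (simp add: alternating_form_iff)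
      from this[unfolded multilinear_def, rule_format, of "[]" "[]"] show ?thesis by simp
    qed
    have "linear L"
      unfolding L_def
      by (intro linear_compose_sum ballI linearI)
        (simp_all add: linear_add[OF lin] linear_scale[OF lin] scaleR_left_distrib)
    moreover have "inj L"
    proof -
      have "v = 0" if "L v = 0" for v
        by (rule e_injective[OF x]) (use Lb[of _ v] that frechet_chart_inv_injective[OF c(3)[unfolded G_atlas_def] x] in auto)
      then show ?thesis using linear_injective_0[OF \<open>linear L\<close>] by blast
    qed
    ultimately have "surj L" by (rule linear_inj_imp_surj)
    \<comment> \<open>The vector \<open>v\<close> is dual to the form of index \<open>i\<close>:
      evaluating the vanishing combination on it isolates \<open>a i\<close>.\<close>
    then obtain v where v: "L v = b i" by (metis surjD)
    have "(\<Sum>j\<in>{1..7}. a j * e j x [v]) = (\<Sum>j\<in>{1..7}. if j = i then a j else 0)"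
      by (intro sum.cong refl) (use i in \<open>simp add: Lb[symmetric] v bb\<close>)
    then show "a i = 0" using z[of "[v]"] i by (simp add: sum.delta)
  qed
  show ?thesis
    unfolding local_coframe_def c_def[symmetric] eq
    using alternating_e smooth_e indep c(4) by auto
qed

text \<open>Evaluation on Maurer-Cartan vectors commutes with real and complex wedge products, so
  the relations of the model forms on the Lie algebra pass to the chart.\<close>

lemma SU3_adapted_quotient:
  assumes C: "C \<in> qatlas"
  shows "SU3_adapted (\<lambda>i. left_form (coframe i) (lift_chart C) y)
    (quotient_form (coframe 7) C y) (quotient_form omega0 C y) (quotient_form psip0 C y) (quotient_form psim0 C y)"
  unfolding SU3_adapted_def
proof (intro conjI)
  have cf: "cform (left_form a c y) (left_form b c y) vs = cform a b (map (maurer (chart_inv c) y) vs)" for a b c vs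
    by (simp add: cform_def left_form_def)
  have w: "((\<lambda>vs. a (map f vs)) \<and>\<^sub>w (\<lambda>vs. b (map f vs))) = (\<lambda>vs. (a \<and>\<^sub>w b) (map f vs))"
    for a b :: "(quat \<times> quat, 'b::comm_ring_1) form" and f :: "real^7 \<Rightarrow> quat \<times> quat"
    by (simp add: fun_eq_iff wedge_map)
  show "quotient_form (coframe 7) C y = left_form (coframe 7) (lift_chart C) y"
    by (simp add: quotient_form_def)
  show "quotient_form omega0 C y = (\<lambda>vs.
      (left_form (coframe 1) (lift_chart C) y \<and>\<^sub>w left_form (coframe 2) (lift_chart C) y) vs +
      (left_form (coframe 3) (lift_chart C) y \<and>\<^sub>w left_form (coframe 4) (lift_chart C) y) vs +
      (left_form (coframe 5) (lift_chart C) y \<and>\<^sub>w left_form (coframe 6) (lift_chart C) y) vs)"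
    unfolding quotient_form_def left_form_def[abs_def] omega0_def w by simp
  have "cform psip0 psim0 = psi0"
    by (simp add: fun_eq_iff cform_def psip0_def psim0_def)
  then show "cform (quotient_form psip0 C y) (quotient_form psim0 C y) =
      cform (left_form (coframe 1) (lift_chart C) y) (left_form (coframe 2) (lift_chart C) y) \<and>\<^sub>w
      cform (left_form (coframe 3) (lift_chart C) y) (left_form (coframe 4) (lift_chart C) y) \<and>\<^sub>w
      cform (left_form (coframe 5) (lift_chart C) y) (left_form (coframe 6) (lift_chart C) y)"
    unfolding quotient_form_def cf[abs_def] w by (simp add: psi0_def)
qed

theorem generalized_G2_quotient:
  "generalized_G2_structure qatlas (quotient_form (coframe 7)) (quotient_form omega0)
    (quotient_form psip0) (quotient_form psim0)"
  unfolding generalized_G2_structure_def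
proof (intro conjI ballI)
  fix C x assume C: "C \<in> qatlas" and x: "x \<in> chart_image C"
  have "open (chart_image C)" using G_atlasD(3)[OF lift_chart(3)[OF C]] by (simp add: lift_chart(4)[OF C])
  then show "\<exists>W e. open W \<and> x \<in> W \<and> W \<subseteq> chart_image C \<and> local_coframe W e \<and>
      (\<forall>y\<in>W. SU3_adapted (\<lambda>i. e i y) (quotient_form (coframe 7) C y) (quotient_form omega0 C y)
        (quotient_form psip0 C y) (quotient_form psim0 C y))"
    using x local_coframe_quotient[OF C] SU3_adapted_quotient[OF C]
    by (intro exI[of _ "chart_image C"] exI[of _ "\<lambda>i. left_form (coframe i) (lift_chart C)"]) simp
qed (intro diff_form_quotient_form alternating_form_0 alternating_form_coframe smooth_left_form_0
    smooth_left_form_coframe)+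

lemma quotient_form_pull:
  "C \<in> qatlas \<Longrightarrow> quotient_form S C = unit_lift.pull (chart_inv (lift_chart C)) S"
  by (simp add: quotient_form_def left_form_pull lift_chart)

lemma closed_quotient_flux: "closed_form qatlas (quotient_form flux0)"
  unfolding closed_form_def
  using unit_lift.closed_flux[OF unit_lift_chart[OF lift_chart(3)]]
  by (simp add: quotient_form_pull lift_chart)

theorem weakly_integrable_quotient:
  "weakly_integrable qatlas (quotient_form flux0) (quotient_form (coframe 7)) (quotient_form omega0)
    (quotient_form psip0) (quotient_form psim0)"
proof -
  have "twisted_deriv (quotient_form flux0)
      (rho_od (quotient_form (coframe 7)) (quotient_form omega0) (quotient_form psip0) (quotient_form psim0)) C x vs =
    1 * rho_ev (quotient_form (coframe 7)) (quotient_form omega0) (quotient_form psip0) (quotient_form psim0) C x vs"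
    if C: "C \<in> qatlas" and x: "x \<in> chart_image C" for C x vs
  proof -
    interpret unit_lift "chart_image (lift_chart C)" "chart_inv (lift_chart C)"
      by (rule unit_lift_chart[OF lift_chart(3)[OF C]])
    show ?thesis
      using weakly_integrable_pull[of x vs] x
      by (simp add: twisted_deriv_def rho_od_def[abs_def] rho_ev_def quotient_form_pull[OF C] pull_coframe lift_chart(4)[OF C])
  qed
  then have "weakly_integrable_form qatlas (quotient_form flux0)
      (rho_od (quotient_form (coframe 7)) (quotient_form omega0) (quotient_form psip0) (quotient_form psim0))
      (rho_ev (quotient_form (coframe 7)) (quotient_form omega0) (quotient_form psip0) (quotient_form psim0))"
    unfolding weakly_integrable_form_def by (intro exI[of _ 1]) simp
  then show ?thesis by (simp add: weakly_integrable_def)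
qed

end

section \<open>The subgroups \<open>\<Gamma>\<^sub>\<beta>\<close>\<close>

text \<open>Two lattice points at distance below 1 coincide, since their components differ by
  integers of absolute value below 1. A set with such a uniform gap is closed.\<close>

lemma closed_subset_integer_lattice:
  assumes "T \<subseteq> integer_lattice"
  shows "closed T"
proof (rule discrete_imp_closed[of 1])
  show "\<forall>x\<in>T. \<forall>y\<in>T. dist y x < 1 \<longrightarrow> y = x"
  proof (intro ballI impI)
    fix x y assume xy: "x \<in> T" "y \<in> T" "dist y x < 1"
    have "y $ i = x $ i" for i
    proof -
      have "\<bar>(y - x) $ i\<bar> < 1" using component_le_norm_cart[of "y - x" i] xy(3) by (simp add: dist_norm)
      moreover have "y $ i \<in> \<int>" "x $ i \<in> \<int>" using xy assms by (auto simp: integer_lattice_def)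
      then have "(y - x) $ i \<in> \<int>" by simp
      ultimately show ?thesis using Ints_nonzero_abs_less1 by fastforce
    qed
    then show "y = x" by (simp add: vec_eq_iff)
  qed
qed simp

text \<open>Formulated for all subsets, so that it applies to the group without its identity. The
  set is cut into finitely many slices over the powers of \<open>A_beta\<close>; each slice is the
  image of a set of lattice points under an injective linear map.\<close>

lemma closed_subset_Gamma_beta:
  assumes root: "primitive_root_of_unity n (cis \<beta>)" and \<phi>: "linear \<phi>" "bij \<phi>" and "T \<subseteq> Gamma_beta \<phi> \<beta>"
  shows "closed T"
proof -
  \<comment> \<open>A finite set containing all powers of \<open>A_beta\<close>, one quaternion for
    each \<open>n\<close>-th root of unity.\<close>
  define P where "P = (\<lambda>z. vector [Re z, Im z, 0, 0] :: quat) ` {z. z ^ n = 1}"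
  have n: "n > 0" "cis \<beta> ^ n = 1" using root by (auto simp: primitive_root_of_unity_def)
  then have "finite P" unfolding P_def by (intro finite_imageI finite_roots_unity) simp
  have P: "A_beta (of_int m * \<beta>) \<in> P" for m
  proof -
    have "cis (of_int m * \<beta>) = cis \<beta> powi m" by (simp add: cis_power_int)
    then have "cis (of_int m * \<beta>) ^ n = 1"
      using n(2) by (metis power_int_1_left power_int_mult power_int_of_nat mult.commute)
    then show ?thesis unfolding P_def A_beta_def by (intro image_eqI[of _ _ "cis (of_int m * \<beta>)"]) simp_all
  qed
  have "closed ({a} \<times> \<phi> ` {r \<in> integer_lattice. (a, \<phi> r) \<in> T})" for a
    using \<phi> by (intro closed_Times closed_singleton closed_injective_linear_image closed_subset_integer_lattice)
      (auto simp: bij_def)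
  then have "closed (\<Union>a\<in>P. {a} \<times> \<phi> ` {r \<in> integer_lattice. (a, \<phi> r) \<in> T})"
    using \<open>finite P\<close> by (intro closed_UN) auto
  moreover have "(\<Union>a\<in>P. {a} \<times> \<phi> ` {r \<in> integer_lattice. (a, \<phi> r) \<in> T}) = T"
  proof (intro equalityI subsetI)
    fix x assume x: "x \<in> T"
    then obtain m r where "r \<in> integer_lattice" "x = (A_beta (of_int m * \<beta>), \<phi> r)"
      using assms(4) by (auto simp: Gamma_beta_def A_beta_pow)
    then show "x \<in> (\<Union>a\<in>P. {a} \<times> \<phi> ` {r \<in> integer_lattice. (a, \<phi> r) \<in> T})" using P x by auto
  qed auto
  ultimately show ?thesis by simp
qed

theorem theorem3p1:
  fixes p :: nat and \<beta> :: real and \<phi> :: "real^4 \<Rightarrow> quat"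
  assumes "prime p"
    and "primitive_root_of_unity p (cis \<beta>)"
    and "linear \<phi>" and "bij \<phi>"
    and "\<forall>q\<in>\<phi> ` integer_lattice. A_beta \<beta> \<bullet>\<^sub>q q \<in> \<phi> ` integer_lattice"
  shows "smooth_manifold (M_top \<phi> \<beta>) (M_atlas \<phi> \<beta>) \<and> compact_space (M_top \<phi> \<beta>) \<and>
    (\<exists>\<alpha> \<omega> \<psi>p \<psi>m H.
       diff_form (M_atlas \<phi> \<beta>) 3 H \<and> closed_form (M_atlas \<phi> \<beta>) H \<and>
       generalized_G2_structure (M_atlas \<phi> \<beta>) \<alpha> \<omega> \<psi>p \<psi>m \<and>
       invariant_form \<phi> \<beta> 1 \<alpha> \<and> invariant_form \<phi> \<beta> 2 \<omega> \<and>
       invariant_form \<phi> \<beta> 3 \<psi>p \<and> invariant_form \<phi> \<beta> 3 \<psi>m \<and>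
       weakly_integrable (M_atlas \<phi> \<beta>) H \<alpha> \<omega> \<psi>p \<psi>m)"
proof -
  interpret discrete_quotient "Gamma_beta \<phi> \<beta>"
  proof (rule discrete_quotient.intro)
    show "subgroup (Gamma_beta \<phi> \<beta>) G" using assms by (intro subgroup_Gamma_beta)
    show "closed (Gamma_beta \<phi> \<beta> - {\<one>\<^bsub>G\<^esub>})"
      using assms by (intro closed_subset_Gamma_beta) auto
  qed
  have proj: "M_proj \<phi> \<beta> = proj" by (simp add: fun_eq_iff M_proj_def proj_def)
  have top: "M_top \<phi> \<beta> = qtop" by (simp add: M_top_def qtop_def proj)
  have atlas: "M_atlas \<phi> \<beta> = qatlas" by (simp add: M_atlas_def qatlas_def proj)
  have "compact_space qtop"
  proof (rule compact_space_qtop)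
    let ?K = "sphere 0 1 \<times> \<phi> ` cbox 0 (\<chi> i. 1) :: (quat \<times> quat) set"
    show "compact ?K"
      using assms(3)
      by (intro compact_Times compact_sphere compact_continuous_image linear_continuous_on compact_cbox)
        (simp add: linear_conv_bounded_linear)
    show "?K \<subseteq> carrier G" by (auto simp: carrier_G)
    show "proj ` carrier G \<subseteq> proj ` ?K"
    proof
      fix P assume "P \<in> proj ` carrier G"
      then obtain a q where aq: "(a, q) \<in> carrier G" "P = proj (a, q)" by auto
      obtain r where r: "q = \<phi> r" using assms(4) by (metis bij_pointE)
      \<comment> \<open>Subtracting the componentwise floor moves \<open>r\<close> into the unit
        cube. The group element that does this has exponent 0, so it leaves the factor
        \<open>a\<close> untouched.\<close>
      define k where "k = (\<chi> i. real_of_int \<lfloor>r $ i\<rfloor>)"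
      have "- k \<in> integer_lattice" by (simp add: integer_lattice_def k_def)
      then have "(A_beta \<beta> [^]\<^bsub>SU2\<^esub> (0::int), \<phi> (- k)) \<in> Gamma_beta \<phi> \<beta>" unfolding Gamma_beta_def by blast
      then have \<gamma>: "(vector [1, 0, 0, 0], \<phi> (- k)) \<in> Gamma_beta \<phi> \<beta>" by (simp add: SU2_def)
      have "(vector [1, 0, 0, 0], \<phi> (- k)) \<otimes>\<^bsub>G\<^esub> (a, q) = (a, \<phi> (r - k))"
        using assms(3) by (simp add: mult_G r linear_neg linear_diff)
      then have "P = proj (a, \<phi> (r - k))"
        unfolding aq(2) using aq(1) \<gamma> by (subst proj_eq_iff) (auto simp: carrier_G intro!: bexI[OF _ \<gamma>])
      moreover have "r - k \<in> cbox 0 (\<chi> i. 1)"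
        unfolding mem_box_cart k_def
      proof
        fix i
        have "0 \<le> r $ i - real_of_int \<lfloor>r $ i\<rfloor>" "r $ i - real_of_int \<lfloor>r $ i\<rfloor> \<le> 1" by linarith+
        then show "0 $ i \<le> (r - (\<chi> i. real_of_int \<lfloor>r $ i\<rfloor>)) $ i \<and>
            (r - (\<chi> i. real_of_int \<lfloor>r $ i\<rfloor>)) $ i \<le> (\<chi> i. 1) $ i"
          by (simp only: vector_minus_component vec_lambda_beta zero_index simp_thms)
      qed
      ultimately show "P \<in> proj ` ?K" using aq(1) by (auto simp: carrier_G)
    qed
  qed
  moreover have "invariant_form \<phi> \<beta> k (quotient_form S)" if "alternating_form k S" "smooth_left_form S" for k S
    unfolding invariant_form_def atlas proj
    using diff_form_left_form[OF that] left_invariant_left_form pulls_back_proj by blast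
  note inv = this[OF alternating_form_coframe[of 7] smooth_left_form_coframe]
    this[OF alternating_form_0(1) smooth_left_form_0(1)] this[OF alternating_form_0(2) smooth_left_form_0(2)]
    this[OF alternating_form_0(3) smooth_left_form_0(3)]
  have "diff_form qatlas 3 (quotient_form flux0)"
    by (rule diff_form_quotient_form[OF alternating_form_0(4) smooth_left_form_0(4)])
  ultimately show ?thesis
    unfolding top atlas
    using smooth_manifold_quotient closed_quotient_flux generalized_G2_quotient inv weakly_integrable_quotient
    by blast
qed

end
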